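(* Let $X$ be a reduced $\mathbf{Q}$-scheme endowed with a vector field $\vec{\mathscr{V}}$. Then the Carrà Ferro sheaf and the Keigher sheaf have the same constants: for every open set $U$ of $X^{\vec{\mathscr{V}}}$, $$C\left(\mathscr{O}_{X^{\vec{\mathscr{V}}}}^{\mathrm{(Keigher)}}(U)\right)\simeq C\left(\mathscr{O}_{X^{\vec{\mathscr{V}}}}^{\mathrm{(CF)}}(U)\right).$$
   Context: Rings are commutative with unit. A vector field $\vec{\mathscr{V}}$ on a scheme $X$ is a derivation of the structure sheaf $\mathscr{O}_X$, i.e. a family of derivations $\partial_U$ of the rings $\mathscr{O}_X(U)$, $U\subset X$ open, compatible with the restriction maps. It induces a derivation $\partial_x$ of each local ring $\mathscr{O}_{X,x}$, with maximal ideal $\mathfrak{M}_x$ and residue field $\kappa(x)$. The tangent vector $\vec{\mathscr{V}}(x)\in \mathrm{Hom}_{\kappa(x)}(\mathfrak{M}_x/\mathfrak{M}_x^2,\kappa(x))$ is the map induced by $f\mapsto \partial_x(f)\bmod\mathfrak{M}_x$. A point $\eta$ is a leaf if $\vec{\mathscr{V}}(\eta)=0$; $X^{\vec{\mathscr{V}}}\subset X$ is the set of leaves, with the topology induced by the Zariski topology. Write $z\leadsto y$ if $y\in\overline{\{z\}}$, and order points by $z\geq y$ iff $z\leadsto y$. When $X$ is a $\mathbf{Q}$-scheme, for each $x\in X$ the set of leaves $\eta$ with $\eta\leadsto x$ has a least element, denoted $\mathrm{Traj}_{\vec{\mathscr{V}}}(x)$. The map $\mathrm{Traj}_{\vec{\mathscr{V}}}:X\to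 X^{\vec{\mathscr{V}}}$ is continuous. The Keigher sheaf is $\mathscr{O}_{X^{\vec{\mathscr{V}}}}^{\mathrm{(Keigher)}}=(i_{\mathrm{Zar}})^{-1}\mathscr{O}_X$, where $i_{\mathrm{Zar}}:X^{\vec{\mathscr{V}}}\to X$ is the inclusion ($X$ with the Zariski topology); that is, the sheaf associated to the presheaf $U\mapsto \varinjlim_{V\supset U,\ V \text{ open in } X}\mathscr{O}_X(V)$. The Carrà Ferro sheaf is $\mathscr{O}_{X^{\vec{\mathscr{V}}}}^{\mathrm{(CF)}}=(\mathrm{Traj}_{\vec{\mathscr{V}}})_*\mathscr{O}_X$, i.e. $U\mapsto \mathscr{O}_X(\{x\in X\mid \mathrm{Traj}_{\vec{\mathscr{V}}}(x)\in U\})$. Both are sheaves of differential rings. For a differential ring $(A,\partial)$, $C(A)=\{a\in A\mid\partial(a)=0\}$ is its ring of constants; $\simeq$ denotes isomorphism of rings. *)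

theory Defs
  imports
    "HOL-Analysis.Abstract_Topology"
    "HOL-Algebra.QuotRing"
    "HOL-Algebra.Ideal_Product"
    "HOL-Algebra.Algebraic_Closure_Type"
begin

section \<open>Sheaves of rings\<close>

text \<open>
  \<open>restr F U V\<close> is the restriction map from \<open>sections F U\<close> to \<open>sections F V\<close>.  Only its values for
  open sets \<open>V \<subseteq> U\<close> and on the carrier of \<open>sections F U\<close> matter.  A ringed space is represented by
  its structure sheaf, which carries the underlying topological space in the field \<open>base\<close>.
\<close>

record ('a, 'b) presheaf =
  base :: "'a topology"
  sections :: "'a set \<Rightarrow> 'b ring"
  restr :: "'a set \<Rightarrow> 'a set \<Rightarrow> 'b \<Rightarrow> 'b"

definition presheaf_of_rings :: "('a, 'b) presheaf \<Rightarrow> bool" where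
  "presheaf_of_rings F \<longleftrightarrow>
     (\<forall>U. openin (base F) U \<longrightarrow> cring (sections F U)) \<and>
     (\<forall>U V. openin (base F) U \<and> openin (base F) V \<and> V \<subseteq> U \<longrightarrow>
        restr F U V \<in> ring_hom (sections F U) (sections F V)) \<and>
     (\<forall>U. openin (base F) U \<longrightarrow> (\<forall>s\<in>carrier (sections F U). restr F U U s = s)) \<and>
     (\<forall>U V W. openin (base F) U \<and> openin (base F) V \<and> openin (base F) W \<and> W \<subseteq> V \<and> V \<subseteq> U \<longrightarrow>
        (\<forall>s\<in>carrier (sections F U). restr F V W (restr F U V s) = restr F U W s))"

definition sheaf_of_rings :: "('a, 'b) presheaf \<Rightarrow> bool" where
  "sheaf_of_rings F \<longleftrightarrow> presheaf_of_rings F \<and>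
     (\<forall>\<U>. (\<forall>V\<in>\<U>. openin (base F) V) \<longrightarrow>
        (\<forall>s\<in>carrier (sections F (\<Union>\<U>)). \<forall>t\<in>carrier (sections F (\<Union>\<U>)).
           (\<forall>V\<in>\<U>. restr F (\<Union>\<U>) V s = restr F (\<Union>\<U>) V t) \<longrightarrow> s = t) \<and>
        (\<forall>\<sigma>. (\<forall>V\<in>\<U>. \<sigma> V \<in> carrier (sections F V)) \<and>
             (\<forall>V\<in>\<U>. \<forall>W\<in>\<U>. restr F V (V \<inter> W) (\<sigma> V) = restr F W (V \<inter> W) (\<sigma> W)) \<longrightarrow>
             (\<exists>s\<in>carrier (sections F (\<Union>\<U>)). \<forall>V\<in>\<U>. restr F (\<Union>\<U>) V s = \<sigma> V)))"

text \<open>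
  The direct limit of \<open>F(V)\<close> over the open sets \<open>V\<close> containing a fixed set \<open>A\<close> of points, as the
  set of equivalence classes of pairs \<open>(V, s)\<close> with \<open>s \<in> F(V)\<close>.
\<close>

definition germ_rel ::
    "('a, 'b) presheaf \<Rightarrow> 'a set \<Rightarrow> (('a set \<times> 'b) \<times> ('a set \<times> 'b)) set" where
  "germ_rel F A = {((V, s), (W, t)).
     openin (base F) V \<and> A \<subseteq> V \<and> s \<in> carrier (sections F V) \<and>
     openin (base F) W \<and> A \<subseteq> W \<and> t \<in> carrier (sections F W) \<and>
     (\<exists>Z. openin (base F) Z \<and> A \<subseteq> Z \<and> Z \<subseteq> V \<inter> W \<and> restr F V Z s = restr F W Z t)}"

definition germ :: "('a, 'b) presheaf \<Rightarrow> 'a set \<Rightarrow> 'a set \<Rightarrow> 'b \<Rightarrow> ('a set \<times> 'b) set" where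
  "germ F A V s = germ_rel F A `` {(V, s)}"

definition germ_ring :: "('a, 'b) presheaf \<Rightarrow> 'a set \<Rightarrow> ('a set \<times> 'b) set ring" where
  "germ_ring F A =
     \<lparr>carrier = {germ F A V s | V s. openin (base F) V \<and> A \<subseteq> V \<and> s \<in> carrier (sections F V)},
      monoid.mult = (\<lambda>a b. \<Union>(V, s)\<in>a. \<Union>(W, t)\<in>b.
        germ F A (V \<inter> W)
          (restr F V (V \<inter> W) s \<otimes>\<^bsub>sections F (V \<inter> W)\<^esub> restr F W (V \<inter> W) t)),
      one = germ F A (topspace (base F)) \<one>\<^bsub>sections F (topspace (base F))\<^esub>,
      zero = germ F A (topspace (base F)) \<zero>\<^bsub>sections F (topspace (base F))\<^esub>,
      add = (\<lambda>a b. \<Union>(V, s)\<in>a. \<Union>(W, t)\<in>b.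
        germ F A (V \<inter> W)
          (restr F V (V \<inter> W) s \<oplus>\<^bsub>sections F (V \<inter> W)\<^esub> restr F W (V \<inter> W) t))\<rparr>"

abbreviation stalk :: "('a, 'b) presheaf \<Rightarrow> 'a \<Rightarrow> ('a set \<times> 'b) set ring" where
  "stalk F x \<equiv> germ_ring F {x}"

text \<open>
  The ring with underlying set \<open>S\<close> of families \<open>s\<close> indexed by \<open>U\<close>, \<open>s x\<close> in the ring \<open>P x\<close>, with
  pointwise operations; families are \<open>undefined\<close> outside \<open>U\<close>.
\<close>

definition pointwise_ring ::
    "'a set \<Rightarrow> ('a \<Rightarrow> 'c ring) \<Rightarrow> ('a \<Rightarrow> 'c) set \<Rightarrow> ('a \<Rightarrow> 'c) ring" where
  "pointwise_ring U P S =
     \<lparr>carrier = S,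
      monoid.mult = (\<lambda>s t. \<lambda>x\<in>U. s x \<otimes>\<^bsub>P x\<^esub> t x),
      one = (\<lambda>x\<in>U. \<one>\<^bsub>P x\<^esub>),
      zero = (\<lambda>x\<in>U. \<zero>\<^bsub>P x\<^esub>),
      add = (\<lambda>s t. \<lambda>x\<in>U. s x \<oplus>\<^bsub>P x\<^esub> t x)\<rparr>"

text \<open>
  The sheaf associated to \<open>F\<close>: families of germs that are locally induced by a section of \<open>F\<close>.
\<close>

definition sheafification ::
    "('a, 'b) presheaf \<Rightarrow> ('a, 'a \<Rightarrow> ('a set \<times> 'b) set) presheaf" where
  "sheafification F =
     \<lparr>base = base F,
      sections = (\<lambda>U. pointwise_ring U (stalk F)
        {s \<in> (\<Pi>\<^sub>E x\<in>U. carrier (stalk F x)).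
           \<forall>x\<in>U. \<exists>V. openin (base F) V \<and> x \<in> V \<and> V \<subseteq> U \<and>
             (\<exists>t\<in>carrier (sections F V). \<forall>y\<in>V. s y = germ F {y} V t)}),
      restr = (\<lambda>U V s. restrict s V)\<rparr>"

definition preimage :: "'a topology \<Rightarrow> ('a \<Rightarrow> 'c) \<Rightarrow> 'c set \<Rightarrow> 'a set" where
  "preimage T f V = {x \<in> topspace T. f x \<in> V}"

definition direct_image ::
    "('a \<Rightarrow> 'c) \<Rightarrow> 'c topology \<Rightarrow> ('a, 'b) presheaf \<Rightarrow> ('c, 'b) presheaf" where
  "direct_image f T F =
     \<lparr>base = T,
      sections = (\<lambda>V. sections F (preimage (base F) f V)),
      restr = (\<lambda>V W. restr F (preimage (base F) f V) (preimage (base F) f W))\<rparr>"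

definition inverse_image_presheaf ::
    "('c \<Rightarrow> 'a) \<Rightarrow> 'c topology \<Rightarrow> ('a, 'b) presheaf \<Rightarrow> ('c, ('a set \<times> 'b) set) presheaf" where
  "inverse_image_presheaf i T F =
     \<lparr>base = T,
      sections = (\<lambda>U. germ_ring F (i ` U)),
      restr = (\<lambda>U U' c. \<Union>(V, s)\<in>c. germ F (i ` U') V s)\<rparr>"

definition open_restriction :: "('a, 'b) presheaf \<Rightarrow> 'a set \<Rightarrow> ('a, 'b) presheaf" where
  "open_restriction F U = F\<lparr>base := subtopology (base F) U\<rparr>"


section \<open>Locally ringed spaces\<close>

definition local_ring :: "('b, 'm) ring_scheme \<Rightarrow> bool" where
  "local_ring R \<longleftrightarrow> cring R \<and> (\<exists>!M. maximalideal M R)"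

definition max_ideal :: "('b, 'm) ring_scheme \<Rightarrow> 'b set" where
  "max_ideal R = (THE M. maximalideal M R)"

definition locally_ringed_space :: "('a, 'b) presheaf \<Rightarrow> bool" where
  "locally_ringed_space \<X> \<longleftrightarrow>
     sheaf_of_rings \<X> \<and> (\<forall>x\<in>topspace (base \<X>). local_ring (stalk \<X> x))"

text \<open>
  A morphism from \<open>\<X>\<close> to \<open>Y\<close> is a continuous map \<open>f\<close> together with a morphism \<open>\<phi>\<close> of sheaves from
  the structure sheaf of \<open>Y\<close> to the direct image of that of \<open>\<X>\<close>, which is local on stalks.
\<close>

definition stalk_map ::
    "('a, 'b) presheaf \<Rightarrow> ('a \<Rightarrow> 'c) \<Rightarrow> ('c set \<Rightarrow> 'd \<Rightarrow> 'b) \<Rightarrow> 'a \<Rightarrow>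
     ('c set \<times> 'd) set \<Rightarrow> ('a set \<times> 'b) set" where
  "stalk_map \<X> f \<phi> x c = (\<Union>(V, s)\<in>c. germ \<X> {x} (preimage (base \<X>) f V) (\<phi> V s))"

definition lrs_morphism ::
    "('a, 'b) presheaf \<Rightarrow> ('c, 'd) presheaf \<Rightarrow> ('a \<Rightarrow> 'c) \<Rightarrow> ('c set \<Rightarrow> 'd \<Rightarrow> 'b) \<Rightarrow> bool" where
  "lrs_morphism \<X> Y f \<phi> \<longleftrightarrow>
     continuous_map (base \<X>) (base Y) f \<and>
     (\<forall>V. openin (base Y) V \<longrightarrow>
        \<phi> V \<in> ring_hom (sections Y V) (sections (direct_image f (base Y) \<X>) V)) \<and>
     (\<forall>V W. openin (base Y) V \<and> openin (base Y) W \<and> W \<subseteq> V \<longrightarrow>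
        (\<forall>s\<in>carrier (sections Y V).
           restr (direct_image f (base Y) \<X>) V W (\<phi> V s) = \<phi> W (restr Y V W s))) \<and>
     (\<forall>x\<in>topspace (base \<X>).
        {c \<in> carrier (stalk Y (f x)). stalk_map \<X> f \<phi> x c \<in> max_ideal (stalk \<X> x)}
          = max_ideal (stalk Y (f x)))"

definition lrs_isomorphism ::
    "('a, 'b) presheaf \<Rightarrow> ('c, 'd) presheaf \<Rightarrow> ('a \<Rightarrow> 'c) \<Rightarrow> ('c set \<Rightarrow> 'd \<Rightarrow> 'b) \<Rightarrow> bool" where
  "lrs_isomorphism \<X> Y f \<phi> \<longleftrightarrow> lrs_morphism \<X> Y f \<phi> \<and>
     homeomorphic_map (base \<X>) (base Y) f \<and>
     (\<forall>V. openin (base Y) V \<longrightarrow>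
        \<phi> V \<in> ring_iso (sections Y V) (sections (direct_image f (base Y) \<X>) V))"


section \<open>Schemes\<close>

definition zariski :: "('b, 'm) ring_scheme \<Rightarrow> 'b set topology" where
  "zariski R = topology (\<lambda>U. \<exists>S \<subseteq> carrier R. U = {p. primeideal p R \<and> \<not> S \<subseteq> p})"

lemma istopology_zariski:
  assumes "cring R"
  shows "istopology (\<lambda>U. \<exists>S \<subseteq> carrier R. U = {p. primeideal p R \<and> \<not> S \<subseteq> p})"
    (is "istopology ?L")
  unfolding istopology_def
proof (intro conjI allI impI)
  interpret cring R by (fact assms)
  fix U V assume "?L U" "?L V"
  then obtain S T where S: "S \<subseteq> carrier R" "U = {p. primeideal p R \<and> \<not> S \<subseteq> p}"
    and T: "T \<subseteq> carrier R" "V = {p. primeideal p R \<and> \<not> T \<subseteq> p}" by blast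
  let ?P = "{s \<otimes>\<^bsub>R\<^esub> t | s t. s \<in> S \<and> t \<in> T}"
  have key: "?P \<subseteq> p \<longleftrightarrow> S \<subseteq> p \<or> T \<subseteq> p" if "primeideal p R" for p
  proof -
    interpret p: primeideal p R by (fact that)
    show ?thesis
    proof
      assume P: "?P \<subseteq> p"
      show "S \<subseteq> p \<or> T \<subseteq> p"
      proof (rule ccontr)
        assume "\<not> (S \<subseteq> p \<or> T \<subseteq> p)"
        then obtain s t where st: "s \<in> S" "s \<notin> p" "t \<in> T" "t \<notin> p" by blast
        then have "s \<otimes>\<^bsub>R\<^esub> t \<in> p" using P by blast
        then show False using p.I_prime[of s t] st S(1) T(1) by blast
      qed
    next
      assume "S \<subseteq> p \<or> T \<subseteq> p"
      then show "?P \<subseteq> p" using S(1) T(1) p.I_l_closed p.I_r_closed by blast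
    qed
  qed
  have "?P \<subseteq> carrier R" using S(1) T(1) by blast
  moreover have "U \<inter> V = {p. primeideal p R \<and> \<not> ?P \<subseteq> p}"
    using S(2) T(2) key by blast
  ultimately show "?L (U \<inter> V)" by blast
next
  fix \<K> assume K: "\<forall>K\<in>\<K>. ?L K"
  let ?S = "\<Union>{S. S \<subseteq> carrier R \<and> {p. primeideal p R \<and> \<not> S \<subseteq> p} \<in> \<K>}"
  have "\<Union>\<K> = {p. primeideal p R \<and> \<not> ?S \<subseteq> p}"
  proof (intro Set.set_eqI iffI)
    fix p assume "p \<in> \<Union>\<K>"
    then obtain K where KK: "K \<in> \<K>" "p \<in> K" by blast
    then obtain S where "S \<subseteq> carrier R" "K = {p. primeideal p R \<and> \<not> S \<subseteq> p}"
      using K by meson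
    with KK show "p \<in> {p. primeideal p R \<and> \<not> ?S \<subseteq> p}" by blast
  next
    fix p assume "p \<in> {p. primeideal p R \<and> \<not> ?S \<subseteq> p}"
    then show "p \<in> \<Union>\<K>" by blast
  qed
  moreover have "?S \<subseteq> carrier R" by blast
  ultimately show "?L (\<Union>\<K>)" by blast
qed

definition frac_rel ::
    "('b, 'm) ring_scheme \<Rightarrow> 'b set \<Rightarrow> (('b \<times> 'b) \<times> ('b \<times> 'b)) set" where
  "frac_rel R S = {((a, s), (b, t)).
     a \<in> carrier R \<and> s \<in> S \<and> b \<in> carrier R \<and> t \<in> S \<and>
     (\<exists>u\<in>S. u \<otimes>\<^bsub>R\<^esub> (a \<otimes>\<^bsub>R\<^esub> t) = u \<otimes>\<^bsub>R\<^esub> (b \<otimes>\<^bsub>R\<^esub> s))}"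

definition loc_frac :: "('b, 'm) ring_scheme \<Rightarrow> 'b set \<Rightarrow> 'b \<Rightarrow> 'b \<Rightarrow> ('b \<times> 'b) set" where
  "loc_frac R S a s = frac_rel R S `` {(a, s)}"

definition localization :: "('b, 'm) ring_scheme \<Rightarrow> 'b set \<Rightarrow> ('b \<times> 'b) set ring" where
  "localization R S =
     \<lparr>carrier = {loc_frac R S a s | a s. a \<in> carrier R \<and> s \<in> S},
      monoid.mult = (\<lambda>x y. \<Union>(a, s)\<in>x. \<Union>(b, t)\<in>y. loc_frac R S (a \<otimes>\<^bsub>R\<^esub> b) (s \<otimes>\<^bsub>R\<^esub> t)),
      one = loc_frac R S \<one>\<^bsub>R\<^esub> \<one>\<^bsub>R\<^esub>,
      zero = loc_frac R S \<zero>\<^bsub>R\<^esub> \<one>\<^bsub>R\<^esub>,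
      add = (\<lambda>x y. \<Union>(a, s)\<in>x. \<Union>(b, t)\<in>y.
        loc_frac R S (a \<otimes>\<^bsub>R\<^esub> t \<oplus>\<^bsub>R\<^esub> b \<otimes>\<^bsub>R\<^esub> s) (s \<otimes>\<^bsub>R\<^esub> t))\<rparr>"

definition spec :: "('b, 'm) ring_scheme \<Rightarrow> ('b set, 'b set \<Rightarrow> ('b \<times> 'b) set) presheaf" where
  "spec R =
     \<lparr>base = zariski R,
      sections = (\<lambda>U. pointwise_ring U (\<lambda>p. localization R (carrier R - p))
        {s \<in> (\<Pi>\<^sub>E p\<in>U. carrier (localization R (carrier R - p))).
           \<forall>p\<in>U. \<exists>V. openin (zariski R) V \<and> p \<in> V \<and> V \<subseteq> U \<and>
             (\<exists>a\<in>carrier R. \<exists>f\<in>carrier R. \<forall>q\<in>V. f \<notin> q \<and> s q = loc_frac R (carrier R - q) a f)}),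
      restr = (\<lambda>U V s. restrict s V)\<rparr>"

text \<open>
  If \<open>\<X>\<close> is isomorphic to the spectrum of a ring, then this ring is isomorphic to the ring of
  global sections of \<open>\<X>\<close>; hence it is no restriction to quantify only over rings whose elements
  have the same type as the sections of \<open>\<X>\<close>.
\<close>

definition affine_scheme :: "('a, 'b) presheaf \<Rightarrow> bool" where
  "affine_scheme \<X> \<longleftrightarrow> locally_ringed_space \<X> \<and>
     (\<exists>(R :: 'b ring) f \<phi>. cring R \<and> lrs_isomorphism \<X> (spec R) f \<phi>)"

definition scheme :: "('a, 'b) presheaf \<Rightarrow> bool" where
  "scheme \<X> \<longleftrightarrow> locally_ringed_space \<X> \<and>
     (\<forall>x\<in>topspace (base \<X>). \<exists>U. openin (base \<X>) U \<and> x \<in> U \<and> affine_scheme (open_restriction \<X> U))"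

text \<open>
  The structure morphism to the spectrum of the rational numbers is unique if it exists, so it is
  not recorded.
\<close>

definition Q_scheme :: "('a, 'b) presheaf \<Rightarrow> bool" where
  "Q_scheme \<X> \<longleftrightarrow> scheme \<X> \<and>
     (\<exists>f \<phi>. lrs_morphism \<X> (spec (ring_of_type_algebra :: rat ring)) f \<phi>)"

definition reduced_ring :: "('b, 'm) ring_scheme \<Rightarrow> bool" where
  "reduced_ring R \<longleftrightarrow> (\<forall>a\<in>carrier R. \<forall>n::nat. a [^]\<^bsub>R\<^esub> n = \<zero>\<^bsub>R\<^esub> \<longrightarrow> a = \<zero>\<^bsub>R\<^esub>)"

definition reduced :: "('a, 'b) presheaf \<Rightarrow> bool" where
  "reduced \<X> \<longleftrightarrow> (\<forall>U. openin (base \<X>) U \<longrightarrow> reduced_ring (sections \<X> U))"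


section \<open>Derivations and vector fields\<close>

definition derivation :: "('b, 'm) ring_scheme \<Rightarrow> ('b \<Rightarrow> 'b) \<Rightarrow> bool" where
  "derivation R d \<longleftrightarrow> d \<in> carrier R \<rightarrow> carrier R \<and>
     (\<forall>a\<in>carrier R. \<forall>b\<in>carrier R. d (a \<oplus>\<^bsub>R\<^esub> b) = d a \<oplus>\<^bsub>R\<^esub> d b) \<and>
     (\<forall>a\<in>carrier R. \<forall>b\<in>carrier R.
        d (a \<otimes>\<^bsub>R\<^esub> b) = (a \<otimes>\<^bsub>R\<^esub> d b) \<oplus>\<^bsub>R\<^esub> (d a \<otimes>\<^bsub>R\<^esub> b))"

definition constants :: "'b ring \<Rightarrow> ('b \<Rightarrow> 'b) \<Rightarrow> 'b ring" where
  "constants R d = R\<lparr>carrier := {a \<in> carrier R. d a = \<zero>\<^bsub>R\<^esub>}\<rparr>"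

definition vector_field :: "('a, 'b) presheaf \<Rightarrow> ('a set \<Rightarrow> 'b \<Rightarrow> 'b) \<Rightarrow> bool" where
  "vector_field \<X> D \<longleftrightarrow>
     (\<forall>U. openin (base \<X>) U \<longrightarrow> derivation (sections \<X> U) (D U)) \<and>
     (\<forall>U V. openin (base \<X>) U \<and> openin (base \<X>) V \<and> V \<subseteq> U \<longrightarrow>
        (\<forall>s\<in>carrier (sections \<X> U). restr \<X> U V (D U s) = D V (restr \<X> U V s)))"

definition germ_der ::
    "('a, 'b) presheaf \<Rightarrow> ('a set \<Rightarrow> 'b \<Rightarrow> 'b) \<Rightarrow> 'a set \<Rightarrow> ('a set \<times> 'b) set \<Rightarrow> ('a set \<times> 'b) set" where
  "germ_der F D A c = (\<Union>(V, s)\<in>c. germ F A V (D V s))"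

definition sheafification_der ::
    "('a, 'b) presheaf \<Rightarrow> ('a set \<Rightarrow> 'b \<Rightarrow> 'b) \<Rightarrow> 'a set \<Rightarrow>
     ('a \<Rightarrow> ('a set \<times> 'b) set) \<Rightarrow> 'a \<Rightarrow> ('a set \<times> 'b) set" where
  "sheafification_der F D U s = (\<lambda>x\<in>U. germ_der F D {x} (s x))"

text \<open>
  The tangent vector at \<open>x\<close> as a map on the cosets of \<open>M\<^sup>2\<close> in \<open>M\<close>, where \<open>M\<close> is the maximal
  ideal of the local ring at \<open>x\<close>.  The union is over all representatives \<open>f\<close> of the coset \<open>c\<close>,
  which all yield the same element of the residue field.
\<close>

definition residue_field :: "('a, 'b) presheaf \<Rightarrow> 'a \<Rightarrow> ('a set \<times> 'b) set set ring" where
  "residue_field \<X> x = stalk \<X> x Quot max_ideal (stalk \<X> x)"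

definition cotangent_space :: "('a, 'b) presheaf \<Rightarrow> 'a \<Rightarrow> ('a set \<times> 'b) set set set" where
  "cotangent_space \<X> x =
     (let R = stalk \<X> x; M = max_ideal R in {ideal_prod R M M +>\<^bsub>R\<^esub> f | f. f \<in> M})"

definition tangent_vector ::
    "('a, 'b) presheaf \<Rightarrow> ('a set \<Rightarrow> 'b \<Rightarrow> 'b) \<Rightarrow> 'a \<Rightarrow>
     ('a set \<times> 'b) set set \<Rightarrow> ('a set \<times> 'b) set set" where
  "tangent_vector \<X> D x =
     (\<lambda>c\<in>cotangent_space \<X> x.
        \<Union>f\<in>c. max_ideal (stalk \<X> x) +>\<^bsub>stalk \<X> x\<^esub> germ_der \<X> D {x} f)"

definition leaves :: "('a, 'b) presheaf \<Rightarrow> ('a set \<Rightarrow> 'b \<Rightarrow> 'b) \<Rightarrow> 'a set" where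
  "leaves \<X> D = {\<eta> \<in> topspace (base \<X>).
     \<forall>c\<in>cotangent_space \<X> \<eta>. tangent_vector \<X> D \<eta> c = \<zero>\<^bsub>residue_field \<X> \<eta>\<^esub>}"

definition leaf_space :: "('a, 'b) presheaf \<Rightarrow> ('a set \<Rightarrow> 'b \<Rightarrow> 'b) \<Rightarrow> 'a topology" where
  "leaf_space \<X> D = subtopology (base \<X>) (leaves \<X> D)"

definition specializes :: "'a topology \<Rightarrow> 'a \<Rightarrow> 'a \<Rightarrow> bool" where
  "specializes T z y \<longleftrightarrow> y \<in> T closure_of {z}"

text \<open>
  Points are ordered by \<open>z \<ge> y\<close> iff \<open>z\<close> specializes to \<open>y\<close>, so the least leaf \<open>\<eta>\<close> specializing
  to \<open>x\<close> is the one to which all other leaves specializing to \<open>x\<close> specialize.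
\<close>

definition traj :: "('a, 'b) presheaf \<Rightarrow> ('a set \<Rightarrow> 'b \<Rightarrow> 'b) \<Rightarrow> 'a \<Rightarrow> 'a" where
  "traj \<X> D x = (THE \<eta>. \<eta> \<in> leaves \<X> D \<and> specializes (base \<X>) \<eta> x \<and>
     (\<forall>\<eta>'\<in>leaves \<X> D. specializes (base \<X>) \<eta>' x \<longrightarrow> specializes (base \<X>) \<eta>' \<eta>))"


section \<open>The Keigher sheaf and the Carra Ferro sheaf\<close>

definition keigher_presheaf ::
    "('a, 'b) presheaf \<Rightarrow> ('a set \<Rightarrow> 'b \<Rightarrow> 'b) \<Rightarrow> ('a, ('a set \<times> 'b) set) presheaf" where
  "keigher_presheaf \<X> D = inverse_image_presheaf (\<lambda>\<eta>. \<eta>) (leaf_space \<X> D) \<X>"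

definition keigher_sheaf ::
    "('a, 'b) presheaf \<Rightarrow> ('a set \<Rightarrow> 'b \<Rightarrow> 'b) \<Rightarrow>
     ('a, 'a \<Rightarrow> ('a set \<times> ('a set \<times> 'b) set) set) presheaf" where
  "keigher_sheaf \<X> D = sheafification (keigher_presheaf \<X> D)"

definition keigher_der ::
    "('a, 'b) presheaf \<Rightarrow> ('a set \<Rightarrow> 'b \<Rightarrow> 'b) \<Rightarrow> 'a set \<Rightarrow>
     ('a \<Rightarrow> ('a set \<times> ('a set \<times> 'b) set) set) \<Rightarrow>
     ('a \<Rightarrow> ('a set \<times> ('a set \<times> 'b) set) set)" where
  "keigher_der \<X> D = sheafification_der (keigher_presheaf \<X> D) (germ_der \<X> D)"

definition carra_ferro_sheaf ::
    "('a, 'b) presheaf \<Rightarrow> ('a set \<Rightarrow> 'b \<Rightarrow> 'b) \<Rightarrow> ('a, 'b) presheaf" where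
  "carra_ferro_sheaf \<X> D = direct_image (traj \<X> D) (leaf_space \<X> D) \<X>"

definition carra_ferro_der ::
    "('a, 'b) presheaf \<Rightarrow> ('a set \<Rightarrow> 'b \<Rightarrow> 'b) \<Rightarrow> 'a set \<Rightarrow> 'b \<Rightarrow> 'b" where
  "carra_ferro_der \<X> D U = D (preimage (base \<X>) (traj \<X> D) U)"

end

theory Submission
  imports Defs
begin

text \<open>
  Let \<open>U\<close> be an open set of leaves and \<open>W\<close> the set of points whose trajectory lies in \<open>U\<close>, so that
  the Carra Ferro sections over \<open>U\<close> are the sections of the structure sheaf over \<open>W\<close>.  Restricting such a
  section to its germs at the leaves in \<open>U\<close> gives a section of the Keigher sheaf, and this restriction
  is shown to be bijective on constants.

  Let \<open>V\<close> be an affine open neighbourhood of \<open>x\<close>.  The trajectory of \<open>x\<close> is the point of \<open>V\<close> whose ideal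
  consists of the sections all of whose iterated derivatives vanish at \<open>x\<close>.  This is the largest
  ideal closed under the derivation inside the ideal of \<open>x\<close>, and it is prime because positive integers
  are invertible (\<open>primeideal_diff_interior\<close>, \<open>traj_in_chart\<close>).  The description gives continuity of
  the trajectory map (\<open>opn_traj_preimage\<close>), hence openness of \<open>W\<close>.  It also gives the principle that
  carries the proof (\<open>escape_core\<close>): a set of sections over \<open>V\<close> that is closed under the derivation, and
  one of whose elements does not vanish at the trajectory of \<open>x\<close>, has an element that does not vanish at
  \<open>x\<close>.

  Injectivity: if a section is zero near the trajectory of \<open>x\<close>, it is zero near \<open>x\<close>.  Apply the
  principle to its annihilator, which is closed under the derivation because the scheme is reduced
  (\<open>zero_if_zero_at_leaves\<close>).

  Surjectivity on constants: a constant section of the Keigher sheaf is represented near each leaf by a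
  constant section of the structure sheaf.  By injectivity these representatives glue to a constant \<open>s\<close>
  over an open set containing \<open>U\<close>.  To extend \<open>s\<close> to a neighbourhood of \<open>x\<close> in \<open>W\<close>, apply the principle
  to its denominators, that is the sections \<open>b\<close> over \<open>V\<close> for which \<open>b s\<close> extends to \<open>V\<close>; they are
  closed under the derivation because \<open>s\<close> is constant (\<open>extend_constant\<close>).  The extensions agree on
  overlaps, again by injectivity.

  Reducedness has a second role.  A function that vanishes at every point is zero
  (\<open>nowhere_invertible_zero\<close>), so a local fraction \<open>a / g\<close> satisfies \<open>g\<^sup>2 s = g a\<close> on the whole domain of
  \<open>s\<close> (\<open>chart_clear_denominator\<close>).  This identifies the prime ideals below the ideal of \<open>x\<close>, in the ring of
  sections over an affine open set, with the points specializing to \<open>x\<close> (\<open>chart_point\<close>).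
\<close>

section \<open>Prime ideals\<close>

text \<open>
  An ideal maximal among those containing no power of \<open>a\<close> is prime: if it contained \<open>x \<otimes> y\<close> but
  neither factor, then enlarging it by \<open>x\<close> and by \<open>y\<close> would catch two powers of \<open>a\<close>, whose product
  lies in the ideal.
\<close>

theorem (in cring) nilpotent_if_in_all_primes:
  assumes a: "a \<in> carrier R" and primes: "\<And>p. primeideal p R \<Longrightarrow> a \<in> p"
  shows "\<exists>n::nat. a [^] n = \<zero>"
proof (rule ccontr)
  assume nil: "\<nexists>n::nat. a [^] n = \<zero>"
  define \<A> where "\<A> = {I. ideal I R \<and> (\<forall>n::nat. a [^] n \<notin> I)}"
  have "{\<zero>} \<in> \<A>" using nil zeroideal by (auto simp: \<A>_def)
  moreover have "\<Union>C \<in> \<A>" if C: "C \<noteq> {}" "subset.chain \<A> C" for C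
  proof -
    have "subset.chain {I. ideal I R} C"
      using C(2) by (auto simp: pred_on.chain_def \<A>_def)
    from chain_Union_is_ideal[OF this] C show ?thesis
      by (auto simp: \<A>_def pred_on.chain_def)
  qed
  ultimately obtain M where M: "M \<in> \<A>" and max: "\<And>I. I \<in> \<A> \<Longrightarrow> M \<subseteq> I \<Longrightarrow> I = M"
    using subset_Zorn_nonempty[of \<A>] by blast
  interpret M: ideal M R using M by (simp add: \<A>_def)
  have meets: "\<exists>n::nat. \<exists>m\<in>M. \<exists>r\<in>carrier R. a [^] n = m \<oplus> r \<otimes> x"
    if x: "x \<in> carrier R" "x \<notin> M" for x
  proof -
    have I: "ideal (M <+> PIdl x) R"
      by (rule add_ideals[OF M.is_ideal cgenideal_ideal[OF x(1)]])
    have "M \<subseteq> M <+> PIdl x"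
    proof
      fix m assume m: "m \<in> M"
      then have "m = m \<oplus> \<zero> \<otimes> x" using x M.Icarr by simp
      then show "m \<in> M <+> PIdl x"
        using m unfolding set_add_def' cgenideal_def by blast
    qed
    moreover have "x \<in> M <+> PIdl x"
    proof -
      have "x = \<zero> \<oplus> \<one> \<otimes> x" using x by simp
      then show ?thesis
        using M.zero_closed unfolding set_add_def' cgenideal_def by blast
    qed
    ultimately have "M <+> PIdl x \<notin> \<A>" using max x(2) by blast
    then obtain n :: nat where "a [^] n \<in> M <+> PIdl x" using I by (auto simp: \<A>_def)
    then show ?thesis unfolding set_add_def' cgenideal_def by blast
  qed
  have "primeideal M R"
  proof (rule primeidealI[OF M.is_ideal is_cring])
    have "a [^] (0::nat) \<notin> M" using M unfolding \<A>_def by blast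
    then show "carrier R \<noteq> M" by auto
    fix x y assume xy: "x \<in> carrier R" "y \<in> carrier R" "x \<otimes> y \<in> M"
    show "x \<in> M \<or> y \<in> M"
    proof (rule ccontr)
      assume "\<not> (x \<in> M \<or> y \<in> M)"
      then obtain n k :: nat and m m' r r'
        where n: "m \<in> M" "r \<in> carrier R" "a [^] n = m \<oplus> r \<otimes> x"
          and k: "m' \<in> M" "r' \<in> carrier R" "a [^] k = m' \<oplus> r' \<otimes> y"
        using meets xy by meson
      have mc: "m \<in> carrier R" "m' \<in> carrier R" using n k M.Icarr by auto
      have "a [^] (n + k) = (m \<oplus> r \<otimes> x) \<otimes> (m' \<oplus> r' \<otimes> y)"
        using nat_pow_mult[OF a, of n k] n k by simp
      also have "\<dots> = (m \<otimes> (m' \<oplus> r' \<otimes> y) \<oplus> (r \<otimes> x) \<otimes> m') \<oplus> (r \<otimes> r') \<otimes> (x \<otimes> y)"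
        using mc n k xy by algebra
      also have "\<dots> \<in> M"
        using mc n k xy M.a_closed M.I_l_closed M.I_r_closed by simp
      finally show False using M by (auto simp: \<A>_def)
    qed
  qed
  from primes[OF this] have "a [^] (1::nat) \<in> M" using a by simp
  then show False using M unfolding \<A>_def by blast
qed

section \<open>Derivations\<close>

locale diff_ring = cring R for R (structure) +
  fixes d
  assumes derivation: "derivation R d"
begin

lemma d_closed [simp, intro]: "a \<in> carrier R \<Longrightarrow> d a \<in> carrier R"
  using derivation by (auto simp: derivation_def)

lemma d_add: "a \<in> carrier R \<Longrightarrow> b \<in> carrier R \<Longrightarrow> d (a \<oplus> b) = d a \<oplus> d b"
  using derivation by (auto simp: derivation_def)

lemma d_mult: "a \<in> carrier R \<Longrightarrow> b \<in> carrier R \<Longrightarrow> d (a \<otimes> b) = a \<otimes> d b \<oplus> d a \<otimes> b"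
  using derivation by (auto simp: derivation_def)

lemma d_zero [simp]: "d \<zero> = \<zero>"
proof -
  have "d \<zero> \<oplus> d \<zero> = d \<zero>" using d_add[of \<zero> \<zero>] by simp
  then show ?thesis by (metis d_closed l_zero add.right_cancel zero_closed one_closed)
qed

lemma d_one [simp]: "d \<one> = \<zero>"
proof -
  have "d \<one> \<oplus> d \<one> = d \<one>" using d_mult[of \<one> \<one>] by simp
  then show ?thesis by (metis d_closed l_zero add.right_cancel zero_closed one_closed)
qed

lemma d_uminus: "a \<in> carrier R \<Longrightarrow> d (\<ominus> a) = \<ominus> d a"
  using d_add[of a "\<ominus> a"] by (metis a_inv_closed add.inv_comm add.inv_equality d_closed d_zero r_neg)

lemma dn_closed [simp, intro]: "a \<in> carrier R \<Longrightarrow> (d ^^ n) a \<in> carrier R"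
  by (induction n) auto

lemma dn_add: "a \<in> carrier R \<Longrightarrow> b \<in> carrier R \<Longrightarrow> (d ^^ n) (a \<oplus> b) = (d ^^ n) a \<oplus> (d ^^ n) b"
  by (induction n) (auto simp: d_add)

lemma dn_d: "(d ^^ n) (d a) = (d ^^ Suc n) a"
  by (simp only: funpow_Suc_right comp_apply)

lemma dn_Suc_mult:
  assumes "a \<in> carrier R" "b \<in> carrier R"
  shows "(d ^^ Suc n) (a \<otimes> b) = (d ^^ n) (a \<otimes> d b) \<oplus> (d ^^ n) (d a \<otimes> b)"
  using assms by (simp only: dn_d[symmetric] d_mult dn_add m_closed d_closed)

text \<open>
  For an ideal \<open>m\<close> this is the largest ideal inside \<open>m\<close> that is closed under \<open>d\<close>.
\<close>

definition diff_interior :: "'a set \<Rightarrow> 'a set" where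
  "diff_interior m = {a \<in> carrier R. \<forall>n. (d ^^ n) a \<in> m}"

text \<open>
  By Leibniz, \<open>d ^^ j\<close> of a product is a sum of terms \<open>(d ^^ i) a \<otimes> (d ^^ l) b\<close> with
  \<open>i + l = j\<close>.  If \<open>j < n + k\<close>, then \<open>i < n\<close> or \<open>l < k\<close> in each of them, so each lies in \<open>m\<close>.
\<close>

lemma dn_mult_low:
  assumes "ideal m R" "a \<in> carrier R" "b \<in> carrier R"
    and "\<forall>i<n. (d ^^ i) a \<in> m" "\<forall>i<k. (d ^^ i) b \<in> m" "j < n + k"
  shows "(d ^^ j) (a \<otimes> b) \<in> m"
  using assms(2-)
proof (induction j arbitrary: a b n k)
  case 0
  interpret m: ideal m R by fact
  from 0 show ?case
    by (cases "n = 0") (fastforce intro: m.I_l_closed m.I_r_closed)+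
next
  case (Suc j)
  interpret m: ideal m R by fact
  have *: "\<forall>i<l - 1. (d ^^ i) (d c) \<in> m" if "\<forall>i<l. (d ^^ i) c \<in> m" for l c
    using that by (auto simp only: dn_d less_diff_conv)
  have "(d ^^ j) (a \<otimes> d b) \<in> m"
  proof (cases "k = 0")
    case True
    with Suc.prems show ?thesis by (intro Suc.IH[of a "d b" n 0]) auto
  next
    case False
    with Suc.prems *[of k b] show ?thesis by (intro Suc.IH[of a "d b" n "k - 1"]) auto
  qed
  moreover have "(d ^^ j) (d a \<otimes> b) \<in> m"
  proof (cases "n = 0")
    case True
    with Suc.prems show ?thesis by (intro Suc.IH[of "d a" b 0 k]) auto
  next
    case False
    with Suc.prems *[of n a] show ?thesis by (intro Suc.IH[of "d a" b "n - 1" k]) auto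
  qed
  ultimately show ?case
    using Suc.prems by (simp only: dn_Suc_mult m.a_closed)
qed

text \<open>
  In degree \<open>n + k\<close> a single Leibniz term escapes this argument, the one with \<open>i = n\<close> and \<open>l = k\<close>.
  Its coefficient \<open>c\<close> is the binomial coefficient \<open>n + k\<close> over \<open>n\<close>; in the induction it is the sum
  of the two coefficients of the previous degree, which shows that it is positive.
\<close>

lemma dn_mult_leading:
  assumes "ideal m R" "a \<in> carrier R" "b \<in> carrier R"
    and "\<forall>i<n. (d ^^ i) a \<in> m" "\<forall>i<k. (d ^^ i) b \<in> m"
  shows "\<exists>c>0. (d ^^ (n + k)) (a \<otimes> b) \<ominus> [(c::nat)] \<cdot> ((d ^^ n) a \<otimes> (d ^^ k) b) \<in> m"
  using assms(2-)
proof (induction "n + k" arbitrary: a b n k)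
  case 0
  interpret m: ideal m R by fact
  have "a \<otimes> b \<ominus> [(1::nat)] \<cdot> (a \<otimes> b) = \<zero>" using 0 by (simp add: r_neg minus_eq)
  with 0 m.zero_closed show ?case by (intro exI[of _ 1]) (simp add: minus_eq r_neg)
next
  case (Suc j)
  interpret m: ideal m R by fact
  let ?l = "(d ^^ n) a \<otimes> (d ^^ k) b"
  have *: "\<forall>i<l - 1. (d ^^ i) (d c) \<in> m" if "\<forall>i<l. (d ^^ i) c \<in> m" for l c
    using that by (auto simp only: dn_d less_diff_conv)
  have lc: "?l \<in> carrier R" using Suc.prems by blast
  \<comment> \<open>If \<open>k = 0\<close> or \<open>n = 0\<close>, one of the two Leibniz summands has no leading term; its coefficient is \<open>0\<close>.\<close>
  have z: "x \<ominus> [(0::nat)] \<cdot> ?l \<in> m" if "x \<in> m" for x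
    using that m.Icarr by (simp add: minus_eq)
  have 1: "\<exists>c. (k > 0 \<longrightarrow> c > 0) \<and> (d ^^ j) (a \<otimes> d b) \<ominus> [(c::nat)] \<cdot> ?l \<in> m"
  proof (cases k)
    case 0
    have "(d ^^ j) (a \<otimes> d b) \<in> m"
      using Suc 0 by (intro dn_mult_low[of m a "d b" n 0]) (auto intro: assms(1))
    with z 0 show ?thesis by blast
  next
    case (Suc k')
    have "\<exists>c>0. (d ^^ (n + k')) (a \<otimes> d b) \<ominus> [(c::nat)] \<cdot> ((d ^^ n) a \<otimes> (d ^^ k') (d b)) \<in> m"
      using Suc.prems Suc.hyps(2) Suc *[of k b] by (intro Suc.hyps(1)) auto
    moreover have "n + k' = j" using Suc.hyps(2) Suc by simp
    ultimately show ?thesis using Suc by (auto simp only: dn_d)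
  qed
  have 2: "\<exists>c. (n > 0 \<longrightarrow> c > 0) \<and> (d ^^ j) (d a \<otimes> b) \<ominus> [(c::nat)] \<cdot> ?l \<in> m"
  proof (cases n)
    case 0
    have "(d ^^ j) (d a \<otimes> b) \<in> m"
      using Suc 0 by (intro dn_mult_low[of m "d a" b 0 k]) (auto intro: assms(1))
    with z 0 show ?thesis by blast
  next
    case (Suc n')
    have "\<exists>c>0. (d ^^ (n' + k)) (d a \<otimes> b) \<ominus> [(c::nat)] \<cdot> ((d ^^ n') (d a) \<otimes> (d ^^ k) b) \<in> m"
      using Suc.prems Suc.hyps(2) Suc *[of n a] by (intro Suc.hyps(1)) auto
    moreover have "n' + k = j" using Suc.hyps(2) Suc by simp
    ultimately show ?thesis using Suc by (auto simp only: dn_d)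
  qed
  from 1 2 obtain c c' :: nat where c: "k > 0 \<longrightarrow> c > 0" "(d ^^ j) (a \<otimes> d b) \<ominus> [c] \<cdot> ?l \<in> m"
    and c': "n > 0 \<longrightarrow> c' > 0" "(d ^^ j) (d a \<otimes> b) \<ominus> [c'] \<cdot> ?l \<in> m" by blast
  let ?x = "(d ^^ j) (a \<otimes> d b)" and ?y = "(d ^^ j) (d a \<otimes> b)"
  have carr: "?x \<in> carrier R" "?y \<in> carrier R" "[c] \<cdot> ?l \<in> carrier R" "[c'] \<cdot> ?l \<in> carrier R"
    using Suc.prems lc by auto
  have "(d ^^ (n + k)) (a \<otimes> b) = ?x \<oplus> ?y"
    using Suc.prems by (simp only: Suc.hyps(2)[symmetric] dn_Suc_mult)
  moreover have "[(c + c')] \<cdot> ?l = [c] \<cdot> ?l \<oplus> [c'] \<cdot> ?l"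
    using lc by (simp add: add.nat_pow_mult)
  moreover have "(?x \<oplus> ?y) \<ominus> ([c] \<cdot> ?l \<oplus> [c'] \<cdot> ?l) = (?x \<ominus> [c] \<cdot> ?l) \<oplus> (?y \<ominus> [c'] \<cdot> ?l)"
    using carr by algebra
  ultimately have "(d ^^ (n + k)) (a \<otimes> b) \<ominus> [(c + c')] \<cdot> ?l \<in> m"
    using c c' m.a_closed by simp
  moreover have "c + c' > 0" using Suc.hyps(2) c(1) c'(1) by auto
  ultimately show ?case by blast
qed

text \<open>
  Let \<open>n\<close> and \<open>k\<close> be the least orders at which derivatives of \<open>a\<close> and \<open>b\<close> leave \<open>m\<close>.  Modulo
  \<open>m\<close> the derivative of order \<open>n + k\<close> of the product is a positive integer times a product of two
  elements outside \<open>m\<close>.  As that integer is a unit, it does not lie in \<open>m\<close>.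
\<close>

theorem primeideal_diff_interior:
  assumes "primeideal m R" and Q: "\<And>c::nat. c > 0 \<Longrightarrow> \<exists>u\<in>carrier R. [c] \<cdot> \<one> \<otimes> u = \<one>"
  shows "primeideal (diff_interior m) R"
proof -
  interpret m: primeideal m R by fact
  have idl: "ideal (diff_interior m) R"
  proof (rule idealI[OF ring_axioms])
    have "\<ominus> a = (\<ominus> \<one>) \<otimes> a" if "a \<in> carrier R" for a using that by algebra
    moreover have dn_uminus: "(d ^^ n) (\<ominus> a) = \<ominus> (d ^^ n) a" if "a \<in> carrier R" for n a
      using that by (induction n) (auto simp: d_uminus)
    have dn_zero: "(d ^^ n) \<zero> = \<zero>" for n by (induction n) auto
    show "subgroup (diff_interior m) (add_monoid R)"
      by (rule add.subgroupI)
        (auto simp: diff_interior_def dn_add dn_uminus dn_zero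
           intro!: m.a_closed m.a_inv_closed exI[of _ \<zero>])
    have "(d ^^ n) (x \<otimes> a) \<in> m" if "x \<in> carrier R" "a \<in> diff_interior m" for x a n
      using that dn_mult_low[OF m.is_ideal, of x a 0 "Suc n" n] by (auto simp: diff_interior_def)
    then show "x \<otimes> a \<in> diff_interior m" "a \<otimes> x \<in> diff_interior m"
      if "a \<in> diff_interior m" "x \<in> carrier R" for x a
      using that m_comm[of a x] by (auto simp: diff_interior_def)
  qed
  show ?thesis
  proof (rule primeidealI[OF idl is_cring])
    have "(d ^^ 0) \<one> \<notin> m" using m.one_imp_carrier m.I_notcarr by auto
    then have "\<one> \<notin> diff_interior m" unfolding diff_interior_def by blast
    then show "carrier R \<noteq> diff_interior m" by auto
    fix a b assume ab: "a \<in> carrier R" "b \<in> carrier R" "a \<otimes> b \<in> diff_interior m"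
    show "a \<in> diff_interior m \<or> b \<in> diff_interior m"
    proof (rule ccontr)
      assume *: "\<not> (a \<in> diff_interior m \<or> b \<in> diff_interior m)"
      define n where "n = (LEAST n. (d ^^ n) a \<notin> m)"
      define k where "k = (LEAST k. (d ^^ k) b \<notin> m)"
      have n: "(d ^^ n) a \<notin> m" "\<forall>i<n. (d ^^ i) a \<in> m"
        unfolding n_def using * ab LeastI_ex[of "\<lambda>n. (d ^^ n) a \<notin> m"] not_less_Least
        by (auto simp: diff_interior_def)
      have k: "(d ^^ k) b \<notin> m" "\<forall>i<k. (d ^^ i) b \<in> m"
        unfolding k_def using * ab LeastI_ex[of "\<lambda>n. (d ^^ n) b \<notin> m"] not_less_Least
        by (auto simp: diff_interior_def)
      let ?l = "(d ^^ n) a \<otimes> (d ^^ k) b"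
      have lc: "?l \<in> carrier R" using ab by blast
      obtain c :: nat where c: "c > 0" "(d ^^ (n + k)) (a \<otimes> b) \<ominus> [c] \<cdot> ?l \<in> m"
        using dn_mult_leading[OF m.is_ideal ab(1,2) n(2) k(2)] by blast
      have dm: "(d ^^ (n + k)) (a \<otimes> b) \<in> m" using ab(3) by (simp add: diff_interior_def)
      have dc: "(d ^^ (n + k)) (a \<otimes> b) \<in> carrier R" using ab by blast
      have cl: "[c] \<cdot> ?l \<in> carrier R" using lc by simp
      have "[c] \<cdot> ?l = (d ^^ (n + k)) (a \<otimes> b) \<oplus> \<ominus> ((d ^^ (n + k)) (a \<otimes> b) \<ominus> [c] \<cdot> ?l)"
        using dc cl by algebra
      then have cm: "[c] \<cdot> ?l \<in> m" using m.a_closed[OF dm m.a_inv_closed[OF c(2)]] by simp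
      obtain u where u: "u \<in> carrier R" "[c] \<cdot> \<one> \<otimes> u = \<one>" using Q c(1) by blast
      \<comment> \<open>Dividing by the unit \<open>c\<close> would put the product of two elements outside \<open>m\<close> into \<open>m\<close>.\<close>
      have "u \<otimes> ([c] \<cdot> ?l) = ([c] \<cdot> \<one> \<otimes> u) \<otimes> ?l"
        using u(1) lc add_pow_ldistr[of \<one> ?l c] by (simp add: m_ac add_pow_ldistr)
      also have "\<dots> = ?l" using u lc by simp
      finally have "?l \<in> m" using m.I_l_closed[OF cm u(1)] by simp
      then show False using m.I_prime n k ab by blast
    qed
  qed
qed

end

section \<open>Sections and restriction\<close>

locale ring_presheaf =
  fixes F :: "('a, 'b) presheaf"
  assumes presheaf: "presheaf_of_rings F"
begin

abbreviation opn :: "'a set \<Rightarrow> bool" where "opn U \<equiv> openin (base F) U"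
abbreviation \<O> :: "'a set \<Rightarrow> 'b ring" where "\<O> U \<equiv> sections F U"
abbreviation res :: "'a set \<Rightarrow> 'a set \<Rightarrow> 'b \<Rightarrow> 'b" where "res \<equiv> restr F"

lemma cring_sections: "opn U \<Longrightarrow> cring (\<O> U)"
  using presheaf by (auto simp: presheaf_of_rings_def)

lemma res_hom: "opn U \<Longrightarrow> opn V \<Longrightarrow> V \<subseteq> U \<Longrightarrow> ring_hom_cring (\<O> U) (\<O> V) (res U V)"
  using presheaf cring_sections
  by (auto simp: presheaf_of_rings_def ring_hom_cring_def ring_hom_cring_axioms_def)

lemma res_id [simp]: "opn U \<Longrightarrow> s \<in> carrier (\<O> U) \<Longrightarrow> res U U s = s"
  using presheaf by (auto simp: presheaf_of_rings_def)

lemma res_res [simp]: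
  "opn U \<Longrightarrow> opn V \<Longrightarrow> opn W \<Longrightarrow> W \<subseteq> V \<Longrightarrow> V \<subseteq> U \<Longrightarrow> s \<in> carrier (\<O> U) \<Longrightarrow>
   res V W (res U V s) = res U W s"
  using presheaf unfolding presheaf_of_rings_def by blast

context
  fixes U V assumes UV: "opn U" "opn V" "V \<subseteq> U"
begin

interpretation r: ring_hom_cring "\<O> U" "\<O> V" "res U V" by (rule res_hom[OF UV])

lemma res_closed [simp]: "s \<in> carrier (\<O> U) \<Longrightarrow> res U V s \<in> carrier (\<O> V)"
  and res_one [simp]: "res U V \<one>\<^bsub>\<O> U\<^esub> = \<one>\<^bsub>\<O> V\<^esub>"
  and res_zero [simp]: "res U V \<zero>\<^bsub>\<O> U\<^esub> = \<zero>\<^bsub>\<O> V\<^esub>"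
  by simp_all

lemma res_mult: "s \<in> carrier (\<O> U) \<Longrightarrow> t \<in> carrier (\<O> U) \<Longrightarrow>
    res U V (s \<otimes>\<^bsub>\<O> U\<^esub> t) = res U V s \<otimes>\<^bsub>\<O> V\<^esub> res U V t"
  and res_add: "s \<in> carrier (\<O> U) \<Longrightarrow> t \<in> carrier (\<O> U) \<Longrightarrow>
    res U V (s \<oplus>\<^bsub>\<O> U\<^esub> t) = res U V s \<oplus>\<^bsub>\<O> V\<^esub> res U V t"
  by simp_all

lemma res_minus: "s \<in> carrier (\<O> U) \<Longrightarrow> t \<in> carrier (\<O> U) \<Longrightarrow>
    res U V (s \<ominus>\<^bsub>\<O> U\<^esub> t) = res U V s \<ominus>\<^bsub>\<O> V\<^esub> res U V t"
  by (simp add: a_minus_def)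

end

text \<open>
  The basic open set of \<open>s\<close>: the points at which the germ of \<open>s\<close> is a unit.
\<close>

definition unit_locus :: "'a set \<Rightarrow> 'b \<Rightarrow> 'a set" where
  "unit_locus U s = {y. \<exists>Z. opn Z \<and> y \<in> Z \<and> Z \<subseteq> U \<and>
     (\<exists>t\<in>carrier (\<O> Z). res U Z s \<otimes>\<^bsub>\<O> Z\<^esub> t = \<one>\<^bsub>\<O> Z\<^esub>)}"

lemma unit_locusI: "opn Z \<Longrightarrow> y \<in> Z \<Longrightarrow> Z \<subseteq> U \<Longrightarrow> t \<in> carrier (\<O> Z) \<Longrightarrow>
    res U Z s \<otimes>\<^bsub>\<O> Z\<^esub> t = \<one>\<^bsub>\<O> Z\<^esub> \<Longrightarrow> y \<in> unit_locus U s"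
  unfolding unit_locus_def by blast

lemma unit_locusE:
  assumes "y \<in> unit_locus U s"
  obtains Z t where "opn Z" "y \<in> Z" "Z \<subseteq> U" "t \<in> carrier (\<O> Z)"
    "res U Z s \<otimes>\<^bsub>\<O> Z\<^esub> t = \<one>\<^bsub>\<O> Z\<^esub>"
  using assms unfolding unit_locus_def by blast

lemma unit_locus_subset: "unit_locus U s \<subseteq> U"
  unfolding unit_locus_def by blast

lemma opn_unit_locus: "opn (unit_locus U s)"
proof -
  have "\<exists>T. opn T \<and> y \<in> T \<and> T \<subseteq> unit_locus U s" if y: "y \<in> unit_locus U s" for y
  proof -
    from y obtain Z t where Z: "opn Z" "y \<in> Z" "Z \<subseteq> U" "t \<in> carrier (\<O> Z)"
      "res U Z s \<otimes>\<^bsub>\<O> Z\<^esub> t = \<one>\<^bsub>\<O> Z\<^esub>" by (rule unit_locusE)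
    then have "Z \<subseteq> unit_locus U s" using unit_locusI[of Z _ U t s] by blast
    with Z show ?thesis by blast
  qed
  then show ?thesis using openin_subopen by blast
qed

lemma unit_locus_res:
  assumes "opn U" "opn V" "V \<subseteq> U" "s \<in> carrier (\<O> U)"
  shows "unit_locus V (res U V s) = unit_locus U s \<inter> V"
proof (intro equalityI subsetI IntI)
  fix y assume "y \<in> unit_locus V (res U V s)"
  then obtain Z t where Z: "opn Z" "y \<in> Z" "Z \<subseteq> V" "t \<in> carrier (\<O> Z)"
    "res V Z (res U V s) \<otimes>\<^bsub>\<O> Z\<^esub> t = \<one>\<^bsub>\<O> Z\<^esub>" unfolding unit_locus_def by blast
  with assms have "res U Z s \<otimes>\<^bsub>\<O> Z\<^esub> t = \<one>\<^bsub>\<O> Z\<^esub>" by simp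
  with Z assms(3) show "y \<in> unit_locus U s" by (meson unit_locusI order_trans)
next
  fix y assume "y \<in> unit_locus V (res U V s)" then show "y \<in> V" using unit_locus_subset by blast
next
  fix y assume y: "y \<in> unit_locus U s \<inter> V"
  then obtain Z t where Z: "opn Z" "y \<in> Z" "Z \<subseteq> U" "t \<in> carrier (\<O> Z)"
    "res U Z s \<otimes>\<^bsub>\<O> Z\<^esub> t = \<one>\<^bsub>\<O> Z\<^esub>" unfolding unit_locus_def by blast
  let ?Y = "Z \<inter> V"
  have Y: "opn ?Y" using Z assms by auto
  have "res U ?Y s \<otimes>\<^bsub>\<O> ?Y\<^esub> res Z ?Y t = \<one>\<^bsub>\<O> ?Y\<^esub>"
    using res_mult[of Z ?Y "res U Z s" t] Z Y assms by simp
  then have "res V ?Y (res U V s) \<otimes>\<^bsub>\<O> ?Y\<^esub> res Z ?Y t = \<one>\<^bsub>\<O> ?Y\<^esub>"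
    using Z Y assms by simp
  then show "y \<in> unit_locus V (res U V s)"
    using Z Y y by (intro unit_locusI[of ?Y _ _ "res Z ?Y t"]) auto
qed

lemma unit_locus_mult:
  assumes "opn U" "s \<in> carrier (\<O> U)" "t \<in> carrier (\<O> U)"
  shows "unit_locus U (s \<otimes>\<^bsub>\<O> U\<^esub> t) = unit_locus U s \<inter> unit_locus U t"
proof (intro equalityI subsetI)
  fix y assume "y \<in> unit_locus U (s \<otimes>\<^bsub>\<O> U\<^esub> t)"
  then obtain Z w where Z: "opn Z" "y \<in> Z" "Z \<subseteq> U" "w \<in> carrier (\<O> Z)"
    "res U Z (s \<otimes>\<^bsub>\<O> U\<^esub> t) \<otimes>\<^bsub>\<O> Z\<^esub> w = \<one>\<^bsub>\<O> Z\<^esub>" unfolding unit_locus_def by blast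
  interpret Z: cring "\<O> Z" using Z cring_sections by blast
  have c: "res U Z s \<in> carrier (\<O> Z)" "res U Z t \<in> carrier (\<O> Z)" using assms Z by auto
  have "res U Z s \<otimes>\<^bsub>\<O> Z\<^esub> (res U Z t \<otimes>\<^bsub>\<O> Z\<^esub> w) = \<one>\<^bsub>\<O> Z\<^esub>"
    "res U Z t \<otimes>\<^bsub>\<O> Z\<^esub> (res U Z s \<otimes>\<^bsub>\<O> Z\<^esub> w) = \<one>\<^bsub>\<O> Z\<^esub>"
    using Z assms c by (simp_all add: res_mult Z.m_ac)
  then have "y \<in> unit_locus U s" "y \<in> unit_locus U t"
    using Z c unit_locusI[of Z y U "res U Z t \<otimes>\<^bsub>\<O> Z\<^esub> w" s]
      unit_locusI[of Z y U "res U Z s \<otimes>\<^bsub>\<O> Z\<^esub> w" t] by simp_all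
  then show "y \<in> unit_locus U s \<inter> unit_locus U t" by blast
next
  fix y assume "y \<in> unit_locus U s \<inter> unit_locus U t"
  then obtain Z v Y w where Z: "opn Z" "y \<in> Z" "Z \<subseteq> U" "v \<in> carrier (\<O> Z)"
    "res U Z s \<otimes>\<^bsub>\<O> Z\<^esub> v = \<one>\<^bsub>\<O> Z\<^esub>" and Y: "opn Y" "y \<in> Y" "Y \<subseteq> U" "w \<in> carrier (\<O> Y)"
    "res U Y t \<otimes>\<^bsub>\<O> Y\<^esub> w = \<one>\<^bsub>\<O> Y\<^esub>" unfolding unit_locus_def by blast
  let ?W = "Z \<inter> Y"
  have W: "opn ?W" "?W \<subseteq> U" using Z Y by auto
  interpret W: cring "\<O> ?W" using W cring_sections by blast
  have c: "res U ?W s \<in> carrier (\<O> ?W)" "res U ?W t \<in> carrier (\<O> ?W)"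
    "res Z ?W v \<in> carrier (\<O> ?W)" "res Y ?W w \<in> carrier (\<O> ?W)" using assms W Z Y by auto
  have 1: "res U ?W s \<otimes>\<^bsub>\<O> ?W\<^esub> res Z ?W v = \<one>\<^bsub>\<O> ?W\<^esub>"
    using res_mult[of Z ?W "res U Z s" v] assms Z W by simp
  have 2: "res U ?W t \<otimes>\<^bsub>\<O> ?W\<^esub> res Y ?W w = \<one>\<^bsub>\<O> ?W\<^esub>"
    using res_mult[of Y ?W "res U Y t" w] assms Y W by simp
  have "res U ?W (s \<otimes>\<^bsub>\<O> U\<^esub> t) \<otimes>\<^bsub>\<O> ?W\<^esub> (res Z ?W v \<otimes>\<^bsub>\<O> ?W\<^esub> res Y ?W w)
      = (res U ?W s \<otimes>\<^bsub>\<O> ?W\<^esub> res Z ?W v) \<otimes>\<^bsub>\<O> ?W\<^esub> (res U ?W t \<otimes>\<^bsub>\<O> ?W\<^esub> res Y ?W w)"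
    using assms W c by (simp add: res_mult W.m_ac)
  with 1 2 Z Y W c show "y \<in> unit_locus U (s \<otimes>\<^bsub>\<O> U\<^esub> t)" by (intro unit_locusI[of ?W]) auto
qed

lemma unit_locus_one: "opn U \<Longrightarrow> unit_locus U \<one>\<^bsub>\<O> U\<^esub> = U"
proof -
  assume U: "opn U"
  interpret cring "\<O> U" using U cring_sections by blast
  have "y \<in> unit_locus U \<one>\<^bsub>\<O> U\<^esub>" if "y \<in> U" for y
    using U that by (intro unit_locusI[of U _ _ "\<one>\<^bsub>\<O> U\<^esub>"]) auto
  then show ?thesis using unit_locus_subset by blast
qed

end

locale ringed_space = ring_presheaf +
  assumes sheaf: "sheaf_of_rings F"
begin

text \<open>
  The two sheaf axioms, with covers indexed by the points that they have to cover.
\<close>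

lemma section_eqI:
  assumes "opn U" "s \<in> carrier (\<O> U)" "t \<in> carrier (\<O> U)"
    and loc: "\<And>x. x \<in> U \<Longrightarrow> \<exists>Z. opn Z \<and> x \<in> Z \<and> Z \<subseteq> U \<and> res U Z s = res U Z t"
  shows "s = t"
proof -
  let ?C = "{Z. opn Z \<and> Z \<subseteq> U \<and> res U Z s = res U Z t}"
  have "\<Union>?C = U" using loc by blast
  moreover have "\<forall>s\<in>carrier (\<O> (\<Union>?C)). \<forall>t\<in>carrier (\<O> (\<Union>?C)).
      (\<forall>V\<in>?C. res (\<Union>?C) V s = res (\<Union>?C) V t) \<longrightarrow> s = t"
    using sheaf[unfolded sheaf_of_rings_def, THEN conjunct2, THEN spec, of ?C] by simp
  ultimately show ?thesis using assms by simp
qed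

lemma glue:
  assumes U: "opn U" and Z: "\<And>x. x \<in> U \<Longrightarrow> opn (Z x) \<and> x \<in> Z x \<and> Z x \<subseteq> U"
    and \<sigma>: "\<And>x. x \<in> U \<Longrightarrow> \<sigma> x \<in> carrier (\<O> (Z x))"
    and agree: "\<And>x y. x \<in> U \<Longrightarrow> y \<in> U \<Longrightarrow>
      res (Z x) (Z x \<inter> Z y) (\<sigma> x) = res (Z y) (Z x \<inter> Z y) (\<sigma> y)"
  obtains s where "s \<in> carrier (\<O> U)" "\<And>x. x \<in> U \<Longrightarrow> res U (Z x) s = \<sigma> x"
proof -
  let ?C = "Z ` U"
  \<comment> \<open>Different points may have the same neighbourhood; the sections then agree because they agree on overlaps.\<close>
  define pick where "pick V = (SOME x. x \<in> U \<and> Z x = V)" for V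
  have pick: "pick V \<in> U" "Z (pick V) = V" if "V \<in> ?C" for V
    using that someI_ex[of "\<lambda>x. x \<in> U \<and> Z x = V"] unfolding pick_def by blast+
  have UC: "\<Union>?C = U" using Z by blast
  have "\<forall>V\<in>?C. \<sigma> (pick V) \<in> carrier (\<O> V)"
    "\<forall>V\<in>?C. \<forall>W\<in>?C. res V (V \<inter> W) (\<sigma> (pick V)) = res W (V \<inter> W) (\<sigma> (pick W))"
    using pick \<sigma> agree by metis+
  moreover have "\<forall>V\<in>?C. opn V" using Z by blast
  ultimately have "\<exists>s\<in>carrier (\<O> (\<Union>?C)). \<forall>V\<in>?C. res (\<Union>?C) V s = \<sigma> (pick V)"
    using sheaf[unfolded sheaf_of_rings_def, THEN conjunct2, THEN spec, of ?C, THEN mp,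
        THEN conjunct2, THEN spec, of "\<lambda>V. \<sigma> (pick V)"] by simp
  then obtain s where s: "s \<in> carrier (\<O> U)" "\<And>V. V \<in> ?C \<Longrightarrow> res U V s = \<sigma> (pick V)"
    unfolding UC by blast
  have "res U (Z x) s = \<sigma> x" if x: "x \<in> U" for x
  proof -
    have "\<sigma> (pick (Z x)) = \<sigma> x"
      using agree[of "pick (Z x)" x] pick[of "Z x"] x Z \<sigma> by (metis Int_absorb imageI res_id)
    then show ?thesis using s(2) x by simp
  qed
  with s(1) that show thesis by blast
qed

text \<open>
  Local inverses are unique, hence they agree on overlaps and glue.
\<close>

lemma inverse_on_unit_locus:
  assumes U: "opn U" and s: "s \<in> carrier (\<O> U)" and unit_locus: "unit_locus U s = U"
  obtains t where "t \<in> carrier (\<O> U)" "s \<otimes>\<^bsub>\<O> U\<^esub> t = \<one>\<^bsub>\<O> U\<^esub>"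
proof -
  have "\<forall>x\<in>U. \<exists>Z t. opn Z \<and> x \<in> Z \<and> Z \<subseteq> U \<and> t \<in> carrier (\<O> Z) \<and> res U Z s \<otimes>\<^bsub>\<O> Z\<^esub> t = \<one>\<^bsub>\<O> Z\<^esub>"
    using unit_locus by (metis unit_locusE)
  then obtain Z \<tau> where Z: "\<And>x. x \<in> U \<Longrightarrow> opn (Z x) \<and> x \<in> Z x \<and> Z x \<subseteq> U"
    and \<tau>: "\<And>x. x \<in> U \<Longrightarrow> \<tau> x \<in> carrier (\<O> (Z x))"
    and inv: "\<And>x. x \<in> U \<Longrightarrow> res U (Z x) s \<otimes>\<^bsub>\<O> (Z x)\<^esub> \<tau> x = \<one>\<^bsub>\<O> (Z x)\<^esub>" by metis
  have "res (Z x) (Z x \<inter> Z y) (\<tau> x) = res (Z y) (Z x \<inter> Z y) (\<tau> y)" if xy: "x \<in> U" "y \<in> U" for x y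
  proof -
    let ?W = "Z x \<inter> Z y"
    have W: "opn ?W" "?W \<subseteq> U" using Z xy by auto
    interpret W: cring "\<O> ?W" using W cring_sections by blast
    have "res U ?W s \<otimes>\<^bsub>\<O> ?W\<^esub> res (Z x) ?W (\<tau> x) = \<one>\<^bsub>\<O> ?W\<^esub>"
      using res_mult[of "Z x" ?W "res U (Z x) s" "\<tau> x"] inv[of x] Z[of x] \<tau>[of x] xy W U s by simp
    moreover have "res U ?W s \<otimes>\<^bsub>\<O> ?W\<^esub> res (Z y) ?W (\<tau> y) = \<one>\<^bsub>\<O> ?W\<^esub>"
      using res_mult[of "Z y" ?W "res U (Z y) s" "\<tau> y"] inv[of y] Z[of y] \<tau>[of y] xy W U s by simp
    moreover have "res (Z x) ?W (\<tau> x) \<in> carrier (\<O> ?W)" "res (Z y) ?W (\<tau> y) \<in> carrier (\<O> ?W)"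
      "res U ?W s \<in> carrier (\<O> ?W)"
      using Z \<tau> xy W U s by auto
    ultimately show ?thesis by (metis W.m_comm W.inv_unique)
  qed
  then obtain t where t: "t \<in> carrier (\<O> U)" "\<And>x. x \<in> U \<Longrightarrow> res U (Z x) t = \<tau> x"
    using glue[of U Z \<tau>] U Z \<tau> by blast
  interpret U: cring "\<O> U" using U cring_sections by blast
  have "s \<otimes>\<^bsub>\<O> U\<^esub> t = \<one>\<^bsub>\<O> U\<^esub>"
  proof (rule section_eqI[OF U])
    fix x assume x: "x \<in> U"
    have "res U (Z x) (s \<otimes>\<^bsub>\<O> U\<^esub> t) = res U (Z x) \<one>\<^bsub>\<O> U\<^esub>"
      using inv x Z[OF x] U s t by (simp add: res_mult)
    then show "\<exists>Z. opn Z \<and> x \<in> Z \<and> Z \<subseteq> U \<and>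
        res U Z (s \<otimes>\<^bsub>\<O> U\<^esub> t) = res U Z \<one>\<^bsub>\<O> U\<^esub>" using Z x by blast
  qed (use s t in auto)
  with t(1) that show thesis by blast
qed

end

section \<open>Fractions and sections over a spectrum\<close>

lemma UN_UN_eqI:
  assumes "(a, s) \<in> A" "(b, t) \<in> B"
    and "\<And>a s b t. (a, s) \<in> A \<Longrightarrow> (b, t) \<in> B \<Longrightarrow> f a s b t = c"
  shows "(\<Union>(a, s)\<in>A. \<Union>(b, t)\<in>B. f a s b t) = c"
  using assms by fast

context primeideal
begin

abbreviation frac :: "'a \<Rightarrow> 'a \<Rightarrow> ('a \<times> 'a) set" where
  "frac a s \<equiv> loc_frac R (carrier R - I) a s"

lemma denom_mult: "s \<in> carrier R - I \<Longrightarrow> t \<in> carrier R - I \<Longrightarrow> s \<otimes> t \<in> carrier R - I"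
  using I_prime by auto

lemma denom_one: "\<one> \<in> carrier R - I"
  using I_notcarr one_imp_carrier by auto

lemma equiv_frac_rel: "equiv (carrier R \<times> (carrier R - I)) (frac_rel R (carrier R - I))"
proof (rule equivI)
  let ?S = "carrier R - I"
  show "refl_on (carrier R \<times> ?S) (frac_rel R ?S)"
    using denom_one by (auto simp: refl_on_def frac_rel_def)
  show "sym (frac_rel R ?S)"
  proof (rule symI, clarify)
    fix a s b t assume "((a, s), (b, t)) \<in> frac_rel R ?S"
    then obtain u where "a \<in> carrier R" "s \<in> ?S" "b \<in> carrier R" "t \<in> ?S" "u \<in> ?S"
      "u \<otimes> (a \<otimes> t) = u \<otimes> (b \<otimes> s)" unfolding frac_rel_def by blast
    moreover from this have "u \<otimes> (b \<otimes> s) = u \<otimes> (a \<otimes> t)" by simp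
    ultimately show "((b, t), (a, s)) \<in> frac_rel R ?S" unfolding frac_rel_def by blast
  qed
  show "trans (frac_rel R ?S)"
  proof (rule transI, clarify)
    fix a s b t c w
    assume "((a, s), (b, t)) \<in> frac_rel R ?S" "((b, t), (c, w)) \<in> frac_rel R ?S"
    then obtain u v where *: "a \<in> carrier R" "s \<in> ?S" "b \<in> carrier R" "t \<in> ?S" "c \<in> carrier R"
      "w \<in> ?S" "u \<in> ?S" "v \<in> ?S" "u \<otimes> (a \<otimes> t) = u \<otimes> (b \<otimes> s)" "v \<otimes> (b \<otimes> w) = v \<otimes> (c \<otimes> t)"
      unfolding frac_rel_def by blast
    then have c: "s \<in> carrier R" "t \<in> carrier R" "w \<in> carrier R" "u \<in> carrier R" "v \<in> carrier R"
      by auto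
    have "(u \<otimes> v \<otimes> t) \<otimes> (a \<otimes> w) = (u \<otimes> (a \<otimes> t)) \<otimes> (v \<otimes> w)" using *(1,3,5) c by algebra
    also have "\<dots> = (v \<otimes> (b \<otimes> w)) \<otimes> (u \<otimes> s)" unfolding *(9) using *(1,3,5) c by algebra
    also have "\<dots> = (u \<otimes> v \<otimes> t) \<otimes> (c \<otimes> s)" unfolding *(10) using *(1,3,5) c by algebra
    finally show "((a, s), (c, w)) \<in> frac_rel R ?S"
      using * denom_mult unfolding frac_rel_def by blast
  qed
qed (auto simp: frac_rel_def)

lemma frac_eq_iff:
  assumes "a \<in> carrier R" "b \<in> carrier R" "s \<in> carrier R - I" "t \<in> carrier R - I"
  shows "frac a s = frac b t \<longleftrightarrow> (\<exists>u\<in>carrier R - I. u \<otimes> (a \<otimes> t) = u \<otimes> (b \<otimes> s))"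
  using eq_equiv_class_iff[OF equiv_frac_rel, of "(a, s)" "(b, t)"] assms
  by (auto simp: loc_frac_def frac_rel_def)

lemma mem_fracE:
  assumes "x \<in> frac a s"
  obtains b t u where "x = (b, t)" "a \<in> carrier R" "s \<in> carrier R - I" "b \<in> carrier R"
    "t \<in> carrier R - I" "u \<in> carrier R - I" "u \<otimes> (a \<otimes> t) = u \<otimes> (b \<otimes> s)"
  using assms unfolding loc_frac_def frac_rel_def by blast

lemma mem_frac_self: "a \<in> carrier R \<Longrightarrow> s \<in> carrier R - I \<Longrightarrow> (a, s) \<in> frac a s"
  using equiv_frac_rel unfolding loc_frac_def by (auto simp: equiv_def refl_on_def)

lemma frac_closed:
  "a \<in> carrier R \<Longrightarrow> s \<in> carrier R - I \<Longrightarrow> frac a s \<in> carrier (localization R (carrier R - I))"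
  by (auto simp: localization_def)

lemma frac_mult:
  assumes "a \<in> carrier R" "b \<in> carrier R" "s \<in> carrier R - I" "t \<in> carrier R - I"
  shows "frac a s \<otimes>\<^bsub>localization R (carrier R - I)\<^esub> frac b t = frac (a \<otimes> b) (s \<otimes> t)"
proof -
  have "frac (a' \<otimes> b') (s' \<otimes> t') = frac (a \<otimes> b) (s \<otimes> t)"
    if 1: "(a', s') \<in> frac a s" and 2: "(b', t') \<in> frac b t" for a' s' b' t'
  proof -
    obtain u where u: "a' \<in> carrier R" "s' \<in> carrier R - I" "u \<in> carrier R - I"
      "u \<otimes> (a \<otimes> s') = u \<otimes> (a' \<otimes> s)" using 1 by (elim mem_fracE) blast
    obtain v where v: "b' \<in> carrier R" "t' \<in> carrier R - I" "v \<in> carrier R - I"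
      "v \<otimes> (b \<otimes> t') = v \<otimes> (b' \<otimes> t)" using 2 by (elim mem_fracE) blast
    have c: "s \<in> carrier R" "t \<in> carrier R" "s' \<in> carrier R" "t' \<in> carrier R" "u \<in> carrier R"
      "v \<in> carrier R" using assms u v by auto
    have "(u \<otimes> v) \<otimes> ((a' \<otimes> b') \<otimes> (s \<otimes> t)) = (u \<otimes> (a' \<otimes> s)) \<otimes> (v \<otimes> (b' \<otimes> t))"
      using assms(1,2) u(1) v(1) c by algebra
    also have "\<dots> = (u \<otimes> v) \<otimes> ((a \<otimes> b) \<otimes> (s' \<otimes> t'))"
      unfolding u(4)[symmetric] v(4)[symmetric] using assms(1,2) u(1) v(1) c by algebra
    finally show ?thesis
      using assms u v denom_mult[OF u(3) v(3)] denom_mult[OF u(2) v(2)] denom_mult[OF assms(3,4)]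
      by (subst frac_eq_iff) blast+
  qed
  then show ?thesis
    using UN_UN_eqI[OF mem_frac_self[OF assms(1,3)] mem_frac_self[OF assms(2,4)],
        of "\<lambda>a s b t. frac (a \<otimes> b) (s \<otimes> t)"]
    by (simp add: localization_def)
qed

lemma frac_add:
  assumes "a \<in> carrier R" "b \<in> carrier R" "s \<in> carrier R - I" "t \<in> carrier R - I"
  shows "frac a s \<oplus>\<^bsub>localization R (carrier R - I)\<^esub> frac b t = frac (a \<otimes> t \<oplus> b \<otimes> s) (s \<otimes> t)"
proof -
  have "frac (a' \<otimes> t' \<oplus> b' \<otimes> s') (s' \<otimes> t') = frac (a \<otimes> t \<oplus> b \<otimes> s) (s \<otimes> t)"
    if 1: "(a', s') \<in> frac a s" and 2: "(b', t') \<in> frac b t" for a' s' b' t'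
  proof -
    obtain u where u: "a' \<in> carrier R" "s' \<in> carrier R - I" "u \<in> carrier R - I"
      "u \<otimes> (a \<otimes> s') = u \<otimes> (a' \<otimes> s)" using 1 by (elim mem_fracE) blast
    obtain v where v: "b' \<in> carrier R" "t' \<in> carrier R - I" "v \<in> carrier R - I"
      "v \<otimes> (b \<otimes> t') = v \<otimes> (b' \<otimes> t)" using 2 by (elim mem_fracE) blast
    have c: "s \<in> carrier R" "t \<in> carrier R" "s' \<in> carrier R" "t' \<in> carrier R" "u \<in> carrier R"
      "v \<in> carrier R" using assms u v by auto
    have "(u \<otimes> v) \<otimes> ((a' \<otimes> t' \<oplus> b' \<otimes> s') \<otimes> (s \<otimes> t))
        = (u \<otimes> (a' \<otimes> s)) \<otimes> (v \<otimes> t \<otimes> t') \<oplus> (v \<otimes> (b' \<otimes> t)) \<otimes> (u \<otimes> s \<otimes> s')"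
      using assms(1,2) u(1) v(1) c by algebra
    also have "\<dots> = (u \<otimes> v) \<otimes> ((a \<otimes> t \<oplus> b \<otimes> s) \<otimes> (s' \<otimes> t'))"
      unfolding u(4)[symmetric] v(4)[symmetric] using assms(1,2) u(1) v(1) c by algebra
    finally show ?thesis
      using assms u v c denom_mult[OF u(3) v(3)] denom_mult[OF u(2) v(2)] denom_mult[OF assms(3,4)]
      by (subst frac_eq_iff) (blast intro: m_closed a_closed)+
  qed
  then show ?thesis
    using UN_UN_eqI[OF mem_frac_self[OF assms(1,3)] mem_frac_self[OF assms(2,4)],
        of "\<lambda>a s b t. frac (a \<otimes> t \<oplus> b \<otimes> s) (s \<otimes> t)"]
    by (simp add: localization_def)
qed

end

context cring
begin

lemma openin_zariski:
  "openin (zariski R) U \<longleftrightarrow> (\<exists>S\<subseteq>carrier R. U = {p. primeideal p R \<and> \<not> S \<subseteq> p})"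
  unfolding zariski_def using istopology_zariski[OF is_cring] by (simp add: topology_inverse')

lemma openin_zariski_basic:
  assumes "h \<in> carrier R"
  shows "openin (zariski R) {p. primeideal p R \<and> h \<notin> p}"
  using assms unfolding openin_zariski by (intro exI[of _ "{h}"]) auto

lemma openin_zariski_prime: "openin (zariski R) U \<Longrightarrow> p \<in> U \<Longrightarrow> primeideal p R"
  by (auto simp: openin_zariski)

lemma topspace_zariski: "topspace (zariski R) = {p. primeideal p R}"
proof (intro equalityI subsetI)
  fix p assume "p \<in> topspace (zariski R)"
  then show "p \<in> {p. primeideal p R}" using openin_zariski_prime[OF openin_topspace] by simp
next
  fix p assume p: "p \<in> {p. primeideal p R}"
  then have "p \<in> {p. primeideal p R \<and> \<one> \<notin> p}" using primeideal.denom_one[of p R] by simp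
  then show "p \<in> topspace (zariski R)"
    using openin_subset[OF openin_zariski_basic[OF one_closed]] by blast
qed

lemma zariski_basis:
  assumes "openin (zariski R) U" "p \<in> U"
  obtains h where "h \<in> carrier R" "h \<notin> p" "\<And>q. primeideal q R \<Longrightarrow> h \<notin> q \<Longrightarrow> q \<in> U"
proof -
  obtain S where S: "S \<subseteq> carrier R" "U = {p. primeideal p R \<and> \<not> S \<subseteq> p}"
    using assms(1)[unfolded openin_zariski] by metis
  with assms(2) obtain h where h: "h \<in> S" "h \<notin> p" by blast
  have U: "q \<in> U" if "primeideal q R" "h \<notin> q" for q
    using h(1) that unfolding S(2) by blast
  show thesis using that[OF _ h(2) U] h(1) S(1) by (meson subsetD)
qed

definition frac_section :: "'a set set \<Rightarrow> 'a \<Rightarrow> 'a \<Rightarrow> 'a set \<Rightarrow> ('a \<times> 'a) set" where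
  "frac_section N a g = (\<lambda>p\<in>N. loc_frac R (carrier R - p) a g)"

lemma sections_specE:
  assumes "s \<in> carrier (sections (spec R) N)" "p \<in> N"
  obtains V a g where "openin (zariski R) V" "p \<in> V" "V \<subseteq> N" "a \<in> carrier R" "g \<in> carrier R"
    "\<And>q. q \<in> V \<Longrightarrow> g \<notin> q \<and> s q = loc_frac R (carrier R - q) a g"
proof -
  have "\<exists>V. openin (zariski R) V \<and> p \<in> V \<and> V \<subseteq> N \<and>
      (\<exists>a\<in>carrier R. \<exists>g\<in>carrier R. \<forall>q\<in>V. g \<notin> q \<and> s q = loc_frac R (carrier R - q) a g)"
    using assms by (simp add: spec_def pointwise_ring_def)
  then obtain V a g where V: "openin (zariski R) V" "p \<in> V" "V \<subseteq> N" "a \<in> carrier R" "g \<in> carrier R"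
    and eq: "\<forall>q\<in>V. g \<notin> q \<and> s q = loc_frac R (carrier R - q) a g" by meson
  show thesis using V eq by (intro that[of V a g]) simp_all
qed

lemma sections_specI:
  assumes N: "openin (zariski R) N" and "s \<in> extensional N"
    and loc: "\<And>p. p \<in> N \<Longrightarrow> \<exists>V a g. openin (zariski R) V \<and> p \<in> V \<and> V \<subseteq> N \<and> a \<in> carrier R \<and>
      g \<in> carrier R \<and> (\<forall>q\<in>V. g \<notin> q \<and> s q = loc_frac R (carrier R - q) a g)"
  shows "s \<in> carrier (sections (spec R) N)"
proof -
  have "s p \<in> carrier (localization R (carrier R - p))" if p: "p \<in> N" for p
  proof -
    interpret p: primeideal p R using openin_zariski_prime[OF N p] .
    show ?thesis using loc[OF p] p.frac_closed by force
  qed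
  moreover have "\<forall>p\<in>N. \<exists>V. openin (zariski R) V \<and> p \<in> V \<and> V \<subseteq> N \<and>
      (\<exists>a\<in>carrier R. \<exists>g\<in>carrier R. \<forall>q\<in>V. g \<notin> q \<and> s q = loc_frac R (carrier R - q) a g)"
    using loc by metis
  ultimately show ?thesis
    using assms(2) by (simp add: spec_def pointwise_ring_def PiE_def)
qed

lemma frac_section_closed:
  assumes "openin (zariski R) N" "a \<in> carrier R" "g \<in> carrier R" "\<And>p. p \<in> N \<Longrightarrow> g \<notin> p"
  shows "frac_section N a g \<in> carrier (sections (spec R) N)"
proof (rule sections_specI[OF assms(1)])
  show "frac_section N a g \<in> extensional N" by (simp add: frac_section_def)
  show "\<exists>V b h. openin (zariski R) V \<and> p \<in> V \<and> V \<subseteq> N \<and> b \<in> carrier R \<and> h \<in> carrier R \<and>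
      (\<forall>q\<in>V. h \<notin> q \<and> frac_section N a g q = loc_frac R (carrier R - q) b h)" if "p \<in> N" for p
    using assms that by (intro exI[of _ N] exI[of _ a] exI[of _ g]) (auto simp: frac_section_def)
qed

lemma one_notin: "openin (zariski R) N \<Longrightarrow> p \<in> N \<Longrightarrow> \<one> \<notin> p"
  using openin_zariski_prime primeideal.denom_one by blast

lemma frac_section_hom:
  assumes N: "openin (zariski R) N"
  shows "(\<lambda>a. frac_section N a \<one>) \<in> ring_hom R (sections (spec R) N)"
proof (rule ring_hom_memI)
  fix a b assume ab: "a \<in> carrier R" "b \<in> carrier R"
  show "frac_section N a \<one> \<in> carrier (sections (spec R) N)"
    using frac_section_closed N ab one_notin by simp
  show "frac_section N (a \<otimes> b) \<one> = frac_section N a \<one> \<otimes>\<^bsub>sections (spec R) N\<^esub> frac_section N b \<one>"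
    using ab N primeideal.frac_mult[OF openin_zariski_prime[OF N], of _ a b \<one> \<one>] one_notin[OF N]
    by (auto simp: frac_section_def spec_def pointwise_ring_def intro!: restrict_ext)
  show "frac_section N (a \<oplus> b) \<one> = frac_section N a \<one> \<oplus>\<^bsub>sections (spec R) N\<^esub> frac_section N b \<one>"
    using ab N primeideal.frac_add[OF openin_zariski_prime[OF N], of _ a b \<one> \<one>] one_notin[OF N]
    by (auto simp: frac_section_def spec_def pointwise_ring_def intro!: restrict_ext)
next
  have "loc_frac R (carrier R - p) \<one> \<one> = \<one>\<^bsub>localization R (carrier R - p)\<^esub>" for p
    by (simp add: localization_def)
  then show "frac_section N \<one> \<one> = \<one>\<^bsub>sections (spec R) N\<^esub>"
    by (auto simp: frac_section_def spec_def pointwise_ring_def intro!: restrict_ext)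
qed

text \<open>
  Enough of the ring structure on sections over a spectrum to multiply by the image of an element of
  \<open>R\<close>: locally \<open>s\<close> is a fraction, and so is its multiple.
\<close>

lemma frac_section_mult_closed:
  assumes N: "openin (zariski R) N" and a: "a \<in> carrier R" and s: "s \<in> carrier (sections (spec R) N)"
  shows "frac_section N a \<one> \<otimes>\<^bsub>sections (spec R) N\<^esub> s \<in> carrier (sections (spec R) N)"
    (is "?t \<in> _")
proof (rule sections_specI[OF N])
  show "?t \<in> extensional N" by (simp add: spec_def pointwise_ring_def)
  fix p assume "p \<in> N"
  with s obtain V b g where V: "openin (zariski R) V" "p \<in> V" "V \<subseteq> N" "b \<in> carrier R" "g \<in> carrier R"
    and sV: "\<And>q. q \<in> V \<Longrightarrow> g \<notin> q \<and> s q = loc_frac R (carrier R - q) b g" by (rule sections_specE) blast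
  have "?t q = loc_frac R (carrier R - q) (a \<otimes> b) g" if q: "q \<in> V" for q
  proof -
    have "q \<in> N" using q V by blast
    interpret q: primeideal q R using openin_zariski_prime[OF V(1) q] .
    show ?thesis
      using q \<open>q \<in> N\<close> V sV[OF q] a q.denom_one q.frac_mult[of a b \<one> g]
      by (simp add: spec_def pointwise_ring_def frac_section_def)
  qed
  with V sV a show "\<exists>V b g. openin (zariski R) V \<and> p \<in> V \<and> V \<subseteq> N \<and> b \<in> carrier R \<and> g \<in> carrier R \<and>
      (\<forall>q\<in>V. g \<notin> q \<and> ?t q = loc_frac R (carrier R - q) b g)"
    by (intro exI[of _ V] exI[of _ "a \<otimes> b"] exI[of _ g]) auto
qed

text \<open>
  The factor \<open>h\<close> is there to shrink the set where the cleared denominator is a unit.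
\<close>

lemma frac_section_clear:
  assumes N: "openin (zariski R) N" and s: "s \<in> carrier (sections (spec R) N)"
    and ag: "a \<in> carrier R" "g \<in> carrier R" "h \<in> carrier R"
    and sN: "\<And>q. q \<in> N \<Longrightarrow> g \<notin> q \<and> s q = loc_frac R (carrier R - q) a g"
  shows "frac_section N (h \<otimes> g) \<one> \<otimes>\<^bsub>sections (spec R) N\<^esub> s = frac_section N (h \<otimes> a) \<one>"
proof -
  have "loc_frac R (carrier R - q) (h \<otimes> g) \<one> \<otimes>\<^bsub>localization R (carrier R - q)\<^esub> s q
      = loc_frac R (carrier R - q) (h \<otimes> a) \<one>" if q: "q \<in> N" for q
  proof -
    interpret q: primeideal q R using openin_zariski_prime[OF N q] .
    have "g \<in> carrier R - q" using sN[OF q] ag by blast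
    moreover from this have "loc_frac R (carrier R - q) ((h \<otimes> g) \<otimes> a) (\<one> \<otimes> g)
        = loc_frac R (carrier R - q) (h \<otimes> a) \<one>"
      using ag q.denom_one q.denom_mult[OF q.denom_one]
      by (subst q.frac_eq_iff) (auto intro!: bexI[of _ \<one>] simp: m_ac)
    ultimately show ?thesis using sN[OF q] ag q.denom_one by (simp add: q.frac_mult)
  qed
  then show ?thesis by (auto simp: spec_def pointwise_ring_def frac_section_def intro!: restrict_ext)
qed

end

section \<open>Affine charts\<close>

context ringed_space
begin

text \<open>
  What is used of an affine open set \<open>V\<close>: its points are the primes of a ring \<open>R\<close>, and near a point
  every section is a fraction of elements of \<open>R\<close>, in a way that detects the basic open sets.  The
  derivation acts on the sections over \<open>V\<close> and not on \<open>R\<close>, so \<open>R\<close> serves to find points and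
  fractions only.
\<close>

definition affine_chart :: "'a set \<Rightarrow> ('c, 'm) ring_scheme \<Rightarrow> ('c \<Rightarrow> 'b) \<Rightarrow> ('a \<Rightarrow> 'c set) \<Rightarrow> bool" where
  "affine_chart V R \<rho> pr \<longleftrightarrow> opn V \<and> cring R \<and> \<rho> \<in> ring_hom R (\<O> V) \<and>
     bij_betw pr V {p. primeideal p R} \<and>
     (\<forall>r\<in>carrier R. unit_locus V (\<rho> r) = {y \<in> V. r \<notin> pr y}) \<and>
     (\<forall>N s. \<forall>y\<in>N. opn N \<and> N \<subseteq> V \<and> s \<in> carrier (\<O> N) \<longrightarrow>
        (\<exists>g\<in>carrier R. \<exists>a\<in>carrier R. y \<in> unit_locus V (\<rho> g) \<and> unit_locus V (\<rho> g) \<subseteq> N \<and>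
           res V (unit_locus V (\<rho> g)) (\<rho> g) \<otimes>\<^bsub>\<O> (unit_locus V (\<rho> g))\<^esub> res N (unit_locus V (\<rho> g)) s
             = res V (unit_locus V (\<rho> g)) (\<rho> a)))"

context
  fixes V :: "'a set" and R :: "('c, 'm) ring_scheme" and f :: "'a \<Rightarrow> 'c set" and \<phi>
  assumes V: "opn V" and R: "cring R"
    and iso: "lrs_isomorphism (open_restriction F V) (spec R) f \<phi>"
begin

interpretation R: cring R by (rule R)

lemma base_spec: "base (spec R) = zariski R"
  and restr_spec: "restr (spec R) A B s = restrict s B"
  by (simp_all add: spec_def)

lemma homeo: "homeomorphic_map (subtopology (base F) V) (zariski R) f"
  using iso by (simp add: lrs_isomorphism_def open_restriction_def base_spec)

lemma topspace_chart: "topspace (subtopology (base F) V) = V"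
  using openin_subset[OF V] by auto

lemma bij_chart: "bij_betw f V {p. primeideal p R}"
  using homeo homeomorphic_imp_injective_map homeomorphic_imp_surjective_map topspace_chart
  unfolding bij_betw_def R.topspace_zariski[symmetric] by metis

lemma prime_at: "y \<in> V \<Longrightarrow> primeideal (f y) R"
  using bij_chart bij_betwE by blast

lemma image_opn: "opn N \<Longrightarrow> N \<subseteq> V \<Longrightarrow> openin (zariski R) (f ` N)"
  using homeomorphic_map_openness_eq[OF homeo] openin_open_subtopology[OF V] by (metis)

lemma preimage_image: "N \<subseteq> V \<Longrightarrow> preimage (base (open_restriction F V)) f (f ` N) = N"
  using bij_chart topspace_chart
  by (auto simp: preimage_def open_restriction_def bij_betw_def inj_on_def subset_iff)

lemma preimage_opn:
  assumes "openin (zariski R) W"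
  shows "opn {y \<in> V. f y \<in> W}"
  using openin_continuous_map_preimage[OF homeomorphic_imp_continuous_map[OF homeo] assms]
    openin_open_subtopology[OF V] unfolding topspace_chart by blast

text \<open>
  The isomorphism of sheaves, indexed by open subsets of \<open>V\<close> instead of their images.
\<close>

definition to_section :: "'a set \<Rightarrow> ('c set \<Rightarrow> ('c \<times> 'c) set) \<Rightarrow> 'b" where
  "to_section N = \<phi> (f ` N)"

lemma section_iso:
  assumes "opn N" "N \<subseteq> V"
  shows "to_section N \<in> ring_iso (sections (spec R) (f ` N)) (\<O> N)"
  using iso image_opn[OF assms] preimage_image[OF assms(2)]
  unfolding lrs_isomorphism_def base_spec to_section_def
  by (auto simp: direct_image_def open_restriction_def)

lemma section_hom: "opn N \<Longrightarrow> N \<subseteq> V \<Longrightarrow> to_section N \<in> ring_hom (sections (spec R) (f ` N)) (\<O> N)"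
  using section_iso by (simp add: ring_iso_def)

lemma section_res:
  assumes N: "opn N" "N \<subseteq> V" and M: "opn M" "M \<subseteq> N" and s: "s \<in> carrier (sections (spec R) (f ` N))"
  shows "res N M (to_section N s) = to_section M (restrict s (f ` M))"
proof -
  have "restr (direct_image f (base (spec R)) (open_restriction F V)) (f ` N) (f ` M) (\<phi> (f ` N) s)
      = \<phi> (f ` M) (restr (spec R) (f ` N) (f ` M) s)"
    using iso[unfolded lrs_isomorphism_def lrs_morphism_def, THEN conjunct1, THEN conjunct2,
        THEN conjunct2, THEN conjunct1, THEN spec, THEN spec, THEN mp, THEN bspec, of "f ` N" "f ` M" s]
      image_opn[OF N] image_opn[OF M(1) order_trans[OF M(2) N(2)]] image_mono[OF M(2), of f] s
    by (simp add: base_spec)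
  moreover have "M \<subseteq> V" using M N by blast
  ultimately show ?thesis
    using preimage_image[OF N(2)] preimage_image[of M]
    by (simp add: direct_image_def restr_spec to_section_def) (simp add: open_restriction_def)
qed

abbreviation \<rho> :: "'a set \<Rightarrow> 'c \<Rightarrow> 'b" where
  "\<rho> N a \<equiv> to_section N (R.frac_section (f ` N) a \<one>\<^bsub>R\<^esub>)"

lemma const_closed:
  "opn N \<Longrightarrow> N \<subseteq> V \<Longrightarrow> a \<in> carrier R \<Longrightarrow>
     R.frac_section (f ` N) a \<one>\<^bsub>R\<^esub> \<in> carrier (sections (spec R) (f ` N))"
  using R.frac_section_closed[OF image_opn] R.one_notin[OF image_opn] by simp

lemma restrict_frac_section:
  "B \<subseteq> A \<Longrightarrow> restrict (R.frac_section A a g) B = R.frac_section B a g"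
  by (rule ext) (auto simp: R.frac_section_def)

lemma rho_res:
  assumes "opn N" "N \<subseteq> V" "opn M" "M \<subseteq> N" "a \<in> carrier R"
  shows "res N M (\<rho> N a) = \<rho> M a"
  using assms section_res[OF assms(1-4) const_closed] restrict_frac_section[of "f ` M" "f ` N" a "\<one>\<^bsub>R\<^esub>"]
  by (simp add: image_mono)

lemma rho_hom:
  assumes "opn N" "N \<subseteq> V"
  shows "\<rho> N \<in> ring_hom R (\<O> N)"
  using ring_hom_trans[OF R.frac_section_hom[OF image_opn] section_hom] assms by (simp add: comp_def)

text \<open>
  If \<open>r\<close> is not in the prime of \<open>y\<close>, the fraction \<open>1 / r\<close> inverts it on the basic open set of
  \<open>r\<close>.  Conversely, an inverse near \<open>y\<close> is a fraction \<open>a / g\<close> at \<open>y\<close>, and \<open>r a / g = 1\<close> puts a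
  multiple of \<open>r\<close> outside the prime.
\<close>

lemma unit_locus_rho:
  assumes r: "r \<in> carrier R"
  shows "unit_locus V (\<rho> V r) = {y \<in> V. r \<notin> f y}"
proof (intro equalityI subsetI)
  fix y assume y: "y \<in> {y \<in> V. r \<notin> f y}"
  let ?M = "{y \<in> V. f y \<in> {p. primeideal p R \<and> r \<notin> p}}"
  have M: "opn ?M" "?M \<subseteq> V" using preimage_opn[OF R.openin_zariski_basic[OF r]] by auto
  let ?N = "f ` ?M"
  have N: "openin (zariski R) ?N" using image_opn M by blast
  have rN: "r \<notin> p" if "p \<in> ?N" for p using that by blast
  have s: "R.frac_section ?N \<one>\<^bsub>R\<^esub> r \<in> carrier (sections (spec R) ?N)"
    by (rule R.frac_section_closed[OF N R.one_closed r rN])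
  have "R.frac_section ?N (\<one>\<^bsub>R\<^esub> \<otimes>\<^bsub>R\<^esub> r) \<one>\<^bsub>R\<^esub> \<otimes>\<^bsub>sections (spec R) ?N\<^esub> R.frac_section ?N \<one>\<^bsub>R\<^esub> r
      = R.frac_section ?N (\<one>\<^bsub>R\<^esub> \<otimes>\<^bsub>R\<^esub> \<one>\<^bsub>R\<^esub>) \<one>\<^bsub>R\<^esub>"
  proof (rule R.frac_section_clear[OF N s])
    fix q assume "q \<in> ?N"
    then show "r \<notin> q \<and> R.frac_section ?N \<one>\<^bsub>R\<^esub> r q = loc_frac R (carrier R - q) \<one>\<^bsub>R\<^esub> r"
      using rN by (simp only: R.frac_section_def restrict_apply if_True simp_thms)
  qed (use r in auto)
  then have "\<rho> ?M r \<otimes>\<^bsub>\<O> ?M\<^esub> to_section ?M (R.frac_section ?N \<one>\<^bsub>R\<^esub> r) = \<one>\<^bsub>\<O> ?M\<^esub>"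
    using ring_hom_mult[OF section_hom[OF M] const_closed[OF M r] s] r
      ring_hom_one[OF rho_hom[OF M]] by simp
  then have "res V ?M (\<rho> V r) \<otimes>\<^bsub>\<O> ?M\<^esub> to_section ?M (R.frac_section ?N \<one>\<^bsub>R\<^esub> r) = \<one>\<^bsub>\<O> ?M\<^esub>"
    using rho_res[OF V subset_refl M r] by simp
  moreover have "y \<in> ?M" using y prime_at by blast
  ultimately show "y \<in> unit_locus V (\<rho> V r)"
    by (intro unit_locusI[OF M(1) _ M(2) ring_hom_closed[OF section_hom[OF M] s]])
next
  fix y assume "y \<in> unit_locus V (\<rho> V r)"
  then obtain Z t where Z: "opn Z" "y \<in> Z" "Z \<subseteq> V" "t \<in> carrier (\<O> Z)"
    "res V Z (\<rho> V r) \<otimes>\<^bsub>\<O> Z\<^esub> t = \<one>\<^bsub>\<O> Z\<^esub>" by (rule unit_locusE)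
  let ?N = "f ` Z"
  have N: "openin (zariski R) ?N" using image_opn Z by blast
  have bij: "bij_betw (to_section Z) (carrier (sections (spec R) ?N)) (carrier (\<O> Z))"
    using section_iso[OF Z(1,3)] by (simp add: ring_iso_def)
  then obtain u where u: "u \<in> carrier (sections (spec R) ?N)" "t = to_section Z u"
    using Z(4) by (auto simp: bij_betw_def)
  let ?r = "R.frac_section ?N r \<one>\<^bsub>R\<^esub>"
  have "to_section Z (?r \<otimes>\<^bsub>sections (spec R) ?N\<^esub> u) = \<rho> Z r \<otimes>\<^bsub>\<O> Z\<^esub> t"
    using ring_hom_mult[OF section_hom[OF Z(1,3)] const_closed[OF Z(1,3) r] u(1)] u(2) by simp
  also have "\<dots> = \<rho> Z \<one>\<^bsub>R\<^esub>"
    using Z(5) rho_res[OF V subset_refl Z(1,3) r] ring_hom_one[OF rho_hom[OF Z(1,3)]] by simp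
  finally have eq: "?r \<otimes>\<^bsub>sections (spec R) ?N\<^esub> u = R.frac_section ?N \<one>\<^bsub>R\<^esub> \<one>\<^bsub>R\<^esub>"
    using bij R.frac_section_mult_closed[OF N r u(1)] const_closed[OF Z(1,3) R.one_closed]
    by (auto simp: bij_betw_def dest: inj_onD)
  have p: "f y \<in> ?N" using Z(2) by blast
  interpret p: primeideal "f y" R using prime_at Z by blast
  obtain W a g where ag: "openin (zariski R) W" "f y \<in> W" "a \<in> carrier R" "g \<in> carrier R"
    "\<And>q. q \<in> W \<Longrightarrow> g \<notin> q \<and> u q = loc_frac R (carrier R - q) a g"
    by (rule R.sections_specE[OF u(1) p]) blast
  have g: "g \<in> carrier R - f y" "u (f y) = p.frac a g" using ag by auto
  have "(?r \<otimes>\<^bsub>sections (spec R) ?N\<^esub> u) (f y) = p.frac r \<one>\<^bsub>R\<^esub> \<otimes>\<^bsub>localization R (carrier R - f y)\<^esub> p.frac a g"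
    using p g by (simp add: spec_def pointwise_ring_def R.frac_section_def)
  also have "\<dots> = p.frac (r \<otimes>\<^bsub>R\<^esub> a) g"
    using p.frac_mult[OF r ag(3) p.denom_one g(1)] ag(4) by simp
  finally have "p.frac (r \<otimes>\<^bsub>R\<^esub> a) g = p.frac \<one>\<^bsub>R\<^esub> \<one>\<^bsub>R\<^esub>"
    using p unfolding eq by (simp add: R.frac_section_def)
  then obtain v where v: "v \<in> carrier R - f y"
    "v \<otimes>\<^bsub>R\<^esub> (r \<otimes>\<^bsub>R\<^esub> a \<otimes>\<^bsub>R\<^esub> \<one>\<^bsub>R\<^esub>) = v \<otimes>\<^bsub>R\<^esub> (\<one>\<^bsub>R\<^esub> \<otimes>\<^bsub>R\<^esub> g)"
    using p.frac_eq_iff[of "r \<otimes>\<^bsub>R\<^esub> a" "\<one>\<^bsub>R\<^esub>" g "\<one>\<^bsub>R\<^esub>"] r ag(3) g p.denom_one by auto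
  have "r \<notin> f y"
  proof
    assume "r \<in> f y"
    then have "v \<otimes>\<^bsub>R\<^esub> (r \<otimes>\<^bsub>R\<^esub> a \<otimes>\<^bsub>R\<^esub> \<one>\<^bsub>R\<^esub>) \<in> f y"
      using v(1) ag(3) p.I_l_closed p.I_r_closed by auto
    then show False using v p.denom_mult[OF v(1) g(1)] g(1) by auto
  qed
  then show "y \<in> {y \<in> V. r \<notin> f y}" using Z by blast
qed

text \<open>
  Near \<open>y\<close> the section is \<open>a / g\<close>.  Multiplying numerator and denominator by some \<open>h\<close> whose basic
  open set lies inside the domain of this fraction makes the denominator \<open>h g\<close> a unit only there.
\<close>

lemma rho_fraction:
  assumes N: "opn N" "N \<subseteq> V" and y: "y \<in> N" and s: "s \<in> carrier (\<O> N)"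
  shows "\<exists>g\<in>carrier R. \<exists>a\<in>carrier R. y \<in> unit_locus V (\<rho> V g) \<and> unit_locus V (\<rho> V g) \<subseteq> N \<and>
           res V (unit_locus V (\<rho> V g)) (\<rho> V g) \<otimes>\<^bsub>\<O> (unit_locus V (\<rho> V g))\<^esub> res N (unit_locus V (\<rho> V g)) s
             = res V (unit_locus V (\<rho> V g)) (\<rho> V a)"
proof -
  let ?N = "f ` N"
  have fN: "openin (zariski R) ?N" using image_opn N by blast
  have bij: "bij_betw (to_section N) (carrier (sections (spec R) ?N)) (carrier (\<O> N))"
    using section_iso[OF N] by (simp add: ring_iso_def)
  then obtain u where u: "u \<in> carrier (sections (spec R) ?N)" "s = to_section N u"
    using s by (auto simp: bij_betw_def)
  have p: "f y \<in> ?N" using y by blast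
  obtain W a g where W: "openin (zariski R) W" "f y \<in> W" "W \<subseteq> ?N" "a \<in> carrier R" "g \<in> carrier R"
    and uW: "\<And>q. q \<in> W \<Longrightarrow> g \<notin> q \<and> u q = loc_frac R (carrier R - q) a g"
    by (rule R.sections_specE[OF u(1) p]) blast
  obtain h where h: "h \<in> carrier R" "h \<notin> f y" "\<And>q. primeideal q R \<Longrightarrow> h \<notin> q \<Longrightarrow> q \<in> W"
    by (rule R.zariski_basis[OF W(1,2)]) blast
  interpret p: primeideal "f y" R using prime_at N y by blast
  let ?g = "h \<otimes>\<^bsub>R\<^esub> g" and ?a = "h \<otimes>\<^bsub>R\<^esub> a"
  let ?Z = "unit_locus V (\<rho> V ?g)"
  have carr: "?g \<in> carrier R" "?a \<in> carrier R" using h W by auto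
  have Z_eq: "?Z = {y \<in> V. ?g \<notin> f y}" by (rule unit_locus_rho[OF carr(1)])
  have yZ: "y \<in> ?Z"
    unfolding Z_eq using p.denom_mult[of h g] h W uW[OF W(2)] N y by auto
  have ZW: "f z \<in> W" if "z \<in> ?Z" for z
  proof -
    interpret z: primeideal "f z" R using prime_at that unfolding Z_eq by blast
    have "h \<notin> f z" using that z.I_r_closed h(1) W(5) unfolding Z_eq by blast
    then show ?thesis using h(3) z.primeideal_axioms by blast
  qed
  have ZN: "?Z \<subseteq> N"
  proof
    fix z assume z: "z \<in> ?Z"
    with ZW W(3) obtain z' where "z' \<in> N" "f z = f z'" by blast
    moreover have "z \<in> V" using z Z_eq by blast
    ultimately show "z \<in> N" using bij_chart N(2) by (metis bij_betw_def inj_onD subsetD)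
  qed
  have Z: "opn ?Z" "?Z \<subseteq> V" using opn_unit_locus unit_locus_subset by auto
  have fZ: "openin (zariski R) (f ` ?Z)" using image_opn Z by blast
  let ?u = "restrict u (f ` ?Z)"
  have uc: "?u \<in> carrier (sections (spec R) (f ` ?Z))"
  proof (rule R.sections_specI[OF fZ])
    show "\<exists>V a g. openin (zariski R) V \<and> q \<in> V \<and> V \<subseteq> f ` ?Z \<and> a \<in> carrier R \<and>
      g \<in> carrier R \<and> (\<forall>q\<in>V. g \<notin> q \<and> ?u q = loc_frac R (carrier R - q) a g)" if "q \<in> f ` ?Z" for q
      using that fZ W ZW uW by (intro exI[of _ "f ` ?Z"] exI[of _ a] exI[of _ g]) auto
  qed simp
  have "R.frac_section (f ` ?Z) ?g \<one>\<^bsub>R\<^esub> \<otimes>\<^bsub>sections (spec R) (f ` ?Z)\<^esub> ?u = R.frac_section (f ` ?Z) ?a \<one>\<^bsub>R\<^esub>"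
    using W h ZW uW by (intro R.frac_section_clear[OF fZ uc]) auto
  then have "\<rho> ?Z ?g \<otimes>\<^bsub>\<O> ?Z\<^esub> to_section ?Z ?u = \<rho> ?Z ?a"
    using ring_hom_mult[OF section_hom[OF Z] const_closed[OF Z carr(1)] uc] by simp
  moreover have "to_section ?Z ?u = res N ?Z s"
    using section_res[OF N Z(1) ZN u(1)] u(2) by simp
  ultimately have "res V ?Z (\<rho> V ?g) \<otimes>\<^bsub>\<O> ?Z\<^esub> res N ?Z s = res V ?Z (\<rho> V ?a)"
    using rho_res[OF V subset_refl Z] carr by simp
  with yZ ZN carr show ?thesis by blast
qed

lemma affine_chart_of_iso: "affine_chart V R (\<rho> V) f"
  unfolding affine_chart_def
  using V R rho_hom[OF V subset_refl] bij_chart unit_locus_rho rho_fraction by blast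

end

end

section \<open>Points and functions on reduced schemes\<close>

lemma (in primeideal) mult_mem_iff:
  "a \<in> carrier R \<Longrightarrow> b \<in> carrier R \<Longrightarrow> a \<notin> I \<Longrightarrow> a \<otimes> b \<in> I \<longleftrightarrow> b \<in> I"
  using I_prime I_l_closed by blast

context ringed_space
begin

text \<open>
  The value of \<open>s\<close> at \<open>y\<close> is its class in the residue field; it is zero iff the germ of \<open>s\<close> at
  \<open>y\<close> is not a unit.  So this is the ideal of sections vanishing at \<open>y\<close>.
\<close>

definition nonunits :: "'a set \<Rightarrow> 'a \<Rightarrow> 'b set" where
  "nonunits N y = {s \<in> carrier (\<O> N). y \<notin> unit_locus N s}"

lemma mem_nonunits: "s \<in> carrier (\<O> N) \<Longrightarrow> s \<in> nonunits N y \<longleftrightarrow> y \<notin> unit_locus N s"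
  by (simp add: nonunits_def)

lemma nonunits_res: "opn N \<Longrightarrow> opn M \<Longrightarrow> M \<subseteq> N \<Longrightarrow> y \<in> M \<Longrightarrow> s \<in> carrier (\<O> N) \<Longrightarrow>
    res N M s \<in> nonunits M y \<longleftrightarrow> s \<in> nonunits N y"
  by (simp add: nonunits_def unit_locus_res)

lemma unit_locus_cancel:
  assumes Z: "opn Z" and s: "s \<in> carrier (\<O> Z)" "unit_locus Z s = Z" and t: "t \<in> carrier (\<O> Z)"
    and st: "s \<otimes>\<^bsub>\<O> Z\<^esub> t = \<zero>\<^bsub>\<O> Z\<^esub>"
  shows "t = \<zero>\<^bsub>\<O> Z\<^esub>"
proof -
  interpret cring "\<O> Z" using Z cring_sections by blast
  obtain u where u: "u \<in> carrier (\<O> Z)" "s \<otimes>\<^bsub>\<O> Z\<^esub> u = \<one>\<^bsub>\<O> Z\<^esub>"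
    by (rule inverse_on_unit_locus[OF Z s]) blast
  have "t = (s \<otimes>\<^bsub>\<O> Z\<^esub> u) \<otimes>\<^bsub>\<O> Z\<^esub> t" using t u by simp
  also have "\<dots> = u \<otimes>\<^bsub>\<O> Z\<^esub> (s \<otimes>\<^bsub>\<O> Z\<^esub> t)" using s t u(1) by (simp add: m_ac)
  finally show ?thesis using st u by simp
qed

context
  fixes V :: "'a set" and R :: "('c, 'm) ring_scheme" and \<rho> pr
  assumes chart: "affine_chart V R \<rho> pr"
begin

lemma chart_opn: "opn V" and chart_ring: "cring R" and chart_hom: "\<rho> \<in> ring_hom R (\<O> V)"
  and chart_bij: "bij_betw pr V {p. primeideal p R}"
  and chart_unit_locus: "r \<in> carrier R \<Longrightarrow> unit_locus V (\<rho> r) = {y \<in> V. r \<notin> pr y}"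
  using chart by (auto simp: affine_chart_def)

lemma chart_fraction:
  assumes "opn N" "N \<subseteq> V" "y \<in> N" "s \<in> carrier (\<O> N)"
  obtains g a where "g \<in> carrier R" "a \<in> carrier R" "y \<in> unit_locus V (\<rho> g)" "unit_locus V (\<rho> g) \<subseteq> N"
    "res V (unit_locus V (\<rho> g)) (\<rho> g) \<otimes>\<^bsub>\<O> (unit_locus V (\<rho> g))\<^esub> res N (unit_locus V (\<rho> g)) s
             = res V (unit_locus V (\<rho> g)) (\<rho> a)"
  using chart assms unfolding affine_chart_def by meson

interpretation \<rho>: ring_hom_cring R "\<O> V" \<rho>
  using chart_hom chart_ring cring_sections[OF chart_opn]
  by (auto simp: ring_hom_cring_def ring_hom_cring_axioms_def)

lemma chart_prime: "y \<in> V \<Longrightarrow> primeideal (pr y) R"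
  using chart_bij bij_betwE by blast

lemma chart_zero:
  assumes "opn N" "y \<in> N" "y \<in> V"
  shows "y \<notin> unit_locus N \<zero>\<^bsub>\<O> N\<^esub>"
proof -
  interpret N: cring "\<O> N" using assms cring_sections by blast
  interpret p: primeideal "pr y" R by (rule chart_prime[OF assms(3)])
  have "y \<notin> unit_locus V (\<rho> \<zero>\<^bsub>R\<^esub>)" using chart_unit_locus[of "\<zero>\<^bsub>R\<^esub>"] p.zero_closed by simp
  then have "y \<notin> unit_locus V \<zero>\<^bsub>\<O> V\<^esub>" by simp
  moreover have M: "opn (N \<inter> V)" using assms chart_opn openin_Int by blast
  have "unit_locus (N \<inter> V) \<zero>\<^bsub>\<O> (N \<inter> V)\<^esub> = unit_locus V \<zero>\<^bsub>\<O> V\<^esub> \<inter> (N \<inter> V)"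
    using unit_locus_res[OF chart_opn M, of "\<zero>\<^bsub>\<O> V\<^esub>"] M chart_opn by simp
  moreover have "unit_locus (N \<inter> V) \<zero>\<^bsub>\<O> (N \<inter> V)\<^esub> = unit_locus N \<zero>\<^bsub>\<O> N\<^esub> \<inter> (N \<inter> V)"
    using unit_locus_res[OF assms(1) M, of "\<zero>\<^bsub>\<O> N\<^esub>"] M assms(1) by simp
  ultimately show ?thesis using assms by blast
qed

text \<open>
  The germs at \<open>y\<close> form a local ring.  Near \<open>y\<close> write the sections as \<open>a / g\<close> and \<open>b / h\<close>, with
  \<open>a\<close> and \<open>b\<close> in the prime of \<open>y\<close>; their sum is \<open>(h a + g b) / (g h)\<close>, with numerator in that
  prime.
\<close>

lemma chart_add:
  assumes N: "opn N" and y: "y \<in> N" "y \<in> V" and s: "s \<in> carrier (\<O> N)" "y \<notin> unit_locus N s"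
    and t: "t \<in> carrier (\<O> N)" "y \<notin> unit_locus N t"
  shows "y \<notin> unit_locus N (s \<oplus>\<^bsub>\<O> N\<^esub> t)"
proof
  assume sum: "y \<in> unit_locus N (s \<oplus>\<^bsub>\<O> N\<^esub> t)"
  interpret p: primeideal "pr y" R by (rule chart_prime[OF y(2)])
  let ?M = "N \<inter> V"
  have M: "opn ?M" "?M \<subseteq> V" "y \<in> ?M" "?M \<subseteq> N" using N y chart_opn by auto
  obtain g a where g: "g \<in> carrier R" "a \<in> carrier R" "y \<in> unit_locus V (\<rho> g)" "unit_locus V (\<rho> g) \<subseteq> ?M"
    "res V (unit_locus V (\<rho> g)) (\<rho> g) \<otimes>\<^bsub>\<O> (unit_locus V (\<rho> g))\<^esub> res ?M (unit_locus V (\<rho> g)) (res N ?M s)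
             = res V (unit_locus V (\<rho> g)) (\<rho> a)"
    by (rule chart_fraction[OF M(1-3) res_closed[OF N M(1,4) s(1)]]) blast
  obtain h b where h: "h \<in> carrier R" "b \<in> carrier R" "y \<in> unit_locus V (\<rho> h)" "unit_locus V (\<rho> h) \<subseteq> ?M"
    "res V (unit_locus V (\<rho> h)) (\<rho> h) \<otimes>\<^bsub>\<O> (unit_locus V (\<rho> h))\<^esub> res ?M (unit_locus V (\<rho> h)) (res N ?M t)
             = res V (unit_locus V (\<rho> h)) (\<rho> b)"
    by (rule chart_fraction[OF M(1-3) res_closed[OF N M(1,4) t(1)]]) blast
  let ?Zg = "unit_locus V (\<rho> g)" and ?Zh = "unit_locus V (\<rho> h)"
  let ?Z = "?Zg \<inter> ?Zh"
  have Z: "opn ?Zg" "opn ?Zh" "opn ?Z" "?Z \<subseteq> ?M" "?Z \<subseteq> N" "?Z \<subseteq> V" "y \<in> ?Z" "?Zg \<subseteq> N" "?Zh \<subseteq> N"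
    "?Zg \<subseteq> V" "?Zh \<subseteq> V" "?Zg \<subseteq> ?M" "?Zh \<subseteq> ?M"
    using opn_unit_locus g h by auto
  interpret Z: cring "\<O> ?Z" using Z cring_sections by blast
  let ?s = "res N ?Z s" and ?t = "res N ?Z t" and ?r = "\<lambda>c. res V ?Z (\<rho> c)"
  have eg: "?r g \<otimes>\<^bsub>\<O> ?Z\<^esub> ?s = ?r a"
    using arg_cong[OF g(5), of "res ?Zg ?Z"] Z N M g s chart_opn by (simp add: res_mult)
  have eh: "?r h \<otimes>\<^bsub>\<O> ?Z\<^esub> ?t = ?r b"
    using arg_cong[OF h(5), of "res ?Zh ?Z"] Z N M h t chart_opn by (simp add: res_mult)
  have c: "?r g \<in> carrier (\<O> ?Z)" "?r h \<in> carrier (\<O> ?Z)" "?s \<in> carrier (\<O> ?Z)" "?t \<in> carrier (\<O> ?Z)"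
    using Z N g h s t chart_opn by simp_all
  have "y \<notin> unit_locus ?Z (?r a)"
    unfolding eg[symmetric] unit_locus_mult[OF Z(3) c(1,3)] using unit_locus_res[OF N Z(3,5) s(1)] s(2) by blast
  then have a: "a \<in> pr y" using unit_locus_res[OF chart_opn Z(3,6), of "\<rho> a"] chart_unit_locus[OF g(2)] g Z by auto
  have "y \<notin> unit_locus ?Z (?r b)"
    unfolding eh[symmetric] unit_locus_mult[OF Z(3) c(2,4)] using unit_locus_res[OF N Z(3,5) t(1)] t(2) by blast
  then have b: "b \<in> pr y" using unit_locus_res[OF chart_opn Z(3,6), of "\<rho> b"] chart_unit_locus[OF h(2)] h Z by auto
  let ?c = "h \<otimes>\<^bsub>R\<^esub> a \<oplus>\<^bsub>R\<^esub> g \<otimes>\<^bsub>R\<^esub> b"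
  \<comment> \<open>\<open>h a + g b\<close> is the numerator of \<open>s + t\<close> over the common denominator \<open>g h\<close>.\<close>
  have "?r ?c = ?r h \<otimes>\<^bsub>\<O> ?Z\<^esub> ?r a \<oplus>\<^bsub>\<O> ?Z\<^esub> ?r g \<otimes>\<^bsub>\<O> ?Z\<^esub> ?r b"
    using g h Z chart_opn by (simp add: res_mult res_add)
  also have "\<dots> = (?r g \<otimes>\<^bsub>\<O> ?Z\<^esub> ?r h) \<otimes>\<^bsub>\<O> ?Z\<^esub> (?s \<oplus>\<^bsub>\<O> ?Z\<^esub> ?t)"
    unfolding eg[symmetric] eh[symmetric] using c by algebra
  finally have "unit_locus ?Z (?r ?c) = (unit_locus ?Z (?r g) \<inter> unit_locus ?Z (?r h)) \<inter> unit_locus ?Z (res N ?Z (s \<oplus>\<^bsub>\<O> N\<^esub> t))"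
    using c s t N Z by (simp add: unit_locus_mult res_add)
  moreover have "s \<oplus>\<^bsub>\<O> N\<^esub> t \<in> carrier (\<O> N)"
    using s t N cring_sections[THEN cring.axioms(1), THEN ring.is_abelian_group]
    by (meson abelian_groupE(1))
  ultimately have "y \<in> unit_locus ?Z (?r ?c)"
    using unit_locus_res[OF chart_opn Z(3,6), of "\<rho> g"] unit_locus_res[OF chart_opn Z(3,6), of "\<rho> h"]
      unit_locus_res[OF N Z(3,5), of "s \<oplus>\<^bsub>\<O> N\<^esub> t"] sum g h Z by auto
  moreover have "?c \<in> pr y" using a b g h by (simp add: p.I_l_closed p.a_closed)
  moreover have "?c \<in> carrier R" using g h by simp
  ultimately show False using unit_locus_res[OF chart_opn Z(3,6), of "\<rho> ?c"] chart_unit_locus[of ?c] by auto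
qed

end

end

text \<open>
  The type of the ring \<open>R\<close> is that of the sections, as for affine schemes.
\<close>

locale reduced_scheme = ringed_space F for F :: "('a, 'b) presheaf" +
  assumes charts: "x \<in> topspace (base F) \<Longrightarrow>
      \<exists>V (R :: 'b ring) \<rho> pr. x \<in> V \<and> affine_chart V R \<rho> pr"
    and red: "reduced F"
begin

lemma point_chart:
  assumes "opn N" "y \<in> N"
  obtains V and R :: "'b ring" and \<rho> pr where "y \<in> V" "affine_chart V R \<rho> pr"
proof -
  have "y \<in> topspace (base F)" using assms openin_subset by blast
  then show thesis using charts that by metis
qed

lemma primeideal_nonunits:
  assumes N: "opn N" and y: "y \<in> N"
  shows "primeideal (nonunits N y) (\<O> N)"
proof -
  interpret cring "\<O> N" using N cring_sections by blast
  obtain V and R :: "'b ring" and \<rho> pr where V: "y \<in> V" "affine_chart V R \<rho> pr"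
    by (rule point_chart[OF N y])
  have mult: "x \<otimes>\<^bsub>\<O> N\<^esub> a \<in> nonunits N y" if "a \<in> nonunits N y" "x \<in> carrier (\<O> N)" for a x
    using that unit_locus_mult[OF N] by (auto simp: nonunits_def)
  have uminus: "\<ominus>\<^bsub>\<O> N\<^esub> a \<in> nonunits N y" if "a \<in> nonunits N y" for a
  proof -
    have "a \<in> carrier (\<O> N)" using that by (simp add: nonunits_def)
    then have "\<ominus>\<^bsub>\<O> N\<^esub> a = (\<ominus>\<^bsub>\<O> N\<^esub> \<one>\<^bsub>\<O> N\<^esub>) \<otimes>\<^bsub>\<O> N\<^esub> a" by algebra
    then show ?thesis using mult[OF that] by simp
  qed
  have zero: "\<zero>\<^bsub>\<O> N\<^esub> \<in> nonunits N y" using chart_zero[OF V(2) N y V(1)] by (simp add: nonunits_def)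
  have add: "a \<oplus>\<^bsub>\<O> N\<^esub> b \<in> nonunits N y" if "a \<in> nonunits N y" "b \<in> nonunits N y" for a b
    using that chart_add[OF V(2) N y V(1)] by (simp add: nonunits_def)
  have "ideal (nonunits N y) (\<O> N)"
  proof (rule idealI[OF ring_axioms])
    show "subgroup (nonunits N y) (add_monoid (\<O> N))"
      using zero add uminus by (intro add.subgroupI) (auto simp: nonunits_def)
  next
    fix a x assume *: "a \<in> nonunits N y" "x \<in> carrier (\<O> N)"
    then show "x \<otimes>\<^bsub>\<O> N\<^esub> a \<in> nonunits N y" by (rule mult)
    then show "a \<otimes>\<^bsub>\<O> N\<^esub> x \<in> nonunits N y" using * m_comm[of a x] by (simp add: nonunits_def)
  qed
  moreover have "\<one>\<^bsub>\<O> N\<^esub> \<notin> nonunits N y" using unit_locus_one[OF N] y by (simp add: nonunits_def)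
  then have "carrier (\<O> N) \<noteq> nonunits N y" by auto
  moreover have "a \<in> nonunits N y \<or> b \<in> nonunits N y"
    if "a \<in> carrier (\<O> N)" "b \<in> carrier (\<O> N)" "a \<otimes>\<^bsub>\<O> N\<^esub> b \<in> nonunits N y" for a b
    using that unit_locus_mult[OF N] by (auto simp: nonunits_def)
  ultimately show ?thesis using is_cring by (intro primeidealI)
qed

text \<open>
  A function that vanishes at every point is zero.  Near a point it is \<open>a / g\<close>; the numerator lies in
  every prime that does not contain \<open>g\<close>, so \<open>g a\<close> lies in every prime of \<open>R\<close> and is nilpotent.  By
  reducedness its image is zero, and on the basic open set of \<open>g\<close> one can divide by \<open>g\<^sup>2\<close>.
\<close>

lemma nowhere_invertible_zero:
  assumes N: "opn N" and s: "s \<in> carrier (\<O> N)" and unit_locus: "unit_locus N s = {}"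
  shows "s = \<zero>\<^bsub>\<O> N\<^esub>"
proof (rule section_eqI[OF N s])
  interpret N: cring "\<O> N" using N cring_sections by blast
  show "\<zero>\<^bsub>\<O> N\<^esub> \<in> carrier (\<O> N)" by simp
  fix y assume y: "y \<in> N"
  obtain V and R :: "'b ring" and \<rho> pr where V: "y \<in> V" and ch: "affine_chart V R \<rho> pr"
    by (rule point_chart[OF N y])
  note opn_V = chart_opn[OF ch]
  interpret \<rho>: ring_hom_cring R "\<O> V" \<rho>
    using chart_hom[OF ch] chart_ring[OF ch] cring_sections[OF opn_V]
    by (auto simp: ring_hom_cring_def ring_hom_cring_axioms_def)
  let ?M = "N \<inter> V"
  have M: "opn ?M" "?M \<subseteq> V" "y \<in> ?M" "?M \<subseteq> N" using N y V opn_V by auto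
  obtain g a where g: "g \<in> carrier R" "a \<in> carrier R" "y \<in> unit_locus V (\<rho> g)" "unit_locus V (\<rho> g) \<subseteq> ?M"
    "res V (unit_locus V (\<rho> g)) (\<rho> g) \<otimes>\<^bsub>\<O> (unit_locus V (\<rho> g))\<^esub> res ?M (unit_locus V (\<rho> g)) (res N ?M s)
             = res V (unit_locus V (\<rho> g)) (\<rho> a)"
    by (rule chart_fraction[OF ch M(1-3) res_closed[OF N M(1,4) s]]) blast
  let ?Z = "unit_locus V (\<rho> g)"
  have Z: "opn ?Z" "?Z \<subseteq> N" "?Z \<subseteq> V" "?Z \<subseteq> ?M" using g opn_unit_locus by auto
  interpret Z: cring "\<O> ?Z" using Z cring_sections by blast
  let ?s = "res N ?Z s" and ?g = "res V ?Z (\<rho> g)"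
  have c: "?s \<in> carrier (\<O> ?Z)" "?g \<in> carrier (\<O> ?Z)" using N Z s opn_V g by simp_all
  have eq: "?g \<otimes>\<^bsub>\<O> ?Z\<^esub> ?s = res V ?Z (\<rho> a)" using g(5) N M Z s by simp
  have nvs: "unit_locus ?Z ?s = {}" using unit_locus_res[OF N Z(1,2) s] unit_locus by simp
  then have "unit_locus ?Z (res V ?Z (\<rho> a)) = {}" unfolding eq[symmetric] unit_locus_mult[OF Z(1) c(2,1)] by simp
  then have nva: "unit_locus V (\<rho> a) \<inter> ?Z = {}" using unit_locus_res[OF opn_V Z(1,3), of "\<rho> a"] g by simp
  have "g \<otimes>\<^bsub>R\<^esub> a \<in> p" if "primeideal p R" for p
  proof -
    interpret p: primeideal p R by fact
    have "p \<in> pr ` V" using chart_bij[OF ch] that by (simp add: bij_betw_def)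
    then obtain z where z: "z \<in> V" "p = pr z" by blast
    show ?thesis
    proof (cases "g \<in> p")
      case True then show ?thesis using p.I_r_closed g by simp
    next
      case False
      then have "a \<in> p" using nva chart_unit_locus[OF ch g(1)] chart_unit_locus[OF ch g(2)] z by auto
      then show ?thesis using p.I_l_closed g by simp
    qed
  qed
  then obtain n :: nat where n: "(g \<otimes>\<^bsub>R\<^esub> a) [^]\<^bsub>R\<^esub> n = \<zero>\<^bsub>R\<^esub>"
    using \<rho>.R.nilpotent_if_in_all_primes[of "g \<otimes>\<^bsub>R\<^esub> a"] g by auto
  have "\<rho> (g \<otimes>\<^bsub>R\<^esub> a) [^]\<^bsub>\<O> V\<^esub> n = \<rho> ((g \<otimes>\<^bsub>R\<^esub> a) [^]\<^bsub>R\<^esub> n)"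
    using g by (intro \<rho>.ring.hom_nat_pow[symmetric]) auto
  then have "\<rho> (g \<otimes>\<^bsub>R\<^esub> a) = \<zero>\<^bsub>\<O> V\<^esub>"
    using n red opn_V g unfolding reduced_def reduced_ring_def by auto
  then have "?g \<otimes>\<^bsub>\<O> ?Z\<^esub> res V ?Z (\<rho> a) = \<zero>\<^bsub>\<O> ?Z\<^esub>"
    using g opn_V Z by (simp flip: res_mult \<rho>.hom_mult)
  moreover have "unit_locus ?Z ?g = ?Z" using unit_locus_res[OF opn_V Z(1,3), of "\<rho> g"] g by simp
  ultimately have "?s = \<zero>\<^bsub>\<O> ?Z\<^esub>"
    using unit_locus_cancel[OF Z(1) c(2)] c eq Z.m_closed by metis
  then show "\<exists>Z. opn Z \<and> y \<in> Z \<and> Z \<subseteq> N \<and> res N Z s = res N Z \<zero>\<^bsub>\<O> N\<^esub>"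
    using Z N g(3) by (intro exI[of _ ?Z]) simp
qed

text \<open>
  Where \<open>h\<close> does not vanish, \<open>w\<close> is zero; hence \<open>h w\<close> vanishes at every point.
\<close>

lemma mult_eq_zeroI:
  assumes N: "opn N" and h: "h \<in> carrier (\<O> N)" and w: "w \<in> carrier (\<O> N)"
    and Z: "opn Z" "Z \<subseteq> N" "unit_locus N h \<subseteq> Z" and z: "res N Z w = \<zero>\<^bsub>\<O> Z\<^esub>"
  shows "h \<otimes>\<^bsub>\<O> N\<^esub> w = \<zero>\<^bsub>\<O> N\<^esub>"
proof (rule nowhere_invertible_zero[OF N])
  interpret N: cring "\<O> N" using N cring_sections by blast
  interpret Z: cring "\<O> Z" using Z cring_sections by blast
  show "h \<otimes>\<^bsub>\<O> N\<^esub> w \<in> carrier (\<O> N)" using h w by simp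
  have "y \<notin> unit_locus N w" if "y \<in> Z" for y
  proof -
    have "\<zero>\<^bsub>\<O> Z\<^esub> \<in> nonunits Z y"
      using primeideal_nonunits[OF Z(1) that] primeideal.axioms(1) ideal.axioms(1)
        additive_subgroup.zero_closed by metis
    then show ?thesis using nonunits_res[OF N Z(1,2) that w] w z by (simp add: nonunits_def)
  qed
  then show "unit_locus N (h \<otimes>\<^bsub>\<O> N\<^esub> w) = {}" using unit_locus_mult[OF N h w] Z(3) by blast
qed

lemma square_zero:
  assumes "opn N" "s \<in> carrier (\<O> N)" "s \<otimes>\<^bsub>\<O> N\<^esub> s = \<zero>\<^bsub>\<O> N\<^esub>"
  shows "s = \<zero>\<^bsub>\<O> N\<^esub>"
proof -
  interpret cring "\<O> N" using assms cring_sections by blast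
  have "s [^]\<^bsub>\<O> N\<^esub> (2::nat) = \<zero>\<^bsub>\<O> N\<^esub>" using assms by (simp add: numeral_2_eq_2)
  then show ?thesis using red assms unfolding reduced_def reduced_ring_def by blast
qed

context
  fixes V :: "'a set" and R :: "('c, 'm) ring_scheme" and \<rho> pr
  assumes chart: "affine_chart V R \<rho> pr"
begin

interpretation \<rho>: ring_hom_cring R "\<O> V" \<rho>
  using chart_hom[OF chart] chart_ring[OF chart] cring_sections[OF chart_opn[OF chart]]
  by (auto simp: ring_hom_cring_def ring_hom_cring_axioms_def)

text \<open>
  A local fraction \<open>a / g\<close> becomes a global identity \<open>g\<^sup>2 s = g a\<close> on \<open>N\<close>: the difference
  \<open>g s - a\<close> vanishes where \<open>g\<close> is a unit, so \<open>g\<close> kills it.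
\<close>

lemma chart_clear_denominator:
  assumes N: "opn N" "N \<subseteq> V" and y: "y \<in> N" and s: "s \<in> carrier (\<O> N)"
  obtains g a where "g \<in> carrier R" "a \<in> carrier R" "y \<in> unit_locus V (\<rho> g)" "unit_locus V (\<rho> g) \<subseteq> N"
    "res V N (\<rho> g) \<otimes>\<^bsub>\<O> N\<^esub> s = res V N (\<rho> a)"
proof -
  note opn_V = chart_opn[OF chart]
  interpret N: cring "\<O> N" using N cring_sections by blast
  obtain g a where g: "g \<in> carrier R" "a \<in> carrier R" "y \<in> unit_locus V (\<rho> g)" "unit_locus V (\<rho> g) \<subseteq> N"
    "res V (unit_locus V (\<rho> g)) (\<rho> g) \<otimes>\<^bsub>\<O> (unit_locus V (\<rho> g))\<^esub> res N (unit_locus V (\<rho> g)) s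
             = res V (unit_locus V (\<rho> g)) (\<rho> a)"
    by (rule chart_fraction[OF chart N y s]) blast
  let ?Z = "unit_locus V (\<rho> g)"
  have Z: "opn ?Z" "?Z \<subseteq> V" using opn_unit_locus unit_locus_subset by auto
  interpret Z: cring "\<O> ?Z" using Z cring_sections by blast
  let ?g = "res V N (\<rho> g)" and ?a = "res V N (\<rho> a)"
  have c: "?g \<in> carrier (\<O> N)" "?a \<in> carrier (\<O> N)" using N g opn_V by simp_all
  have "res N ?Z (?g \<otimes>\<^bsub>\<O> N\<^esub> s \<ominus>\<^bsub>\<O> N\<^esub> ?a) = \<zero>\<^bsub>\<O> ?Z\<^esub>"
    using N Z g(1-4) s c opn_V by (simp add: res_minus res_mult g(5) Z.minus_eq Z.r_neg)
  moreover have "unit_locus N ?g \<subseteq> ?Z" using unit_locus_res[OF opn_V N, of "\<rho> g"] g by simp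
  ultimately have "?g \<otimes>\<^bsub>\<O> N\<^esub> (?g \<otimes>\<^bsub>\<O> N\<^esub> s \<ominus>\<^bsub>\<O> N\<^esub> ?a) = \<zero>\<^bsub>\<O> N\<^esub>"
    using c s by (intro mult_eq_zeroI[OF N(1) _ _ Z(1) g(4)]) auto
  moreover have "?g \<otimes>\<^bsub>\<O> N\<^esub> (?g \<otimes>\<^bsub>\<O> N\<^esub> s \<ominus>\<^bsub>\<O> N\<^esub> ?a)
      = (?g \<otimes>\<^bsub>\<O> N\<^esub> ?g) \<otimes>\<^bsub>\<O> N\<^esub> s \<ominus>\<^bsub>\<O> N\<^esub> ?g \<otimes>\<^bsub>\<O> N\<^esub> ?a"
    using c s by algebra
  ultimately have "(?g \<otimes>\<^bsub>\<O> N\<^esub> ?g) \<otimes>\<^bsub>\<O> N\<^esub> s = ?g \<otimes>\<^bsub>\<O> N\<^esub> ?a"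
    using c s N.r_right_minus_eq by simp
  then have "res V N (\<rho> (g \<otimes>\<^bsub>R\<^esub> g)) \<otimes>\<^bsub>\<O> N\<^esub> s = res V N (\<rho> (g \<otimes>\<^bsub>R\<^esub> a))"
    using g N opn_V by (simp add: res_mult)
  moreover have "unit_locus V (\<rho> (g \<otimes>\<^bsub>R\<^esub> g)) = ?Z" using g opn_V by (simp add: unit_locus_mult)
  ultimately show thesis using g by (intro that[of "g \<otimes>\<^bsub>R\<^esub> g" "g \<otimes>\<^bsub>R\<^esub> a"]) auto
qed

lemma chart_nonunits_inj:
  assumes "y \<in> V" "z \<in> V" "nonunits V y = nonunits V z"
  shows "y = z"
proof -
  have "pr x = {r \<in> carrier R. \<rho> r \<in> nonunits V x}" if "x \<in> V" for x
    using that chart_unit_locus[OF chart] ideal.Icarr[OF primeideal.axioms(1)[OF chart_prime[OF chart that]]]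
    by (auto simp: nonunits_def)
  then have "pr y = pr z" using assms by metis
  then show ?thesis using chart_bij[OF chart] assms by (auto simp: bij_betw_def dest: inj_onD)
qed

text \<open>
  The points of \<open>V\<close> that generalize \<open>x\<close> are the primes of the ring of sections over \<open>V\<close> inside the
  ideal of \<open>x\<close>.  The preimage of \<open>J\<close> in \<open>R\<close> is the prime of some point \<open>\<eta>\<close>.  A section \<open>s\<close>
  satisfies \<open>g s = a\<close> on all of \<open>V\<close> with \<open>g\<close> and \<open>a\<close> from \<open>R\<close> and \<open>g\<close> not vanishing at \<open>x\<close>; so
  its membership in \<open>J\<close> and in the ideal of \<open>\<eta>\<close> are both decided by \<open>a\<close>.
\<close>

lemma chart_point:
  assumes J: "primeideal J (\<O> V)" and x: "x \<in> V" "J \<subseteq> nonunits V x"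
  obtains \<eta> where "\<eta> \<in> V" "nonunits V \<eta> = J"
proof -
  note opn_V = chart_opn[OF chart]
  interpret J: primeideal J "\<O> V" by fact
  let ?q = "{r \<in> carrier R. \<rho> r \<in> J}"
  have "\<one>\<^bsub>\<O> V\<^esub> \<notin> J" using J.I_notcarr J.one_imp_carrier by blast
  then have "\<one>\<^bsub>R\<^esub> \<notin> ?q" by simp
  then have "primeideal ?q R"
  proof (intro primeidealI[OF \<rho>.ring.ideal_vimage[OF J.is_ideal] chart_ring[OF chart]])
    show "carrier R \<noteq> ?q" using \<open>\<one>\<^bsub>R\<^esub> \<notin> ?q\<close> by blast
    show "a \<in> ?q \<or> b \<in> ?q" if "a \<in> carrier R" "b \<in> carrier R" "a \<otimes>\<^bsub>R\<^esub> b \<in> ?q" for a b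
      using that J.I_prime[of "\<rho> a" "\<rho> b"] by simp
  qed
  then have "?q \<in> pr ` V" using chart_bij[OF chart] by (simp add: bij_betw_def)
  then obtain \<eta> where \<eta>: "\<eta> \<in> V" "pr \<eta> = ?q" by auto
  interpret v: primeideal "nonunits V \<eta>" "\<O> V" by (rule primeideal_nonunits[OF opn_V \<eta>(1)])
  have same: "\<rho> r \<in> nonunits V \<eta> \<longleftrightarrow> \<rho> r \<in> J" if r: "r \<in> carrier R" for r
  proof -
    have "\<rho> r \<in> nonunits V \<eta> \<longleftrightarrow> r \<in> pr \<eta>"
      unfolding mem_nonunits[OF \<rho>.hom_closed[OF r]] chart_unit_locus[OF chart r] using \<eta>(1) by blast
    then show ?thesis using r unfolding \<eta>(2) by blast
  qed
  have "s \<in> nonunits V \<eta> \<longleftrightarrow> s \<in> J" if s: "s \<in> carrier (\<O> V)" for s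
  proof -
    obtain g a where g: "g \<in> carrier R" "a \<in> carrier R" "x \<in> unit_locus V (\<rho> g)" "unit_locus V (\<rho> g) \<subseteq> V"
      and "res V V (\<rho> g) \<otimes>\<^bsub>\<O> V\<^esub> s = res V V (\<rho> a)"
      by (rule chart_clear_denominator[OF opn_V subset_refl x(1) s])
    then have eq: "\<rho> g \<otimes>\<^bsub>\<O> V\<^esub> s = \<rho> a"
      unfolding res_id[OF opn_V \<rho>.hom_closed[OF g(1)]] res_id[OF opn_V \<rho>.hom_closed[OF g(2)]] by blast
    have nJ: "\<rho> g \<notin> J"
    proof
      assume "\<rho> g \<in> J"
      then have "\<rho> g \<in> nonunits V x" using x(2) by (rule rev_subsetD)
      then show False using g(3) mem_nonunits[OF \<rho>.hom_closed[OF g(1)]] by simp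
    qed
    have unit_locus: "\<rho> g \<notin> nonunits V \<eta>" using nJ same[OF g(1)] by simp
    have "s \<in> nonunits V \<eta> \<longleftrightarrow> \<rho> a \<in> nonunits V \<eta>"
      unfolding eq[symmetric] by (rule v.mult_mem_iff[OF \<rho>.hom_closed[OF g(1)] s unit_locus, symmetric])
    moreover have "s \<in> J \<longleftrightarrow> \<rho> a \<in> J"
      unfolding eq[symmetric] by (rule J.mult_mem_iff[OF \<rho>.hom_closed[OF g(1)] s nJ, symmetric])
    ultimately show ?thesis using same[OF g(2)] by (simp only:)
  qed
  moreover have "s \<in> carrier (\<O> V)" if "s \<in> nonunits V \<eta> \<or> s \<in> J" for s
    using that v.Icarr J.Icarr by (elim disjE)
  ultimately have "nonunits V \<eta> = J" by (intro Set.set_eqI) metis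
  with \<eta>(1) show thesis by (rule that)
qed

end

end

section \<open>Germs\<close>

context ring_presheaf
begin

text \<open>
  The pairs \<open>(V, s)\<close> that represent germs along the set \<open>A\<close>.
\<close>

definition near :: "'a set \<Rightarrow> 'a set \<Rightarrow> 'b \<Rightarrow> bool" where
  "near A V s \<longleftrightarrow> opn V \<and> A \<subseteq> V \<and> s \<in> carrier (\<O> V)"

lemma nearD: "near A V s \<Longrightarrow> opn V" "near A V s \<Longrightarrow> A \<subseteq> V" "near A V s \<Longrightarrow> s \<in> carrier (\<O> V)"
  by (auto simp: near_def)

lemma near_res: "near A V s \<Longrightarrow> opn Z \<Longrightarrow> A \<subseteq> Z \<Longrightarrow> Z \<subseteq> V \<Longrightarrow> near A Z (res V Z s)"
  by (simp add: near_def)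

lemma mem_germ_rel:
  "((V, s), (W, t)) \<in> germ_rel F A \<longleftrightarrow> near A V s \<and> near A W t \<and>
     (\<exists>Z. opn Z \<and> A \<subseteq> Z \<and> Z \<subseteq> V \<inter> W \<and> res V Z s = res W Z t)"
  by (auto simp: germ_rel_def near_def)

lemma equiv_germ_rel: "equiv {(V, s). near A V s} (germ_rel F A)"
proof (rule equivI)
  show "germ_rel F A \<subseteq> {(V, s). near A V s} \<times> {(V, s). near A V s}"
    by (auto simp: mem_germ_rel)
  show "refl_on {(V, s). near A V s} (germ_rel F A)"
    by (auto simp: refl_on_def mem_germ_rel near_def)
  show "sym (germ_rel F A)"
  proof (rule symI, clarify)
    fix V s W t assume "((V, s), (W, t)) \<in> germ_rel F A"
    then obtain Z where "near A V s" "near A W t" "opn Z" "A \<subseteq> Z" "Z \<subseteq> W \<inter> V" "res W Z t = res V Z s"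
      unfolding mem_germ_rel by (metis inf_commute)
    then show "((W, t), (V, s)) \<in> germ_rel F A" unfolding mem_germ_rel by blast
  qed
  show "trans (germ_rel F A)"
  proof (rule transI, clarify)
    fix V s W t Y u
    assume "((V, s), (W, t)) \<in> germ_rel F A" "((W, t), (Y, u)) \<in> germ_rel F A"
    then obtain Z Z' where n: "near A V s" "near A W t" "near A Y u"
      and Z: "opn Z" "A \<subseteq> Z" "Z \<subseteq> V \<inter> W" "res V Z s = res W Z t"
      and Z': "opn Z'" "A \<subseteq> Z'" "Z' \<subseteq> W \<inter> Y" "res W Z' t = res Y Z' u"
      unfolding mem_germ_rel by metis
    let ?Y = "Z \<inter> Z'"
    have Y: "opn ?Y" using Z(1) Z'(1) by (rule openin_Int)
    have s: "Z \<subseteq> V" "Z \<subseteq> W" "Z' \<subseteq> W" "Z' \<subseteq> Y" "?Y \<subseteq> Z" "?Y \<subseteq> Z'" using Z Z' by auto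
    have "res V ?Y s = res Z ?Y (res V Z s)" "res Z ?Y (res W Z t) = res W ?Y t"
      "res W ?Y t = res Z' ?Y (res W Z' t)" "res Z' ?Y (res Y Z' u) = res Y ?Y u"
      using n Z(1) Z'(1) Y s by (auto simp: near_def)
    then have "res V ?Y s = res Y ?Y u" using Z(4) Z'(4) by simp
    then show "((V, s), (Y, u)) \<in> germ_rel F A"
      using n Z Z' Y unfolding mem_germ_rel by (intro conjI exI[of _ ?Y]) auto
  qed
qed

lemma germ_eq_iff:
  assumes "near A V s" "near A W t"
  shows "germ F A V s = germ F A W t \<longleftrightarrow>
    (\<exists>Z. opn Z \<and> A \<subseteq> Z \<and> Z \<subseteq> V \<inter> W \<and> res V Z s = res W Z t)"
  using eq_equiv_class_iff[OF equiv_germ_rel, of "(V, s)" A "(W, t)"] assms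
  by (simp add: germ_def mem_germ_rel)

lemma mem_germ: "(W, t) \<in> germ F A V s \<longleftrightarrow> near A V s \<and> near A W t \<and> germ F A W t = germ F A V s"
proof -
  have "(W, t) \<in> germ F A V s \<longleftrightarrow> ((V, s), (W, t)) \<in> germ_rel F A" by (simp add: germ_def)
  also have "\<dots> \<longleftrightarrow> near A V s \<and> near A W t \<and> germ F A V s = germ F A W t"
    using germ_eq_iff[of A V s W t] unfolding mem_germ_rel by blast
  finally show ?thesis by metis
qed

lemma germ_res:
  assumes "near A V s" "opn Z" "A \<subseteq> Z" "Z \<subseteq> V"
  shows "germ F A Z (res V Z s) = germ F A V s"
proof -
  have "Z \<subseteq> Z \<inter> V" "res Z Z (res V Z s) = res V Z s"
    using assms by (auto simp: near_def)
  then show ?thesis unfolding germ_eq_iff[OF near_res[OF assms] assms(1)]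
    using assms(2,3) by metis
qed

lemma UN_germ:
  assumes "near A V s" "\<And>W t. near A W t \<Longrightarrow> germ F A W t = germ F A V s \<Longrightarrow> g W t = g V s"
  shows "(\<Union>(W, t)\<in>germ F A V s. g W t) = g V s"
proof -
  have "(V, s) \<in> germ F A V s" using assms(1) by (simp add: mem_germ)
  moreover have "g W t = g V s" if "(W, t) \<in> germ F A V s" for W t
    using assms(2) that[unfolded mem_germ] by blast
  ultimately show ?thesis by fast
qed

lemma germ_closed: "near A V s \<Longrightarrow> germ F A V s \<in> carrier (germ_ring F A)"
  by (auto simp: germ_ring_def near_def)

lemma germE:
  assumes "c \<in> carrier (germ_ring F A)"
  obtains V s where "near A V s" "c = germ F A V s"
  using assms by (auto simp: germ_ring_def near_def)

lemma common2:
  assumes "near A V s" "near A W t"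
  shows "near A (V \<inter> W) (res V (V \<inter> W) s)" "near A (V \<inter> W) (res W (V \<inter> W) t)"
    "germ F A (V \<inter> W) (res V (V \<inter> W) s) = germ F A V s"
    "germ F A (V \<inter> W) (res W (V \<inter> W) t) = germ F A W t"
proof -
  have V: "opn (V \<inter> W)" "A \<subseteq> V \<inter> W" using assms by (auto simp: near_def)
  show "near A (V \<inter> W) (res V (V \<inter> W) s)" by (rule near_res[OF assms(1) V]) simp
  show "near A (V \<inter> W) (res W (V \<inter> W) t)" by (rule near_res[OF assms(2) V]) simp
  show "germ F A (V \<inter> W) (res V (V \<inter> W) s) = germ F A V s" by (rule germ_res[OF assms(1) V]) simp
  show "germ F A (V \<inter> W) (res W (V \<inter> W) t) = germ F A W t" by (rule germ_res[OF assms(2) V]) simp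
qed

lemma germE2:
  assumes "c \<in> carrier (germ_ring F A)" "d \<in> carrier (germ_ring F A)"
  obtains V s t where "near A V s" "near A V t" "c = germ F A V s" "d = germ F A V t"
proof -
  obtain V s where s: "near A V s" "c = germ F A V s" by (rule germE[OF assms(1)])
  obtain W t where t: "near A W t" "d = germ F A W t" by (rule germE[OF assms(2)])
  show thesis by (rule that[OF common2(1,2)[OF s(1) t(1)]]) (simp_all add: common2[OF s(1) t(1)] s(2) t(2))
qed

lemma germE3:
  assumes "c \<in> carrier (germ_ring F A)" "d \<in> carrier (germ_ring F A)" "e \<in> carrier (germ_ring F A)"
  obtains V s t u where "near A V s" "near A V t" "near A V u"
    "c = germ F A V s" "d = germ F A V t" "e = germ F A V u"
proof -
  obtain V s t where s: "near A V s" "near A V t" "c = germ F A V s" "d = germ F A V t"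
    by (rule germE2[OF assms(1,2)])
  obtain W u where u: "near A W u" "e = germ F A W u" by (rule germE[OF assms(3)])
  show thesis
    by (rule that[OF common2(1)[OF s(1) u(1)] common2(1)[OF s(2) u(1)] common2(2)[OF s(1) u(1)]])
      (simp_all add: common2[OF s(1) u(1)] common2[OF s(2) u(1)] s u(2))
qed

text \<open>
  Both ring operations on germs have this form, so their independence of representatives is shown
  once.
\<close>

lemma germ_binop:
  assumes op_closed: "\<And>U s t. opn U \<Longrightarrow> s \<in> carrier (\<O> U) \<Longrightarrow> t \<in> carrier (\<O> U) \<Longrightarrow> f U s t \<in> carrier (\<O> U)"
    and op_res: "\<And>U Z s t. opn U \<Longrightarrow> opn Z \<Longrightarrow> Z \<subseteq> U \<Longrightarrow> s \<in> carrier (\<O> U) \<Longrightarrow> t \<in> carrier (\<O> U) \<Longrightarrow>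
      res U Z (f U s t) = f Z (res U Z s) (res U Z t)"
    and n: "near A V s" "near A V t"
  shows "(\<Union>(Y, s)\<in>germ F A V s. \<Union>(W, t)\<in>germ F A V t.
            germ F A (Y \<inter> W) (f (Y \<inter> W) (res Y (Y \<inter> W) s) (res W (Y \<inter> W) t)))
         = germ F A V (f V s t)"
proof -
  let ?g = "\<lambda>V s W t. germ F A (V \<inter> W) (f (V \<inter> W) (res V (V \<inter> W) s) (res W (V \<inter> W) t))"
  have "?g V' s' W t' = germ F A V (f V s t)"
    if st: "(V', s') \<in> germ F A V s" "(W, t') \<in> germ F A V t" for V' s' W t'
  proof -
    have s': "near A V' s'" "germ F A V' s' = germ F A V s"
      and t: "near A W t'" "germ F A W t' = germ F A V t" using st unfolding mem_germ by blast+
    from s' n(1) obtain Z where Z: "opn Z" "A \<subseteq> Z" "Z \<subseteq> V' \<inter> V" "res V' Z s' = res V Z s"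
      by (auto simp: germ_eq_iff)
    from t n(2) obtain Y where Y: "opn Y" "A \<subseteq> Y" "Y \<subseteq> W \<inter> V" "res W Y t' = res V Y t"
      by (auto simp: germ_eq_iff)
    let ?U = "Z \<inter> Y" and ?M = "V' \<inter> W"
    have U: "opn ?U" using Z(1) Y(1) by (rule openin_Int)
    have M: "opn ?M" using s'(1) t(1) openin_Int by (auto simp: near_def)
    have sub: "?U \<subseteq> ?M" "?U \<subseteq> V" "?U \<subseteq> Z" "?U \<subseteq> Y" "?U \<subseteq> V'" "?U \<subseteq> W" "Z \<subseteq> V'" "Z \<subseteq> V" "Y \<subseteq> W" "Y \<subseteq> V"
      "?M \<subseteq> V'" "?M \<subseteq> W" using Z Y by auto
    have o: "opn V'" "opn W" "opn V" "s' \<in> carrier (\<O> V')" "t' \<in> carrier (\<O> W)"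
      "s \<in> carrier (\<O> V)" "t \<in> carrier (\<O> V)" using s' t n by (auto simp: near_def)
    have es: "res V' ?U s' = res V ?U s"
      using arg_cong[OF Z(4), of "res Z ?U"] o Z(1) U sub by simp
    have et: "res W ?U t' = res V ?U t"
      using arg_cong[OF Y(4), of "res Y ?U"] o Y(1) U sub by simp
    have nM: "near A ?M (f ?M (res V' ?M s') (res W ?M t'))"
      using o M sub s'(1) t(1) op_closed[OF M] by (auto simp: near_def)
    have nV: "near A V (f V s t)" using n op_closed by (auto simp: near_def)
    have "res ?M ?U (f ?M (res V' ?M s') (res W ?M t')) = f ?U (res V' ?U s') (res W ?U t')"
      using o M U sub by (simp add: op_res)
    also have "\<dots> = res V ?U (f V s t)" unfolding es et using o U sub by (simp add: op_res)
    finally show ?thesis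
      using germ_eq_iff[OF nM nV] U Z Y sub by (metis Int_greatest)
  qed
  moreover have "(V, s) \<in> germ F A V s" "(V, t) \<in> germ F A V t" using n by (simp_all add: mem_germ)
  ultimately show ?thesis by (intro UN_UN_eqI)
qed

lemma germ_mult:
  assumes "near A V s" "near A V t"
  shows "germ F A V s \<otimes>\<^bsub>germ_ring F A\<^esub> germ F A V t = germ F A V (s \<otimes>\<^bsub>\<O> V\<^esub> t)"
proof -
  have "germ F A V s \<otimes>\<^bsub>germ_ring F A\<^esub> germ F A V t
      = (\<Union>(Y, s)\<in>germ F A V s. \<Union>(W, t)\<in>germ F A V t.
          germ F A (Y \<inter> W) (res Y (Y \<inter> W) s \<otimes>\<^bsub>\<O> (Y \<inter> W)\<^esub> res W (Y \<inter> W) t))"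
    unfolding germ_ring_def by simp
  also have "\<dots> = germ F A V (s \<otimes>\<^bsub>\<O> V\<^esub> t)"
    using cring_sections
    by (intro germ_binop[of "\<lambda>U s t. s \<otimes>\<^bsub>\<O> U\<^esub> t", OF _ _ assms])
      (simp_all add: res_mult cring.cring_simprules)
  finally show ?thesis .
qed

lemma germ_add:
  assumes "near A V s" "near A V t"
  shows "germ F A V s \<oplus>\<^bsub>germ_ring F A\<^esub> germ F A V t = germ F A V (s \<oplus>\<^bsub>\<O> V\<^esub> t)"
proof -
  have "germ F A V s \<oplus>\<^bsub>germ_ring F A\<^esub> germ F A V t
      = (\<Union>(Y, s)\<in>germ F A V s. \<Union>(W, t)\<in>germ F A V t.
          germ F A (Y \<inter> W) (res Y (Y \<inter> W) s \<oplus>\<^bsub>\<O> (Y \<inter> W)\<^esub> res W (Y \<inter> W) t))"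
    unfolding germ_ring_def by simp
  also have "\<dots> = germ F A V (s \<oplus>\<^bsub>\<O> V\<^esub> t)"
    using cring_sections
    by (intro germ_binop[of "\<lambda>U s t. s \<oplus>\<^bsub>\<O> U\<^esub> t", OF _ _ assms])
      (simp_all add: res_add cring.cring_simprules)
  finally show ?thesis .
qed

lemma near_one: "opn V \<Longrightarrow> A \<subseteq> V \<Longrightarrow> near A V \<one>\<^bsub>\<O> V\<^esub>"
  and near_zero: "opn V \<Longrightarrow> A \<subseteq> V \<Longrightarrow> near A V \<zero>\<^bsub>\<O> V\<^esub>"
  and near_mult: "near A V s \<Longrightarrow> near A V t \<Longrightarrow> near A V (s \<otimes>\<^bsub>\<O> V\<^esub> t)"
  and near_add: "near A V s \<Longrightarrow> near A V t \<Longrightarrow> near A V (s \<oplus>\<^bsub>\<O> V\<^esub> t)"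
  and near_uminus: "near A V s \<Longrightarrow> near A V (\<ominus>\<^bsub>\<O> V\<^esub> s)"
  using cring_sections by (simp_all add: near_def cring.cring_simprules)

lemma germ_one:
  assumes "opn V" "A \<subseteq> V"
  shows "\<one>\<^bsub>germ_ring F A\<^esub> = germ F A V \<one>\<^bsub>\<O> V\<^esub>"
proof -
  have "V \<subseteq> topspace (base F)" using assms openin_subset by blast
  then show ?thesis
    using germ_res[OF near_one[OF openin_topspace], of A V] assms by (simp add: germ_ring_def)
qed

lemma germ_zero:
  assumes "opn V" "A \<subseteq> V"
  shows "\<zero>\<^bsub>germ_ring F A\<^esub> = germ F A V \<zero>\<^bsub>\<O> V\<^esub>"
proof -
  have "V \<subseteq> topspace (base F)" using assms openin_subset by blast
  then show ?thesis
    using germ_res[OF near_zero[OF openin_topspace], of A V] assms by (simp add: germ_ring_def)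
qed

lemma cring_germ_ring:
  assumes A: "A \<subseteq> topspace (base F)"
  shows "cring (germ_ring F A)"
proof -
  let ?G = "germ_ring F A"
  note gs = germ_mult germ_add near_mult near_add germ_closed
  have one: "\<one>\<^bsub>?G\<^esub> \<in> carrier ?G" "\<zero>\<^bsub>?G\<^esub> \<in> carrier ?G"
    using germ_one[OF openin_topspace A] germ_zero[OF openin_topspace A]
      germ_closed near_one near_zero A by auto
  have c2: "x \<oplus>\<^bsub>?G\<^esub> y \<in> carrier ?G" "x \<otimes>\<^bsub>?G\<^esub> y \<in> carrier ?G" "x \<oplus>\<^bsub>?G\<^esub> y = y \<oplus>\<^bsub>?G\<^esub> x"
    "x \<otimes>\<^bsub>?G\<^esub> y = y \<otimes>\<^bsub>?G\<^esub> x" if xy: "x \<in> carrier ?G" "y \<in> carrier ?G" for x y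
  proof -
    obtain V s t where V: "near A V s" "near A V t" and eq: "x = germ F A V s" "y = germ F A V t"
      by (rule germE2[OF xy])
    interpret cring "\<O> V" by (rule cring_sections[OF nearD(1)[OF V(1)]])
    show "x \<oplus>\<^bsub>?G\<^esub> y \<in> carrier ?G" "x \<otimes>\<^bsub>?G\<^esub> y \<in> carrier ?G" "x \<oplus>\<^bsub>?G\<^esub> y = y \<oplus>\<^bsub>?G\<^esub> x"
      "x \<otimes>\<^bsub>?G\<^esub> y = y \<otimes>\<^bsub>?G\<^esub> x"
      unfolding eq using V by (simp_all add: gs m_comm a_comm nearD)
  qed
  have c3: "x \<oplus>\<^bsub>?G\<^esub> y \<oplus>\<^bsub>?G\<^esub> z = x \<oplus>\<^bsub>?G\<^esub> (y \<oplus>\<^bsub>?G\<^esub> z)" "x \<otimes>\<^bsub>?G\<^esub> y \<otimes>\<^bsub>?G\<^esub> z = x \<otimes>\<^bsub>?G\<^esub> (y \<otimes>\<^bsub>?G\<^esub> z)"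
    "(x \<oplus>\<^bsub>?G\<^esub> y) \<otimes>\<^bsub>?G\<^esub> z = x \<otimes>\<^bsub>?G\<^esub> z \<oplus>\<^bsub>?G\<^esub> y \<otimes>\<^bsub>?G\<^esub> z"
    if xyz: "x \<in> carrier ?G" "y \<in> carrier ?G" "z \<in> carrier ?G" for x y z
  proof -
    obtain V s t u where V: "near A V s" "near A V t" "near A V u"
      and eq: "x = germ F A V s" "y = germ F A V t" "z = germ F A V u"
      by (rule germE3[OF xyz])
    interpret cring "\<O> V" by (rule cring_sections[OF nearD(1)[OF V(1)]])
    show "x \<oplus>\<^bsub>?G\<^esub> y \<oplus>\<^bsub>?G\<^esub> z = x \<oplus>\<^bsub>?G\<^esub> (y \<oplus>\<^bsub>?G\<^esub> z)" "x \<otimes>\<^bsub>?G\<^esub> y \<otimes>\<^bsub>?G\<^esub> z = x \<otimes>\<^bsub>?G\<^esub> (y \<otimes>\<^bsub>?G\<^esub> z)"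
      "(x \<oplus>\<^bsub>?G\<^esub> y) \<otimes>\<^bsub>?G\<^esub> z = x \<otimes>\<^bsub>?G\<^esub> z \<oplus>\<^bsub>?G\<^esub> y \<otimes>\<^bsub>?G\<^esub> z"
      unfolding eq using V by (simp_all add: gs m_assoc a_assoc l_distr nearD)
  qed
  have c1: "\<one>\<^bsub>?G\<^esub> \<otimes>\<^bsub>?G\<^esub> x = x" "\<zero>\<^bsub>?G\<^esub> \<oplus>\<^bsub>?G\<^esub> x = x" "\<exists>y\<in>carrier ?G. y \<oplus>\<^bsub>?G\<^esub> x = \<zero>\<^bsub>?G\<^esub>"
    if x: "x \<in> carrier ?G" for x
  proof -
    obtain V s where V: "near A V s" and eq: "x = germ F A V s" by (rule germE[OF x])
    interpret cring "\<O> V" by (rule cring_sections[OF nearD(1)[OF V]])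
    note V' = nearD[OF V]
    show "\<one>\<^bsub>?G\<^esub> \<otimes>\<^bsub>?G\<^esub> x = x" "\<zero>\<^bsub>?G\<^esub> \<oplus>\<^bsub>?G\<^esub> x = x"
      unfolding eq germ_one[OF V'(1,2)] germ_zero[OF V'(1,2)]
      using V V' by (simp_all add: germ_mult germ_add near_one near_zero)
    show "\<exists>y\<in>carrier ?G. y \<oplus>\<^bsub>?G\<^esub> x = \<zero>\<^bsub>?G\<^esub>"
      unfolding eq germ_zero[OF V'(1,2)]
      using V V' germ_closed[OF near_uminus[OF V]]
      by (intro bexI[of _ "germ F A V (\<ominus>\<^bsub>\<O> V\<^esub> s)"]) (simp_all add: germ_add near_uminus l_neg)
  qed
  show ?thesis
    by (intro cringI abelian_groupI comm_monoidI) (use one c1 c2 c3 in \<open>auto simp: c2\<close>)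
qed

end

context ring_presheaf
begin

lemma germ_der_germ:
  assumes closed: "\<And>U s. opn U \<Longrightarrow> s \<in> carrier (\<O> U) \<Longrightarrow> D U s \<in> carrier (\<O> U)"
    and compat: "\<And>U V s. opn U \<Longrightarrow> opn V \<Longrightarrow> V \<subseteq> U \<Longrightarrow> s \<in> carrier (\<O> U) \<Longrightarrow>
      res U V (D U s) = D V (res U V s)"
    and s: "near A V s"
  shows "germ_der F D A (germ F A V s) = germ F A V (D V s)"
proof -
  have "germ F A W (D W t) = germ F A V (D V s)"
    if t: "near A W t" "germ F A W t = germ F A V s" for W t
  proof -
    obtain Z where Z: "opn Z" "A \<subseteq> Z" "Z \<subseteq> W \<inter> V" "res W Z t = res V Z s"
      using t(2) unfolding germ_eq_iff[OF t(1) s] by blast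
    have "res W Z (D W t) = res V Z (D V s)"
      using Z t(1) s compat[of W Z t] compat[of V Z s] by (simp add: near_def)
    moreover have "near A W (D W t)" "near A V (D V s)" using t(1) s closed by (auto simp: near_def)
    ultimately show ?thesis using Z(1-3) germ_eq_iff by blast
  qed
  then show ?thesis unfolding germ_der_def by (intro UN_germ[OF s])
qed

end

section \<open>Leaves\<close>

context reduced_scheme
begin

lemma ideal_nonunits: "opn N \<Longrightarrow> y \<in> N \<Longrightarrow> ideal (nonunits N y) (\<O> N)"
  using primeideal_nonunits primeideal.axioms(1) by blast

lemma nonunits_closed: "s \<in> nonunits N y \<Longrightarrow> s \<in> carrier (\<O> N)"
  by (simp add: nonunits_def)

definition nonunit_germs :: "'a \<Rightarrow> ('a set \<times> 'b) set set" where
  "nonunit_germs x = {germ F {x} V s | V s. opn V \<and> x \<in> V \<and> s \<in> nonunits V x}"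

lemma germ_mem_nonunit_germs:
  assumes "near {x} V s"
  shows "germ F {x} V s \<in> nonunit_germs x \<longleftrightarrow> s \<in> nonunits V x"
proof
  assume "s \<in> nonunits V x"
  then show "germ F {x} V s \<in> nonunit_germs x"
    using assms unfolding nonunit_germs_def near_def by blast
next
  assume "germ F {x} V s \<in> nonunit_germs x"
  then obtain W t where eq: "germ F {x} V s = germ F {x} W t" and W: "opn W" "x \<in> W" "t \<in> nonunits W x"
    unfolding nonunit_germs_def by blast
  have t: "near {x} W t" using W nonunits_closed by (simp add: near_def)
  obtain Z where Z: "opn Z" "x \<in> Z" "Z \<subseteq> V \<inter> W" "res V Z s = res W Z t"
    using eq unfolding germ_eq_iff[OF assms t] by blast
  have "res W Z t \<in> nonunits Z x" using W(3) nonunits_res[of W Z x t] W Z nonunits_closed by simp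
  then show "s \<in> nonunits V x" using nonunits_res[of V Z x s] assms Z by (simp add: near_def)
qed

text \<open>
  In a ring whose nonunits form an ideal, that ideal contains every proper ideal.
\<close>

lemma maximalideal_nonunit_germs:
  assumes x: "x \<in> topspace (base F)"
  shows "maximalideal (nonunit_germs x) (stalk F x)"
proof -
  let ?S = "stalk F x"
  interpret S: cring ?S using cring_germ_ring x by simp
  have sub: "c \<in> carrier ?S" if "c \<in> nonunit_germs x" for c
    using that nonunits_closed germ_closed unfolding nonunit_germs_def near_def by blast
  have add: "c \<oplus>\<^bsub>?S\<^esub> d \<in> nonunit_germs x" if cd: "c \<in> nonunit_germs x" "d \<in> nonunit_germs x" for c d
  proof -
    obtain V s t where V: "near {x} V s" "near {x} V t" and eq: "c = germ F {x} V s" "d = germ F {x} V t"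
      by (rule germE2[OF sub[OF cd(1)] sub[OF cd(2)]])
    interpret v: ideal "nonunits V x" "\<O> V" using ideal_nonunits V by (simp add: near_def)
    show ?thesis using cd v.a_closed V unfolding eq
      by (simp add: germ_add germ_mem_nonunit_germs near_add)
  qed
  have mult: "d \<otimes>\<^bsub>?S\<^esub> c \<in> nonunit_germs x" if cd: "c \<in> nonunit_germs x" "d \<in> carrier ?S" for c d
  proof -
    obtain V s t where V: "near {x} V s" "near {x} V t" and eq: "c = germ F {x} V s" "d = germ F {x} V t"
      by (rule germE2[OF sub[OF cd(1)] cd(2)])
    interpret v: ideal "nonunits V x" "\<O> V" using ideal_nonunits V by (simp add: near_def)
    show ?thesis using cd v.I_l_closed V unfolding eq
      by (simp add: germ_mult germ_mem_nonunit_germs near_mult nearD)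
  qed
  have uminus: "\<ominus>\<^bsub>?S\<^esub> c \<in> nonunit_germs x" if "c \<in> nonunit_germs x" for c
  proof -
    have "\<ominus>\<^bsub>?S\<^esub> c = (\<ominus>\<^bsub>?S\<^esub> \<one>\<^bsub>?S\<^esub>) \<otimes>\<^bsub>?S\<^esub> c" using sub[OF that] by (simp add: S.l_minus)
    then show ?thesis using mult[OF that] by simp
  qed
  have top: "opn (topspace (base F))" "{x} \<subseteq> topspace (base F)" using x by auto
  have zero: "\<zero>\<^bsub>?S\<^esub> \<in> nonunit_germs x"
  proof -
    have "\<zero>\<^bsub>\<O> (topspace (base F))\<^esub> \<in> nonunits (topspace (base F)) x"
      using ideal_nonunits top by (intro additive_subgroup.zero_closed ideal.axioms(1)) auto
    then show ?thesis unfolding germ_zero[OF top] germ_mem_nonunit_germs[OF near_zero[OF top]] .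
  qed
  have one: "\<one>\<^bsub>?S\<^esub> \<notin> nonunit_germs x"
    unfolding germ_one[OF top] germ_mem_nonunit_germs[OF near_one[OF top]]
    using unit_locus_one[OF top(1)] x by (simp add: nonunits_def)
  have idl: "ideal (nonunit_germs x) ?S"
  proof (rule idealI[OF S.ring_axioms])
    show "subgroup (nonunit_germs x) (add_monoid ?S)"
      using zero add uminus sub by (intro S.add.subgroupI) (auto simp: a_inv_def)
    show "a \<otimes>\<^bsub>?S\<^esub> c \<in> nonunit_germs x" "c \<otimes>\<^bsub>?S\<^esub> a \<in> nonunit_germs x"
      if "c \<in> nonunit_germs x" "a \<in> carrier ?S" for a c
      using mult[OF that] S.m_comm[OF sub[OF that(1)] that(2)] by simp_all
  qed
  show ?thesis
  proof (rule maximalidealI[OF idl])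
    show "carrier ?S \<noteq> nonunit_germs x" using one S.one_closed by metis
    fix J assume J: "ideal J ?S" "nonunit_germs x \<subseteq> J" "J \<subseteq> carrier ?S"
    interpret J: ideal J ?S by (rule J(1))
    show "J = nonunit_germs x \<or> J = carrier ?S"
    proof (rule disjCI)
      assume "J \<noteq> carrier ?S"
      then have no1: "\<one>\<^bsub>?S\<^esub> \<notin> J" using J.one_imp_carrier by blast
      have "c \<in> nonunit_germs x" if c: "c \<in> J" for c
      proof -
        obtain V s where V: "near {x} V s" and eq: "c = germ F {x} V s"
          using germE[OF J.Icarr[OF c]] by metis
        show ?thesis
        proof (rule ccontr)
          assume "c \<notin> nonunit_germs x"
          then have "x \<in> unit_locus V s" unfolding eq germ_mem_nonunit_germs[OF V] using V by (simp add: nonunits_def near_def)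
          then obtain Z t where Z: "opn Z" "x \<in> Z" "Z \<subseteq> V" "t \<in> carrier (\<O> Z)"
            "res V Z s \<otimes>\<^bsub>\<O> Z\<^esub> t = \<one>\<^bsub>\<O> Z\<^esub>" by (rule unit_locusE)
          have n: "{x} \<subseteq> Z" "near {x} Z (res V Z s)" "near {x} Z t" using Z V by (auto simp: near_def)
          have "c = germ F {x} Z (res V Z s)" unfolding eq by (rule germ_res[OF V Z(1) n(1) Z(3), symmetric])
          then have "c \<otimes>\<^bsub>?S\<^esub> germ F {x} Z t = \<one>\<^bsub>?S\<^esub>"
            using n Z by (simp add: germ_mult germ_one[OF Z(1) n(1)])
          then show False using no1 J.I_r_closed[OF c germ_closed[OF n(3)]] by simp
        qed
      qed
      then show "J = nonunit_germs x" using J(2) by blast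
    qed
  qed
qed

lemma max_ideal_stalk:
  assumes "x \<in> topspace (base F)" "local_ring (stalk F x)"
  shows "max_ideal (stalk F x) = nonunit_germs x"
  unfolding max_ideal_def
  using assms(2)[unfolded local_ring_def, THEN conjunct2] maximalideal_nonunit_germs[OF assms(1)]
  by (rule the1_equality)

end

text \<open>
  Positive integers are invertible as global sections; this is what a morphism to the spectrum of the
  rationals provides.
\<close>

locale vector_field_scheme = reduced_scheme F for F :: "('a, 'b) presheaf" +
  fixes D
  assumes vf: "vector_field F D"
    and rational: "0 < c \<Longrightarrow> \<exists>u\<in>carrier (sections F (topspace (base F))).
      add_pow (sections F (topspace (base F))) (c::nat) \<one>\<^bsub>sections F (topspace (base F))\<^esub>
        \<otimes>\<^bsub>sections F (topspace (base F))\<^esub> u = \<one>\<^bsub>sections F (topspace (base F))\<^esub>"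
    and local_stalks: "x \<in> topspace (base F) \<Longrightarrow> local_ring (stalk F x)"
begin

lemma diff_ring_sections: "opn U \<Longrightarrow> diff_ring (\<O> U) (D U)"
  using vf cring_sections
  by (simp add: vector_field_def diff_ring.intro diff_ring_axioms.intro)

lemma D_closed: "opn U \<Longrightarrow> s \<in> carrier (\<O> U) \<Longrightarrow> D U s \<in> carrier (\<O> U)"
  by (rule diff_ring.d_closed[OF diff_ring_sections])

lemma D_res: "opn U \<Longrightarrow> opn V \<Longrightarrow> V \<subseteq> U \<Longrightarrow> s \<in> carrier (\<O> U) \<Longrightarrow>
    res U V (D U s) = D V (res U V s)"
  using vf by (simp add: vector_field_def)

lemma D_mult: "opn U \<Longrightarrow> s \<in> carrier (\<O> U) \<Longrightarrow> t \<in> carrier (\<O> U) \<Longrightarrow>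
    D U (s \<otimes>\<^bsub>\<O> U\<^esub> t) = s \<otimes>\<^bsub>\<O> U\<^esub> D U t \<oplus>\<^bsub>\<O> U\<^esub> D U s \<otimes>\<^bsub>\<O> U\<^esub> t"
  by (rule diff_ring.d_mult[OF diff_ring_sections])

lemma D_zero: "opn U \<Longrightarrow> D U \<zero>\<^bsub>\<O> U\<^esub> = \<zero>\<^bsub>\<O> U\<^esub>"
  by (rule diff_ring.d_zero[OF diff_ring_sections])

lemma germ_der: "near A V s \<Longrightarrow> germ_der F D A (germ F A V s) = germ F A V (D V s)"
  by (rule germ_der_germ[OF D_closed D_res])

text \<open>
  The value of the tangent vector on the coset of \<open>f\<close> in the cotangent space is the residue class of
  the derivative of \<open>f\<close>, so the tangent vector is zero iff the derivation maps the maximal ideal to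
  itself.  A coset contains \<open>f\<close> and is contained in the maximal ideal, which takes care of the union
  over its elements.
\<close>

lemma leaves_iff_nonunit_germs:
  assumes x: "x \<in> topspace (base F)"
  shows "x \<in> leaves F D \<longleftrightarrow> (\<forall>f\<in>nonunit_germs x. germ_der F D {x} f \<in> nonunit_germs x)"
proof -
  let ?S = "stalk F x" and ?M = "nonunit_germs x"
  interpret S: cring ?S using cring_germ_ring x by simp
  interpret M: maximalideal ?M ?S by (rule maximalideal_nonunit_germs[OF x])
  let ?MM = "ideal_prod ?S ?M ?M"
  interpret MM: ideal ?MM ?S by (rule S.ideal_prod_is_ideal[OF M.is_ideal M.is_ideal])
  have MMM: "?MM \<subseteq> ?M" using S.ideal_prod_inter[OF M.is_ideal M.is_ideal] by blast
  have der: "germ_der F D {x} f \<in> carrier ?S" if f: "f \<in> carrier ?S" for f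
  proof -
    obtain V s where V: "near {x} V s" and eq: "f = germ F {x} V s" by (rule germE[OF f])
    have "near {x} V (D V s)" using V D_closed by (simp add: near_def)
    then show ?thesis unfolding eq germ_der[OF V] by (rule germ_closed)
  qed
  have coset: "?M +>\<^bsub>?S\<^esub> a = ?M \<longleftrightarrow> a \<in> ?M" if "a \<in> carrier ?S" for a
    using that M.rcos_const_imp_mem S.a_rcos_zero[OF M.is_ideal] by blast
  have self: "f \<in> ?MM +>\<^bsub>?S\<^esub> f" if "f \<in> ?M" for f
    by (rule MM.a_rcos_self[OF M.Icarr[OF that]])
  have in_M: "g \<in> ?M" if "f \<in> ?M" "g \<in> ?MM +>\<^bsub>?S\<^esub> f" for f g
    using that MMM M.a_closed unfolding a_r_coset_def' by blast
  have cot: "cotangent_space F x = {?MM +>\<^bsub>?S\<^esub> f | f. f \<in> ?M}"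
    unfolding cotangent_space_def Let_def max_ideal_stalk[OF x local_stalks[OF x]] ..
  have tan: "tangent_vector F D x c = (\<Union>f\<in>c. ?M +>\<^bsub>?S\<^esub> germ_der F D {x} f)"
    if "c \<in> cotangent_space F x" for c
    unfolding tangent_vector_def max_ideal_stalk[OF x local_stalks[OF x]] using that by simp
  have zero: "\<zero>\<^bsub>residue_field F x\<^esub> = ?M"
    unfolding residue_field_def max_ideal_stalk[OF x local_stalks[OF x]] by (simp add: FactRing_def)
  have "x \<in> leaves F D \<longleftrightarrow> (\<forall>c\<in>cotangent_space F x. tangent_vector F D x c = ?M)"
    unfolding leaves_def zero[symmetric] using x by simp
  also have "\<dots> \<longleftrightarrow> (\<forall>f\<in>?M. tangent_vector F D x (?MM +>\<^bsub>?S\<^esub> f) = ?M)"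
    unfolding cot by blast
  also have "\<dots> \<longleftrightarrow> (\<forall>f\<in>?M. (\<Union>g\<in>?MM +>\<^bsub>?S\<^esub> f. ?M +>\<^bsub>?S\<^esub> germ_der F D {x} g) = ?M)"
  proof (intro ball_cong refl)
    fix f assume "f \<in> ?M"
    then have "?MM +>\<^bsub>?S\<^esub> f \<in> cotangent_space F x" unfolding cot by blast
    then show "(tangent_vector F D x (?MM +>\<^bsub>?S\<^esub> f) = ?M) \<longleftrightarrow>
        ((\<Union>g\<in>?MM +>\<^bsub>?S\<^esub> f. ?M +>\<^bsub>?S\<^esub> germ_der F D {x} g) = ?M)"
      by (simp only: tan)
  qed
  also have "\<dots> \<longleftrightarrow> (\<forall>f\<in>?M. germ_der F D {x} f \<in> ?M)"
  proof (intro iffI ballI)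
    fix f assume all: "\<forall>f\<in>?M. (\<Union>g\<in>?MM +>\<^bsub>?S\<^esub> f. ?M +>\<^bsub>?S\<^esub> germ_der F D {x} g) = ?M" and f: "f \<in> ?M"
    have c: "germ_der F D {x} f \<in> carrier ?S" by (rule der[OF M.Icarr[OF f]])
    have "?M +>\<^bsub>?S\<^esub> germ_der F D {x} f \<subseteq> ?M" using all f self[OF f] by blast
    then show "germ_der F D {x} f \<in> ?M" using M.a_rcos_self[OF c] by blast
  next
    fix f assume all: "\<forall>f\<in>?M. germ_der F D {x} f \<in> ?M" and f: "f \<in> ?M"
    have "?M +>\<^bsub>?S\<^esub> germ_der F D {x} g = ?M" if "g \<in> ?MM +>\<^bsub>?S\<^esub> f" for g
      using all in_M[OF f that] coset M.Icarr by metis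
    then show "(\<Union>g\<in>?MM +>\<^bsub>?S\<^esub> f. ?M +>\<^bsub>?S\<^esub> germ_der F D {x} g) = ?M"
      using self[OF f] by (metis (no_types, lifting) SUP_eq_const empty_iff)
  qed
  finally show ?thesis .
qed

lemma leaves_iff:
  "x \<in> leaves F D \<longleftrightarrow> x \<in> topspace (base F) \<and>
     (\<forall>V s. opn V \<and> x \<in> V \<and> s \<in> nonunits V x \<longrightarrow> D V s \<in> nonunits V x)"
proof (cases "x \<in> topspace (base F)")
  case True
  have *: "germ_der F D {x} (germ F {x} V s) \<in> nonunit_germs x \<longleftrightarrow> D V s \<in> nonunits V x"
    if "opn V" "x \<in> V" "s \<in> nonunits V x" for V s
  proof -
    have "near {x} V s" "near {x} V (D V s)" using that nonunits_closed D_closed by (auto simp: near_def)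
    then show ?thesis using germ_der germ_mem_nonunit_germs by simp
  qed
  show ?thesis
    unfolding leaves_iff_nonunit_germs[OF True] using True * unfolding nonunit_germs_def by fast
next
  case False
  then show ?thesis by (simp add: leaves_def)
qed

end

section \<open>Trajectories\<close>

context vector_field_scheme
begin

lemma rational_sections:
  assumes U: "opn U" and c: "0 < c"
  shows "\<exists>u\<in>carrier (\<O> U). add_pow (\<O> U) (c::nat) \<one>\<^bsub>\<O> U\<^esub> \<otimes>\<^bsub>\<O> U\<^esub> u = \<one>\<^bsub>\<O> U\<^esub>"
proof -
  let ?X = "topspace (base F)"
  have top: "opn ?X" "U \<subseteq> ?X" using U openin_subset by auto
  interpret r: ring_hom_cring "\<O> ?X" "\<O> U" "res ?X U" by (rule res_hom[OF top(1) U top(2)])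
  obtain u where u: "u \<in> carrier (\<O> ?X)" "add_pow (\<O> ?X) c \<one>\<^bsub>\<O> ?X\<^esub> \<otimes>\<^bsub>\<O> ?X\<^esub> u = \<one>\<^bsub>\<O> ?X\<^esub>"
    using rational[OF c] by blast
  have "res ?X U (add_pow (\<O> ?X) k \<one>\<^bsub>\<O> ?X\<^esub>) = add_pow (\<O> U) k \<one>\<^bsub>\<O> U\<^esub>" for k :: nat
    by (induction k) (simp_all add: r.R.add.nat_pow_Suc r.S.add.nat_pow_Suc)
  then have "add_pow (\<O> U) c \<one>\<^bsub>\<O> U\<^esub> \<otimes>\<^bsub>\<O> U\<^esub> res ?X U u = \<one>\<^bsub>\<O> U\<^esub>"
    using arg_cong[OF u(2), of "res ?X U"] u(1) by simp
  with u(1) show ?thesis by (intro bexI[of _ "res ?X U u"]) simp_all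
qed

context
  fixes V :: "'a set" and R :: "'b ring" and \<rho> pr
  assumes chart: "affine_chart V R \<rho> pr"
begin

text \<open>
  The prime ideal of the trajectory of \<open>x\<close>, in the sections over a chart.
\<close>

abbreviation core :: "'a \<Rightarrow> 'b set" where
  "core x \<equiv> diff_ring.diff_interior (\<O> V) (D V) (nonunits V x)"

lemma opn_V: "opn V"
  by (rule chart_opn[OF chart])

lemma mem_core: "s \<in> core x \<longleftrightarrow> s \<in> carrier (\<O> V) \<and> (\<forall>n. (D V ^^ n) s \<in> nonunits V x)"
  unfolding diff_ring.diff_interior_def[OF diff_ring_sections[OF opn_V]] by simp

lemma core_subset: "core x \<subseteq> nonunits V x"
  unfolding subset_iff mem_core by (metis funpow_0)

lemma core_D: "s \<in> core x \<Longrightarrow> D V s \<in> core x"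
  unfolding mem_core using D_closed[OF opn_V] by (metis comp_apply funpow_Suc_right)

text \<open>
  Clearing the denominator of the section \<open>\<one>\<close> over \<open>N\<close> yields a basic open set inside \<open>N\<close>.
\<close>

lemma chart_basis:
  assumes "opn N" "N \<subseteq> V" "y \<in> N"
  obtains f where "f \<in> carrier (\<O> V)" "y \<in> unit_locus V f" "unit_locus V f \<subseteq> N"
proof -
  interpret N: cring "\<O> N" using assms cring_sections by blast
  obtain g a where "g \<in> carrier R" "a \<in> carrier R" "y \<in> unit_locus V (\<rho> g)" "unit_locus V (\<rho> g) \<subseteq> N"
    "res V N (\<rho> g) \<otimes>\<^bsub>\<O> N\<^esub> \<one>\<^bsub>\<O> N\<^esub> = res V N (\<rho> a)"
    by (rule chart_clear_denominator[OF chart assms N.one_closed])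
  then show thesis using ring_hom_closed[OF chart_hom[OF chart]] by (intro that[of "\<rho> g"])
qed

lemma specializes_iff:
  assumes y: "y \<in> V"
  shows "specializes (base F) z y \<longleftrightarrow> z \<in> V \<and> nonunits V z \<subseteq> nonunits V y"
proof
  assume "specializes (base F) z y"
  then have *: "z \<in> T" if "opn T" "y \<in> T" for T
    using that by (auto simp: specializes_def in_closure_of)
  have "y \<notin> unit_locus V s" if "z \<notin> unit_locus V s" for s using *[OF opn_unit_locus, of V s] that by blast
  then show "z \<in> V \<and> nonunits V z \<subseteq> nonunits V y" using *[OF opn_V y] by (auto simp: nonunits_def)
next
  assume z: "z \<in> V \<and> nonunits V z \<subseteq> nonunits V y"
  have "z \<in> T" if T: "opn T" "y \<in> T" for T
  proof -
    have N: "opn (T \<inter> V)" "T \<inter> V \<subseteq> V" "y \<in> T \<inter> V" using T y opn_V by auto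
    obtain f where f: "f \<in> carrier (\<O> V)" "y \<in> unit_locus V f" "unit_locus V f \<subseteq> T \<inter> V"
      by (rule chart_basis[OF N])
    then have "f \<notin> nonunits V z" using z mem_nonunits[OF f(1)] by blast
    then show ?thesis using f mem_nonunits[OF f(1)] by blast
  qed
  moreover have "y \<in> topspace (base F)" using y opn_V openin_subset by blast
  ultimately show "specializes (base F) z y" by (auto simp: specializes_def in_closure_of)
qed

text \<open>
  On a chart, being a leaf can be tested on sections over the chart.  A section \<open>s\<close> over a smaller
  open set satisfies \<open>g s = a\<close> with \<open>g\<close> not vanishing at \<open>\<eta>\<close>.  If \<open>s\<close> vanishes at \<open>\<eta>\<close>, so do \<open>a\<close>
  and its derivative \<open>g D s + D g s\<close>, hence also \<open>D s\<close>.
\<close>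

lemma chart_leaves_iff:
  assumes \<eta>: "\<eta> \<in> V"
  shows "\<eta> \<in> leaves F D \<longleftrightarrow> (\<forall>s\<in>nonunits V \<eta>. D V s \<in> nonunits V \<eta>)"
proof
  assume "\<eta> \<in> leaves F D"
  then show "\<forall>s\<in>nonunits V \<eta>. D V s \<in> nonunits V \<eta>" using \<eta> opn_V unfolding leaves_iff by blast
next
  assume L: "\<forall>s\<in>nonunits V \<eta>. D V s \<in> nonunits V \<eta>"
  have "D N s \<in> nonunits N \<eta>" if N: "opn N" "\<eta> \<in> N" and s: "s \<in> nonunits N \<eta>" for N s
  proof -
    let ?M = "N \<inter> V"
    have M: "opn ?M" "?M \<subseteq> V" "\<eta> \<in> ?M" "?M \<subseteq> N" using N \<eta> opn_V by auto
    interpret M: cring "\<O> ?M" by (rule cring_sections[OF M(1)])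
    interpret v: primeideal "nonunits ?M \<eta>" "\<O> ?M" by (rule primeideal_nonunits[OF M(1,3)])
    have sN: "s \<in> carrier (\<O> N)" using s nonunits_closed by blast
    let ?s = "res N ?M s"
    have sM: "?s \<in> carrier (\<O> ?M)" using N(1) M sN by simp
    obtain g a where g: "g \<in> carrier R" "a \<in> carrier R" "\<eta> \<in> unit_locus V (\<rho> g)" "unit_locus V (\<rho> g) \<subseteq> ?M"
      and eq: "res V ?M (\<rho> g) \<otimes>\<^bsub>\<O> ?M\<^esub> ?s = res V ?M (\<rho> a)"
      by (rule chart_clear_denominator[OF chart M(1-3) sM])
    have gc: "\<rho> g \<in> carrier (\<O> V)" "\<rho> a \<in> carrier (\<O> V)"
      using g ring_hom_closed[OF chart_hom[OF chart]] by auto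
    let ?g = "res V ?M (\<rho> g)" and ?a = "res V ?M (\<rho> a)"
    have c: "?g \<in> carrier (\<O> ?M)" "?a \<in> carrier (\<O> ?M)" "D ?M ?s \<in> carrier (\<O> ?M)"
      "D ?M ?g \<in> carrier (\<O> ?M)"
      using gc opn_V M sM D_closed by simp_all
    have sv: "?s \<in> nonunits ?M \<eta>" using nonunits_res[OF N(1) M(1,4,3) sN] s by simp
    then have "?a \<in> nonunits ?M \<eta>" unfolding eq[symmetric] using c(1) by (rule v.I_l_closed)
    then have "\<rho> a \<in> nonunits V \<eta>" using nonunits_res[OF opn_V M(1-3) gc(2)] by simp
    then have "D V (\<rho> a) \<in> nonunits V \<eta>" using L by blast
    then have "D ?M ?a \<in> nonunits ?M \<eta>"
      using nonunits_res[OF opn_V M(1-3) D_closed[OF opn_V gc(2)]] D_res[OF opn_V M(1,2) gc(2)] by simp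
    moreover have "D ?M ?a = ?g \<otimes>\<^bsub>\<O> ?M\<^esub> D ?M ?s \<oplus>\<^bsub>\<O> ?M\<^esub> D ?M ?g \<otimes>\<^bsub>\<O> ?M\<^esub> ?s"
      unfolding eq[symmetric] by (rule D_mult[OF M(1) c(1) sM])
    moreover have "\<ominus>\<^bsub>\<O> ?M\<^esub> (D ?M ?g \<otimes>\<^bsub>\<O> ?M\<^esub> ?s) \<in> nonunits ?M \<eta>"
      by (intro v.a_inv_closed v.I_l_closed[OF sv] c(4))
    ultimately have "(?g \<otimes>\<^bsub>\<O> ?M\<^esub> D ?M ?s \<oplus>\<^bsub>\<O> ?M\<^esub> D ?M ?g \<otimes>\<^bsub>\<O> ?M\<^esub> ?s)
        \<oplus>\<^bsub>\<O> ?M\<^esub> \<ominus>\<^bsub>\<O> ?M\<^esub> (D ?M ?g \<otimes>\<^bsub>\<O> ?M\<^esub> ?s) \<in> nonunits ?M \<eta>" by (metis v.a_closed)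
    moreover have "(?g \<otimes>\<^bsub>\<O> ?M\<^esub> D ?M ?s \<oplus>\<^bsub>\<O> ?M\<^esub> D ?M ?g \<otimes>\<^bsub>\<O> ?M\<^esub> ?s)
        \<oplus>\<^bsub>\<O> ?M\<^esub> \<ominus>\<^bsub>\<O> ?M\<^esub> (D ?M ?g \<otimes>\<^bsub>\<O> ?M\<^esub> ?s) = ?g \<otimes>\<^bsub>\<O> ?M\<^esub> D ?M ?s"
      using c sM by algebra
    ultimately have "?g \<otimes>\<^bsub>\<O> ?M\<^esub> D ?M ?s \<in> nonunits ?M \<eta>" by simp
    moreover have "?g \<notin> nonunits ?M \<eta>" unfolding nonunits_res[OF opn_V M(1-3) gc(1)] mem_nonunits[OF gc(1)] using g(3) by blast
    ultimately have "D ?M ?s \<in> nonunits ?M \<eta>" using v.mult_mem_iff[OF c(1,3)] by simp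
    then show ?thesis
      using nonunits_res[OF N(1) M(1,4,3) D_closed[OF N(1) sN]] D_res[OF N(1) M(1,4) sN] by simp
  qed
  moreover have "\<eta> \<in> topspace (base F)" using \<eta> opn_V openin_subset by blast
  ultimately show "\<eta> \<in> leaves F D" unfolding leaves_iff by blast
qed

text \<open>
  The core of \<open>x\<close> is prime, so it is the ideal of a point \<open>\<eta>\<close> that specializes to \<open>x\<close>, and
  \<open>\<eta>\<close> is a leaf because the core is closed under the derivation.  The ideal of any other leaf
  specializing to \<open>x\<close> is closed under the derivation and lies in the ideal of \<open>x\<close>, so it lies in the
  core.  Two least leaves specialize to each other and have the same ideal.
\<close>

lemma traj_in_chart:
  assumes x: "x \<in> V"
  shows "traj F D x \<in> V" "nonunits V (traj F D x) = core x" "traj F D x \<in> leaves F D"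
    "specializes (base F) (traj F D x) x"
proof -
  have prime: "primeideal (core x) (\<O> V)"
    by (rule diff_ring.primeideal_diff_interior[OF diff_ring_sections[OF opn_V] primeideal_nonunits[OF opn_V x]
        rational_sections[OF opn_V]])
  obtain \<eta> where \<eta>: "\<eta> \<in> V" "nonunits V \<eta> = core x"
    by (rule chart_point[OF chart prime x core_subset])
  have leaf: "\<eta> \<in> leaves F D"
    unfolding chart_leaves_iff[OF \<eta>(1)] \<eta>(2) by (intro ballI core_D)
  have spec: "specializes (base F) \<eta> x" unfolding specializes_iff[OF x] \<eta>(2) using \<eta>(1) core_subset by blast
  have least: "specializes (base F) \<eta>' \<eta>" if \<eta>': "\<eta>' \<in> leaves F D" "specializes (base F) \<eta>' x" for \<eta>'
  proof -
    have V: "\<eta>' \<in> V" and sub: "nonunits V \<eta>' \<subseteq> nonunits V x" using \<eta>'(2) unfolding specializes_iff[OF x] by auto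
    have "s \<in> core x" if s: "s \<in> nonunits V \<eta>'" for s
    proof -
      have "(D V ^^ n) s \<in> nonunits V \<eta>'" for n
        using s \<eta>'(1) unfolding chart_leaves_iff[OF V] by (induction n) auto
      then show ?thesis unfolding mem_core using sub s nonunits_closed by blast
    qed
    then show ?thesis unfolding specializes_iff[OF \<eta>(1)] \<eta>(2) using V by blast
  qed
  have "traj F D x = \<eta>"
    unfolding traj_def
  proof (rule the_equality)
    show "\<eta> \<in> leaves F D \<and> specializes (base F) \<eta> x \<and>
      (\<forall>\<eta>'\<in>leaves F D. specializes (base F) \<eta>' x \<longrightarrow> specializes (base F) \<eta>' \<eta>)"
      using leaf spec least by blast
    fix \<zeta> assume \<zeta>: "\<zeta> \<in> leaves F D \<and> specializes (base F) \<zeta> x \<and>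
      (\<forall>\<eta>'\<in>leaves F D. specializes (base F) \<eta>' x \<longrightarrow> specializes (base F) \<eta>' \<zeta>)"
    then have V: "\<zeta> \<in> V" unfolding specializes_iff[OF x] by blast
    have "specializes (base F) \<eta> \<zeta>" "specializes (base F) \<zeta> \<eta>" using \<zeta> leaf spec least by blast+
    then have "nonunits V \<zeta> = nonunits V \<eta>" unfolding specializes_iff[OF V] specializes_iff[OF \<eta>(1)] by blast
    then show "\<zeta> = \<eta>" by (rule chart_nonunits_inj[OF chart V \<eta>(1)])
  qed
  with \<eta> leaf spec show "traj F D x \<in> V" "nonunits V (traj F D x) = core x" "traj F D x \<in> leaves F D"
    "specializes (base F) (traj F D x) x" by simp_all
qed

lemma traj_of_leaf_in_chart:
  assumes "x \<in> V" "x \<in> leaves F D"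
  shows "traj F D x = x"
proof -
  have "(D V ^^ n) s \<in> nonunits V x" if "s \<in> nonunits V x" for s n
    using that assms(2) unfolding chart_leaves_iff[OF assms(1)] by (induction n) auto
  then have "nonunits V x \<subseteq> core x" using nonunits_closed by (intro subsetI) (simp add: mem_core)
  then have "core x = nonunits V x" using core_subset by (intro equalityI)
  then show ?thesis
    using chart_nonunits_inj[OF chart traj_in_chart(1)[OF assms(1)] assms(1)] traj_in_chart(2)[OF assms(1)] by simp
qed

text \<open>
  The engine of the proof: it is applied to the derivatives of one section, to the annihilator of a
  section and to the denominators of a section.  A section not vanishing at the trajectory of \<open>x\<close> has an iterated derivative not vanishing at \<open>x\<close>, and a set
  closed under the derivation contains that derivative.
\<close>

lemma escape_core:
  assumes x: "x \<in> V" and I: "I \<subseteq> carrier (\<O> V)" "\<And>b. b \<in> I \<Longrightarrow> D V b \<in> I"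
    and f: "f \<in> I" "traj F D x \<in> unit_locus V f"
  obtains b where "b \<in> I" "x \<in> unit_locus V b"
proof -
  have "f \<notin> core x" using f(2) traj_in_chart(2)[OF x] unfolding nonunits_def by blast
  then obtain n where n: "(D V ^^ n) f \<notin> nonunits V x" unfolding mem_core using I(1) f(1) by blast
  have nI: "(D V ^^ n) f \<in> I" by (induction n) (use f I in auto)
  then have "x \<in> unit_locus V ((D V ^^ n) f)" using n I(1) unfolding nonunits_def by blast
  with nI show thesis by (rule that)
qed

end

lemma point_chart_vf:
  assumes "x \<in> topspace (base F)"
  obtains V R \<rho> pr where "x \<in> V" "affine_chart V (R :: 'b ring) \<rho> pr"
  using point_chart[OF openin_topspace assms] by metis

lemma traj_mem:
  assumes N: "opn N" and x: "x \<in> N"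
  shows "traj F D x \<in> N"
proof -
  have "x \<in> topspace (base F)" using assms openin_subset by blast
  then obtain V R \<rho> pr where "x \<in> V" "affine_chart V (R :: 'b ring) \<rho> pr" by (rule point_chart_vf)
  then have "specializes (base F) (traj F D x) x" using traj_in_chart(4) by blast
  then show ?thesis using assms by (auto simp: specializes_def in_closure_of)
qed

lemma traj_leaf: "x \<in> topspace (base F) \<Longrightarrow> traj F D x \<in> leaves F D"
  using point_chart_vf traj_in_chart(3) by metis

lemma traj_of_leaf: "x \<in> leaves F D \<Longrightarrow> traj F D x = x"
  using point_chart_vf traj_of_leaf_in_chart leaves_iff by metis

text \<open>
  Continuity of the trajectory map.  If \<open>f\<close> does not vanish at the trajectory of \<open>x\<close>, then some
  derivative \<open>b\<close> of \<open>f\<close> does not vanish at \<open>x\<close>, and at every point where \<open>b\<close> does not vanish, \<open>f\<close>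
  does not vanish at the trajectory of that point.
\<close>

lemma opn_traj_preimage:
  assumes U: "opn U"
  shows "opn {x \<in> topspace (base F). traj F D x \<in> U}"
proof -
  let ?W = "{x \<in> topspace (base F). traj F D x \<in> U}"
  have "\<exists>T. opn T \<and> x \<in> T \<and> T \<subseteq> ?W" if x: "x \<in> ?W" for x
  proof -
    from x have xt: "x \<in> topspace (base F)" by blast
    then obtain V R \<rho> pr where V: "x \<in> V" and ch: "affine_chart V (R :: 'b ring) \<rho> pr"
      by (rule point_chart_vf)
    note opn_V = chart_opn[OF ch]
    let ?N = "U \<inter> V"
    have N: "opn ?N" "?N \<subseteq> V" "traj F D x \<in> ?N"
      using U opn_V x traj_in_chart(1)[OF ch V] by auto
    obtain f where f: "f \<in> carrier (\<O> V)" "traj F D x \<in> unit_locus V f" "unit_locus V f \<subseteq> ?N"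
      by (rule chart_basis[OF ch N])
    \<comment> \<open>The smallest set closed under the derivation that contains \<open>f\<close>.\<close>
    let ?I = "range (\<lambda>n. (D V ^^ n) f)"
    have sub: "?I \<subseteq> carrier (\<O> V)"
      using diff_ring.dn_closed[OF diff_ring_sections[OF opn_V] f(1)] by blast
    have D_I: "D V b \<in> ?I" if b: "b \<in> ?I" for b
    proof -
      from b obtain n where "b = (D V ^^ n) f" by auto
      then have "D V b = (D V ^^ Suc n) f" by simp
      then show ?thesis by (rule range_eqI)
    qed
    have fI: "f \<in> ?I" by (rule range_eqI[of _ _ 0]) simp
    obtain b where "b \<in> ?I" and xb: "x \<in> unit_locus V b"
      by (rule escape_core[OF ch V sub D_I fI f(2)])
    then obtain n where b: "b = (D V ^^ n) f" by auto
    have "y \<in> ?W" if y: "y \<in> unit_locus V b" for y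
    proof -
      have yV: "y \<in> V" using y unit_locus_subset by blast
      have "(D V ^^ n) f \<notin> nonunits V y" using y unfolding b nonunits_def by blast
      then have "f \<notin> core V y" unfolding mem_core[OF ch] by blast
      then have "traj F D y \<in> unit_locus V f" using traj_in_chart(2)[OF ch yV] mem_nonunits[OF f(1)] by blast
      then show ?thesis using f(3) yV opn_V openin_subset by blast
    qed
    with xb opn_unit_locus show ?thesis by blast
  qed
  then show ?thesis using openin_subopen by blast
qed

section \<open>Sections and leaves\<close>

text \<open>
  Let \<open>\<eta>\<close> be the trajectory of \<open>x\<close>.  The sections annihilating \<open>s\<close> are closed under the
  derivation: \<open>b s = 0\<close> gives \<open>b D s + D b s = 0\<close>, and multiplying by \<open>D b s\<close> gives
  \<open>(D b s)\<^sup>2 = 0\<close>, so \<open>D b s = 0\<close> by reducedness.  Since \<open>s\<close> is zero near \<open>\<eta>\<close>, one of them does not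
  vanish at \<open>\<eta>\<close>; hence one does not vanish at \<open>x\<close>, and \<open>s\<close> is zero near \<open>x\<close>.
\<close>

theorem zero_if_zero_at_leaves:
  assumes N: "opn N" and s: "s \<in> carrier (\<O> N)"
    and loc: "\<And>\<eta>. \<eta> \<in> N \<Longrightarrow> \<eta> \<in> leaves F D \<Longrightarrow>
      \<exists>Z. opn Z \<and> \<eta> \<in> Z \<and> Z \<subseteq> N \<and> res N Z s = \<zero>\<^bsub>\<O> Z\<^esub>"
  shows "s = \<zero>\<^bsub>\<O> N\<^esub>"
proof (rule section_eqI[OF N s])
  interpret N: cring "\<O> N" by (rule cring_sections[OF N])
  show "\<zero>\<^bsub>\<O> N\<^esub> \<in> carrier (\<O> N)" by simp
  fix x assume x: "x \<in> N"
  have xt: "x \<in> topspace (base F)" using x N openin_subset by blast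
  then obtain V R \<rho> pr where V: "x \<in> V" and ch: "affine_chart V (R :: 'b ring) \<rho> pr"
    by (rule point_chart_vf)
  note opn_V = chart_opn[OF ch]
  let ?M = "N \<inter> V"
  have M: "opn ?M" "?M \<subseteq> V" "x \<in> ?M" "?M \<subseteq> N" using N x V opn_V by auto
  interpret M: cring "\<O> ?M" by (rule cring_sections[OF M(1)])
  let ?s = "res N ?M s"
  have sM: "?s \<in> carrier (\<O> ?M)" using N M s by simp
  let ?I = "{b \<in> carrier (\<O> V). res V ?M b \<otimes>\<^bsub>\<O> ?M\<^esub> ?s = \<zero>\<^bsub>\<O> ?M\<^esub>}"
  have D_I: "D V b \<in> ?I" if b: "b \<in> ?I" for b
  proof -
    let ?b = "res V ?M b" and ?Db = "D ?M (res V ?M b)" and ?Ds = "D ?M ?s"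
    have c: "?b \<in> carrier (\<O> ?M)" "?Db \<in> carrier (\<O> ?M)" "?Ds \<in> carrier (\<O> ?M)"
      using b M opn_V sM D_closed by simp_all
    have bs: "?b \<otimes>\<^bsub>\<O> ?M\<^esub> ?s = \<zero>\<^bsub>\<O> ?M\<^esub>" using b by blast
    have D0: "?b \<otimes>\<^bsub>\<O> ?M\<^esub> ?Ds \<oplus>\<^bsub>\<O> ?M\<^esub> ?Db \<otimes>\<^bsub>\<O> ?M\<^esub> ?s = \<zero>\<^bsub>\<O> ?M\<^esub>"
      using D_mult[OF M(1) c(1) sM] D_zero[OF M(1)] unfolding bs by simp
    have "(?Db \<otimes>\<^bsub>\<O> ?M\<^esub> ?s) \<otimes>\<^bsub>\<O> ?M\<^esub> (?Db \<otimes>\<^bsub>\<O> ?M\<^esub> ?s)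
        = (?b \<otimes>\<^bsub>\<O> ?M\<^esub> ?Ds \<oplus>\<^bsub>\<O> ?M\<^esub> ?Db \<otimes>\<^bsub>\<O> ?M\<^esub> ?s) \<otimes>\<^bsub>\<O> ?M\<^esub> (?Db \<otimes>\<^bsub>\<O> ?M\<^esub> ?s)
          \<ominus>\<^bsub>\<O> ?M\<^esub> (?b \<otimes>\<^bsub>\<O> ?M\<^esub> ?s) \<otimes>\<^bsub>\<O> ?M\<^esub> (?Ds \<otimes>\<^bsub>\<O> ?M\<^esub> ?Db)"
      using c sM by algebra
    also have "\<dots> = \<zero>\<^bsub>\<O> ?M\<^esub>" unfolding D0 bs using c sM by (simp add: M.minus_eq)
    finally have "?Db \<otimes>\<^bsub>\<O> ?M\<^esub> ?s = \<zero>\<^bsub>\<O> ?M\<^esub>" by (rule square_zero[OF M(1) M.m_closed[OF c(2) sM]])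
    then show ?thesis using b D_closed[OF opn_V] D_res[OF opn_V M(1,2)] by simp
  qed
  let ?\<eta> = "traj F D x"
  have \<eta>: "?\<eta> \<in> ?M" "?\<eta> \<in> N" by (rule traj_mem[OF M(1,3)], rule traj_mem[OF N x])
  obtain Z where Z: "opn Z" "?\<eta> \<in> Z" "Z \<subseteq> N" "res N Z s = \<zero>\<^bsub>\<O> Z\<^esub>"
    using loc[OF \<eta>(2) traj_leaf[OF xt]] by blast
  let ?Z = "Z \<inter> ?M"
  have Z': "opn ?Z" "?Z \<subseteq> V" "?\<eta> \<in> ?Z" "?Z \<subseteq> ?M" "?Z \<subseteq> Z" using Z M \<eta> by auto
  obtain f where f: "f \<in> carrier (\<O> V)" "?\<eta> \<in> unit_locus V f" "unit_locus V f \<subseteq> ?Z"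
    by (rule chart_basis[OF ch Z'(1-3)])
  have "res ?M ?Z ?s = res Z ?Z (res N Z s)" using N M Z(1-3) Z' s by simp
  then have "res ?M ?Z ?s = \<zero>\<^bsub>\<O> ?Z\<^esub>" unfolding Z(4) using Z' Z(1) by simp
  moreover have "unit_locus ?M (res V ?M f) \<subseteq> ?Z" using unit_locus_res[OF opn_V M(1,2) f(1)] f(3) by blast
  ultimately have "res V ?M f \<otimes>\<^bsub>\<O> ?M\<^esub> ?s = \<zero>\<^bsub>\<O> ?M\<^esub>"
    using f(1) opn_V M sM by (intro mult_eq_zeroI[OF M(1) _ sM Z'(1,4)]) auto
  then have fI: "f \<in> ?I" using f(1) by blast
  have sub: "?I \<subseteq> carrier (\<O> V)" by blast
  obtain b where b: "b \<in> ?I" "x \<in> unit_locus V b"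
    by (rule escape_core[OF ch V sub D_I fI f(2)])
  let ?Y = "unit_locus V b \<inter> ?M"
  have Y: "opn ?Y" "?Y \<subseteq> ?M" "?Y \<subseteq> V" "?Y \<subseteq> N" "x \<in> ?Y" using opn_unit_locus M b by auto
  have c: "res V ?Y b \<in> carrier (\<O> ?Y)" "res N ?Y s \<in> carrier (\<O> ?Y)" using b Y opn_V N s by simp_all
  have "unit_locus ?Y (res V ?Y b) = ?Y" using unit_locus_res[OF opn_V Y(1,3), of b] b by blast
  moreover have bV: "b \<in> carrier (\<O> V)" and bs: "res V ?M b \<otimes>\<^bsub>\<O> ?M\<^esub> ?s = \<zero>\<^bsub>\<O> ?M\<^esub>"
    using b(1) by blast+
  have "res V ?Y b \<otimes>\<^bsub>\<O> ?Y\<^esub> res N ?Y s = \<zero>\<^bsub>\<O> ?Y\<^esub>"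
    using arg_cong[OF bs, of "res ?M ?Y"] bV N M opn_V s sM Y by (simp add: res_mult)
  ultimately have "res N ?Y s = \<zero>\<^bsub>\<O> ?Y\<^esub>" using unit_locus_cancel[OF Y(1)] c by blast
  then show "\<exists>Z. opn Z \<and> x \<in> Z \<and> Z \<subseteq> N \<and> res N Z s = res N Z \<zero>\<^bsub>\<O> N\<^esub>"
    using Y N by (intro exI[of _ ?Y]) simp
qed

corollary eq_if_eq_at_leaves:
  assumes N: "opn N" and s: "s \<in> carrier (\<O> N)" and t: "t \<in> carrier (\<O> N)"
    and loc: "\<And>\<eta>. \<eta> \<in> N \<Longrightarrow> \<eta> \<in> leaves F D \<Longrightarrow>
      \<exists>Z. opn Z \<and> \<eta> \<in> Z \<and> Z \<subseteq> N \<and> res N Z s = res N Z t"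
  shows "s = t"
proof -
  interpret N: cring "\<O> N" by (rule cring_sections[OF N])
  have "s \<ominus>\<^bsub>\<O> N\<^esub> t = \<zero>\<^bsub>\<O> N\<^esub>"
  proof (rule zero_if_zero_at_leaves[OF N])
    show "s \<ominus>\<^bsub>\<O> N\<^esub> t \<in> carrier (\<O> N)" using s t by simp
    fix \<eta> assume "\<eta> \<in> N" "\<eta> \<in> leaves F D"
    from loc[OF this] obtain Z where Z: "opn Z" "\<eta> \<in> Z" "Z \<subseteq> N" "res N Z s = res N Z t" by blast
    interpret Z: cring "\<O> Z" by (rule cring_sections[OF Z(1)])
    have "res N Z (s \<ominus>\<^bsub>\<O> N\<^esub> t) = \<zero>\<^bsub>\<O> Z\<^esub>"
      using Z N s t by (simp add: res_minus Z.minus_eq Z.r_neg)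
    with Z show "\<exists>Z. opn Z \<and> \<eta> \<in> Z \<and> Z \<subseteq> N \<and> res N Z (s \<ominus>\<^bsub>\<O> N\<^esub> t) = \<zero>\<^bsub>\<O> Z\<^esub>" by blast
  qed
  then show ?thesis using s t by simp
qed

text \<open>
  Let \<open>\<eta>\<close> be the trajectory of \<open>x\<close>, which lies in \<open>U\<close>.  The denominators of \<open>s\<close>, that is the
  sections \<open>b\<close> such that \<open>b s\<close> extends to a section \<open>a\<close> over a chart, are closed under the derivation
  because \<open>D s = 0\<close> gives \<open>D b s = D a\<close>.  One of them does not vanish at \<open>\<eta>\<close>; hence some \<open>b\<close> does
  not vanish at \<open>x\<close>, and \<open>a / b\<close> extends \<open>s\<close> to a neighbourhood of \<open>x\<close>.  By
  \<open>eq_if_eq_at_leaves\<close> these extensions agree on overlaps, and their derivatives are zero.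
\<close>

theorem extend_constant:
  assumes U: "opn U" and W: "opn W" and UW: "U \<subseteq> W" and leaves: "\<And>\<eta>. \<eta> \<in> W \<Longrightarrow> \<eta> \<in> leaves F D \<Longrightarrow> \<eta> \<in> U"
    and s: "s \<in> carrier (\<O> U)" "D U s = \<zero>\<^bsub>\<O> U\<^esub>"
  obtains t where "t \<in> carrier (\<O> W)" "D W t = \<zero>\<^bsub>\<O> W\<^esub>" "res W U t = s"
proof -
  have "\<exists>Z t. opn Z \<and> x \<in> Z \<and> Z \<subseteq> W \<and> t \<in> carrier (\<O> Z) \<and> res Z (Z \<inter> U) t = res U (Z \<inter> U) s"
    if x: "x \<in> W" for x
  proof -
    have xt: "x \<in> topspace (base F)" using x W openin_subset by blast
    then obtain V R \<rho> pr where V: "x \<in> V" and ch: "affine_chart V (R :: 'b ring) \<rho> pr"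
      by (rule point_chart_vf)
    note opn_V = chart_opn[OF ch]
    let ?N = "V \<inter> U"
    let ?s = "res U ?N s"
    have N: "opn ?N" "?N \<subseteq> V" "?N \<subseteq> U" using U opn_V by auto
    interpret N: cring "\<O> ?N" by (rule cring_sections[OF N(1)])
    have sN: "?s \<in> carrier (\<O> ?N)" using U N s by simp
    have Ds: "D ?N ?s = \<zero>\<^bsub>\<O> ?N\<^esub>" using D_res[OF U N(1,3) s(1)] s(2) U N by simp
    \<comment> \<open>The denominators of \<open>s\<close>.\<close>
    let ?I = "{b \<in> carrier (\<O> V). \<exists>a\<in>carrier (\<O> V). res V ?N b \<otimes>\<^bsub>\<O> ?N\<^esub> ?s = res V ?N a}"
    have D_I: "D V b \<in> ?I" if "b \<in> ?I" for b
    proof -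
      obtain a where a: "b \<in> carrier (\<O> V)" "a \<in> carrier (\<O> V)"
        and eq: "res V ?N b \<otimes>\<^bsub>\<O> ?N\<^esub> ?s = res V ?N a" using \<open>b \<in> ?I\<close> by blast
      have c: "res V ?N b \<in> carrier (\<O> ?N)" "D ?N (res V ?N b) \<in> carrier (\<O> ?N)"
        using a N opn_V D_closed by simp_all
      have "D ?N (res V ?N b \<otimes>\<^bsub>\<O> ?N\<^esub> ?s) = D ?N (res V ?N b) \<otimes>\<^bsub>\<O> ?N\<^esub> ?s"
        unfolding D_mult[OF N(1) c(1) sN] Ds using c sN by simp
      then have "res V ?N (D V b) \<otimes>\<^bsub>\<O> ?N\<^esub> ?s = res V ?N (D V a)"
        unfolding eq D_res[OF opn_V N(1,2) a(1)] D_res[OF opn_V N(1,2) a(2)] by simp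
      then show ?thesis using D_closed[OF opn_V] a by blast
    qed
    let ?\<eta> = "traj F D x"
    have "?\<eta> \<in> W" by (rule traj_mem[OF W x])
    then have \<eta>: "?\<eta> \<in> ?N" using leaves traj_leaf[OF xt] traj_mem[OF opn_V V] by blast
    obtain g a where g: "g \<in> carrier R" "a \<in> carrier R" "?\<eta> \<in> unit_locus V (\<rho> g)" "unit_locus V (\<rho> g) \<subseteq> ?N"
      "res V ?N (\<rho> g) \<otimes>\<^bsub>\<O> ?N\<^esub> ?s = res V ?N (\<rho> a)"
      by (rule chart_clear_denominator[OF ch N(1,2) \<eta> sN])
    have gI: "\<rho> g \<in> ?I" using g ring_hom_closed[OF chart_hom[OF ch]] by blast
    have sub: "?I \<subseteq> carrier (\<O> V)" by blast
    obtain b where bI: "b \<in> ?I" and xb: "x \<in> unit_locus V b"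
      by (rule escape_core[OF ch V sub D_I gI g(3)])
    obtain a where b: "b \<in> carrier (\<O> V)" and a: "a \<in> carrier (\<O> V)"
      and eq: "res V ?N b \<otimes>\<^bsub>\<O> ?N\<^esub> ?s = res V ?N a" using bI by blast
    let ?Z = "unit_locus V b \<inter> W"
    have Z: "opn ?Z" "?Z \<subseteq> V" "?Z \<subseteq> W" "x \<in> ?Z" using opn_unit_locus unit_locus_subset[of V b] xb x W by auto
    let ?b = "res V ?Z b" and ?a = "res V ?Z a"
    have c: "?b \<in> carrier (\<O> ?Z)" "?a \<in> carrier (\<O> ?Z)" using a b opn_V Z by simp_all
    have nvb: "unit_locus ?Z ?b = ?Z" using unit_locus_res[OF opn_V Z(1,2) b] by blast
    obtain u where u: "u \<in> carrier (\<O> ?Z)" "?b \<otimes>\<^bsub>\<O> ?Z\<^esub> u = \<one>\<^bsub>\<O> ?Z\<^esub>"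
      by (rule inverse_on_unit_locus[OF Z(1) c(1) nvb])
    interpret Z: cring "\<O> ?Z" by (rule cring_sections[OF Z(1)])
    let ?Y = "?Z \<inter> U"
    have Y: "opn ?Y" "?Y \<subseteq> ?Z" "?Y \<subseteq> U" "?Y \<subseteq> ?N" "?Y \<subseteq> V" using Z U by auto
    interpret Y: cring "\<O> ?Y" by (rule cring_sections[OF Y(1)])
    have cY: "res ?Z ?Y u \<in> carrier (\<O> ?Y)" "res V ?Y b \<in> carrier (\<O> ?Y)" "res U ?Y s \<in> carrier (\<O> ?Y)"
      using u(1) b s(1) Z(1) Y opn_V U by simp_all
    have eqY: "res V ?Y b \<otimes>\<^bsub>\<O> ?Y\<^esub> res U ?Y s = res V ?Y a"
      using arg_cong[OF eq, of "res ?N ?Y"] a b s(1) U opn_V N sN Y by (simp add: res_mult)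
    have uY: "res V ?Y b \<otimes>\<^bsub>\<O> ?Y\<^esub> res ?Z ?Y u = \<one>\<^bsub>\<O> ?Y\<^esub>"
      using arg_cong[OF u(2), of "res ?Z ?Y"] b c u(1) opn_V Z(1,2) Y by (simp add: res_mult)
    have "res ?Z ?Y (u \<otimes>\<^bsub>\<O> ?Z\<^esub> ?a) = res ?Z ?Y u \<otimes>\<^bsub>\<O> ?Y\<^esub> res V ?Y a"
      using u(1) c a opn_V Z(1,2) Y by (simp add: res_mult)
    also have "\<dots> = (res V ?Y b \<otimes>\<^bsub>\<O> ?Y\<^esub> res ?Z ?Y u) \<otimes>\<^bsub>\<O> ?Y\<^esub> res U ?Y s"
      unfolding eqY[symmetric] using cY by (simp add: Y.m_ac)
    also have "\<dots> = res U ?Y s" unfolding uY using cY by simp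
    finally show ?thesis
      using Z u(1) c by (intro exI[of _ ?Z] exI[of _ "u \<otimes>\<^bsub>\<O> ?Z\<^esub> ?a"]) simp
  qed
  then obtain Z \<tau> where Z: "\<And>x. x \<in> W \<Longrightarrow> opn (Z x) \<and> x \<in> Z x \<and> Z x \<subseteq> W"
    and \<tau>: "\<And>x. x \<in> W \<Longrightarrow> \<tau> x \<in> carrier (\<O> (Z x))"
    and ext: "\<And>x. x \<in> W \<Longrightarrow> res (Z x) (Z x \<inter> U) (\<tau> x) = res U (Z x \<inter> U) s" by metis
  have agree: "res (Z x) (Z x \<inter> Z y) (\<tau> x) = res (Z y) (Z x \<inter> Z y) (\<tau> y)" if xy: "x \<in> W" "y \<in> W" for x y
  proof (rule eq_if_eq_at_leaves)
    let ?Y = "Z x \<inter> Z y"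
    have zx: "opn (Z x)" "Z x \<subseteq> W" "\<tau> x \<in> carrier (\<O> (Z x))" and zy: "opn (Z y)" "\<tau> y \<in> carrier (\<O> (Z y))"
      using Z \<tau> xy by blast+
    show Y: "opn ?Y" by (rule openin_Int[OF zx(1) zy(1)])
    have sub: "?Y \<subseteq> Z x" "?Y \<subseteq> Z y" "?Y \<inter> U \<subseteq> ?Y" "?Y \<inter> U \<subseteq> Z x \<inter> U" "?Y \<inter> U \<subseteq> Z y \<inter> U"
      "Z x \<inter> U \<subseteq> Z x" "Z y \<inter> U \<subseteq> Z y" "Z x \<inter> U \<subseteq> U" "Z y \<inter> U \<subseteq> U" "?Y \<inter> U \<subseteq> Z x" "?Y \<inter> U \<subseteq> Z y"
      "?Y \<inter> U \<subseteq> U" by auto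
    have o: "opn (?Y \<inter> U)" "opn (Z x \<inter> U)" "opn (Z y \<inter> U)" using Y zx zy U by (simp_all add: openin_Int)
    show "res (Z x) ?Y (\<tau> x) \<in> carrier (\<O> ?Y)" "res (Z y) ?Y (\<tau> y) \<in> carrier (\<O> ?Y)"
      using zx zy Y sub by simp_all
    have "res ?Y (?Y \<inter> U) (res (Z x) ?Y (\<tau> x)) = res U (?Y \<inter> U) s"
      using arg_cong[OF ext[OF xy(1)], of "res (Z x \<inter> U) (?Y \<inter> U)"] zx Y o sub U s(1) by simp
    moreover have "res ?Y (?Y \<inter> U) (res (Z y) ?Y (\<tau> y)) = res U (?Y \<inter> U) s"
      using arg_cong[OF ext[OF xy(2)], of "res (Z y \<inter> U) (?Y \<inter> U)"] zy Y o sub U s(1) by simp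
    moreover fix \<eta> assume "\<eta> \<in> ?Y" "\<eta> \<in> leaves F D"
    moreover from this have "\<eta> \<in> U" using leaves zx(2) by blast
    ultimately show "\<exists>T. opn T \<and> \<eta> \<in> T \<and> T \<subseteq> ?Y \<and>
        res ?Y T (res (Z x) ?Y (\<tau> x)) = res ?Y T (res (Z y) ?Y (\<tau> y))"
      using o(1) by (intro exI[of _ "?Y \<inter> U"]) auto
  qed
  have "\<exists>t\<in>carrier (\<O> W). \<forall>x\<in>W. res W (Z x) t = \<tau> x"
    by (rule glue[OF W Z \<tau> agree]) auto
  then obtain t where t: "t \<in> carrier (\<O> W)" "\<And>x. x \<in> W \<Longrightarrow> res W (Z x) t = \<tau> x" by auto
  have tU: "res W U t = s"
  proof (rule section_eqI[OF U _ s(1)])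
    show "res W U t \<in> carrier (\<O> U)" using t(1) U W UW by simp
    fix x assume x: "x \<in> U"
    then have xW: "x \<in> W" using UW by blast
    let ?Y = "Z x \<inter> U"
    have Y: "opn (Z x)" "Z x \<subseteq> W" "opn ?Y" "?Y \<subseteq> U" "?Y \<subseteq> Z x" "x \<in> ?Y" using Z[OF xW] U x by auto
    have "res U ?Y (res W U t) = res (Z x) ?Y (res W (Z x) t)" using Y U W UW t(1) by simp
    also have "\<dots> = res U ?Y s" unfolding t(2)[OF xW] by (rule ext[OF xW])
    finally show "\<exists>Z. opn Z \<and> x \<in> Z \<and> Z \<subseteq> U \<and> res U Z (res W U t) = res U Z s" using Y by blast
  qed
  have "D W t = \<zero>\<^bsub>\<O> W\<^esub>"
  proof (rule zero_if_zero_at_leaves[OF W D_closed[OF W t(1)]])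
    fix \<eta> assume "\<eta> \<in> W" "\<eta> \<in> leaves F D"
    then have "\<eta> \<in> U" by (rule leaves)
    moreover have "res W U (D W t) = \<zero>\<^bsub>\<O> U\<^esub>" unfolding D_res[OF W U UW t(1)] tU by (rule s(2))
    ultimately show "\<exists>Z. opn Z \<and> \<eta> \<in> Z \<and> Z \<subseteq> W \<and> res W Z (D W t) = \<zero>\<^bsub>\<O> Z\<^esub>" using U UW by blast
  qed
  with t(1) tU show thesis by (intro that)
qed

end

section \<open>The Keigher and Carra Ferro sheaves\<close>

lemma (in diff_ring) ring_constants: "ring (R\<lparr>carrier := {a \<in> carrier R. d a = \<zero>}\<rparr>)"
proof (rule subring_is_ring, rule subringI)
  show "\<ominus> h \<in> {a \<in> carrier R. d a = \<zero>}" if "h \<in> {a \<in> carrier R. d a = \<zero>}" for h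
    using that by (simp add: d_uminus)
qed (auto simp: d_add d_mult)

context ring_presheaf
begin

context
  fixes L :: "'a set"
begin

abbreviation T :: "'a topology" where "T \<equiv> subtopology (base F) L"
abbreviation K :: "('a, ('a set \<times> 'b) set) presheaf" where
  "K \<equiv> inverse_image_presheaf (\<lambda>\<eta>. \<eta>) T F"

lemma base_K: "base K = T"
  and sections_K: "sections K U = germ_ring F U"
  by (simp_all add: inverse_image_presheaf_def)

lemma restr_K:
  assumes s: "near U V s" and U: "U' \<subseteq> U"
  shows "restr K U U' (germ F U V s) = germ F U' V s"
proof -
  have "germ F U' W t = germ F U' V s" if t: "near U W t" "germ F U W t = germ F U V s" for W t
  proof -
    obtain Z where Z: "opn Z" "U \<subseteq> Z" "Z \<subseteq> W \<inter> V" "res W Z t = res V Z s"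
      using t(2) unfolding germ_eq_iff[OF t(1) s] by blast
    have "near U' W t" "near U' V s" using t(1) s U by (auto simp: near_def)
    then show ?thesis using Z order_trans[OF U Z(2)] by (subst germ_eq_iff) blast+
  qed
  then show ?thesis
    unfolding inverse_image_presheaf_def by (simp add: UN_germ[OF s, of "\<lambda>V s. germ F U' V s"])
qed

lemma near_mono: "near U V s \<Longrightarrow> U' \<subseteq> U \<Longrightarrow> near U' V s"
  by (auto simp: near_def)

lemma ring_presheaf_K: "ring_presheaf K"
proof (unfold_locales, unfold presheaf_of_rings_def base_K sections_K, intro conjI allI impI)
  have top: "U \<subseteq> topspace (base F)" if "openin T U" for U
    using openin_subset[OF that] by auto
  show "cring (germ_ring F U)" if "openin T U" for U
    by (rule cring_germ_ring[OF top[OF that]])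
  show "restr K U V \<in> ring_hom (germ_ring F U) (germ_ring F V)"
    if UV: "openin T U \<and> openin T V \<and> V \<subseteq> U" for U V
  proof (rule ring_hom_memI)
    have sub: "V \<subseteq> U" using UV by blast
    fix c d assume cd: "c \<in> carrier (germ_ring F U)" "d \<in> carrier (germ_ring F U)"
    obtain W s t where s: "near U W s" and t: "near U W t" and eq: "c = germ F U W s" "d = germ F U W t"
      by (rule germE2[OF cd])
    note n = near_mono[OF s sub] near_mono[OF t sub]
    show "restr K U V c \<in> carrier (germ_ring F V)"
      unfolding eq restr_K[OF s sub] by (rule germ_closed[OF n(1)])
    show "restr K U V (c \<otimes>\<^bsub>germ_ring F U\<^esub> d) = restr K U V c \<otimes>\<^bsub>germ_ring F V\<^esub> restr K U V d"
      unfolding eq germ_mult[OF s t] restr_K[OF s sub] restr_K[OF t sub] restr_K[OF near_mult[OF s t] sub]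
      by (rule germ_mult[OF n, symmetric])
    show "restr K U V (c \<oplus>\<^bsub>germ_ring F U\<^esub> d) = restr K U V c \<oplus>\<^bsub>germ_ring F V\<^esub> restr K U V d"
      unfolding eq germ_add[OF s t] restr_K[OF s sub] restr_K[OF t sub] restr_K[OF near_add[OF s t] sub]
      by (rule germ_add[OF n, symmetric])
  next
    have U: "U \<subseteq> topspace (base F)" "V \<subseteq> topspace (base F)" "V \<subseteq> U" using UV top by auto
    show "restr K U V \<one>\<^bsub>germ_ring F U\<^esub> = \<one>\<^bsub>germ_ring F V\<^esub>"
      unfolding germ_one[OF openin_topspace U(1)] germ_one[OF openin_topspace U(2)]
      by (rule restr_K[OF near_one[OF openin_topspace U(1)] U(3)])
  qed
  show "\<forall>s\<in>carrier (germ_ring F U). restr K U U s = s" for U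
    using germE restr_K subset_refl by metis
  show "\<forall>s\<in>carrier (germ_ring F U). restr K V W (restr K U V s) = restr K U W s"
    if "openin T U \<and> openin T V \<and> openin T W \<and> W \<subseteq> V \<and> V \<subseteq> U" for U V W
  proof
    fix c assume "c \<in> carrier (germ_ring F U)"
    then obtain Y s where s: "near U Y s" "c = germ F U Y s" by (rule germE)
    have sub: "V \<subseteq> U" "W \<subseteq> V" "W \<subseteq> U" using that by auto
    show "restr K V W (restr K U V c) = restr K U W c"
      unfolding s(2) restr_K[OF s(1) sub(1)] restr_K[OF s(1) sub(3)]
      by (rule restr_K[OF near_mono[OF s(1) sub(1)] sub(2)])
  qed
qed

interpretation K: ring_presheaf K by (rule ring_presheaf_K)

text \<open>
  Stalks of the inverse image presheaf consist of germs at a point of germs along open sets of the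
  subspace.  The pair \<open>(U, V)\<close> records both stages: \<open>s\<close> is a section over \<open>V\<close>, and \<open>U\<close> is an open set
  of the subspace contained in \<open>V\<close>.
\<close>

definition iterated_germ :: "'a \<Rightarrow> 'a set \<Rightarrow> 'a set \<Rightarrow> 'b \<Rightarrow> ('a set \<times> ('a set \<times> 'b) set) set" where
  "iterated_germ y U V s = germ K {y} U (germ F U V s)"

lemma near_K: "openin T U \<Longrightarrow> y \<in> U \<Longrightarrow> near U V s \<Longrightarrow> K.near {y} U (germ F U V s)"
  using germ_closed by (simp add: K.near_def base_K sections_K)

lemma iterated_germ_restrict:
  assumes U: "openin T U" and U': "openin T U'" "y \<in> U'" "U' \<subseteq> U" and s: "near U V s"
    and V': "opn V'" "U' \<subseteq> V'" "V' \<subseteq> V"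
  shows "iterated_germ y U' V' (res V V' s) = iterated_germ y U V s"
proof -
  have y: "y \<in> U" using U' by blast
  have "{y} \<subseteq> U'" using U' by blast
  with U'(1,3) have "germ K {y} U' (restr K U U' (germ F U V s)) = germ K {y} U (germ F U V s)"
    by (intro K.germ_res[OF near_K[OF U y s]]) (simp_all add: base_K)
  then show ?thesis
    unfolding iterated_germ_def restr_K[OF s U'(3)] germ_res[OF near_mono[OF s U'(3)] V'] .
qed

text \<open>
  Equality of iterated germs at \<open>y\<close> is equality near \<open>y\<close> in the ambient space.
\<close>

lemma iterated_germ_eqD:
  assumes U: "openin T U" "y \<in> U" "near U V s" and U': "openin T U'" "y \<in> U'" "near U' V' s'"
    and eq: "iterated_germ y U V s = iterated_germ y U' V' s'"
  obtains Z where "opn Z" "y \<in> Z" "Z \<subseteq> V \<inter> V'" "res V Z s = res V' Z s'"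
proof -
  obtain Y where Y: "openin T Y" "y \<in> Y" "Y \<subseteq> U \<inter> U'"
    "restr K U Y (germ F U V s) = restr K U' Y (germ F U' V' s')"
    using eq unfolding iterated_germ_def K.germ_eq_iff[OF near_K[OF U] near_K[OF U']] base_K by blast
  have sub: "Y \<subseteq> U" "Y \<subseteq> U'" using Y by auto
  note n = near_mono[OF U(3) sub(1)] near_mono[OF U'(3) sub(2)]
  have "germ F Y V s = germ F Y V' s'"
    using Y(4) unfolding restr_K[OF U(3) sub(1)] restr_K[OF U'(3) sub(2)] .
  then obtain Z where "opn Z" "Y \<subseteq> Z" "Z \<subseteq> V \<inter> V'" "res V Z s = res V' Z s'"
    unfolding germ_eq_iff[OF n] by blast
  with Y(2) show thesis by (intro that[of Z]) auto
qed

lemma iterated_germ_closed: "openin T U \<Longrightarrow> y \<in> U \<Longrightarrow> near U V s \<Longrightarrow> iterated_germ y U V s \<in> carrier (stalk K y)"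
  unfolding iterated_germ_def by (rule K.germ_closed[OF near_K])

lemma iterated_germ_mult:
  assumes "openin T U" "y \<in> U" "near U V s" "near U V t"
  shows "iterated_germ y U V s \<otimes>\<^bsub>stalk K y\<^esub> iterated_germ y U V t = iterated_germ y U V (s \<otimes>\<^bsub>\<O> V\<^esub> t)"
  unfolding iterated_germ_def K.germ_mult[OF near_K[OF assms(1-3)] near_K[OF assms(1,2,4)]] sections_K
    germ_mult[OF assms(3,4)] ..

lemma iterated_germ_add:
  assumes "openin T U" "y \<in> U" "near U V s" "near U V t"
  shows "iterated_germ y U V s \<oplus>\<^bsub>stalk K y\<^esub> iterated_germ y U V t = iterated_germ y U V (s \<oplus>\<^bsub>\<O> V\<^esub> t)"
  unfolding iterated_germ_def K.germ_add[OF near_K[OF assms(1-3)] near_K[OF assms(1,2,4)]] sections_K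
    germ_add[OF assms(3,4)] ..

lemma iterated_germ_one:
  assumes "openin T U" "y \<in> U" "opn V" "U \<subseteq> V"
  shows "\<one>\<^bsub>stalk K y\<^esub> = iterated_germ y U V \<one>\<^bsub>\<O> V\<^esub>"
  using K.germ_one[of U "{y}"] assms unfolding iterated_germ_def sections_K germ_one[OF assms(3,4)]
  by (simp add: base_K)

lemma iterated_germ_zero:
  assumes "openin T U" "y \<in> U" "opn V" "U \<subseteq> V"
  shows "\<zero>\<^bsub>stalk K y\<^esub> = iterated_germ y U V \<zero>\<^bsub>\<O> V\<^esub>"
  using K.germ_zero[of U "{y}"] assms unfolding iterated_germ_def sections_K germ_zero[OF assms(3,4)]
  by (simp add: base_K)

lemma iterated_germ_der:
  assumes closed: "\<And>U s. opn U \<Longrightarrow> s \<in> carrier (\<O> U) \<Longrightarrow> D U s \<in> carrier (\<O> U)"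
    and compat: "\<And>U V s. opn U \<Longrightarrow> opn V \<Longrightarrow> V \<subseteq> U \<Longrightarrow> s \<in> carrier (\<O> U) \<Longrightarrow>
      res U V (D U s) = D V (res U V s)"
    and U: "openin T U" "y \<in> U" "near U V s"
  shows "germ_der K (germ_der F D) {y} (iterated_germ y U V s) = iterated_germ y U V (D V s)"
proof -
  have gd: "germ_der F D A (germ F A V s) = germ F A V (D V s)" if "near A V s" for A V s
    by (rule germ_der_germ[OF closed compat that])
  have nD: "near A V (D V s)" if "near A V s" for A V s using that closed by (auto simp: near_def)
  have "germ_der K (germ_der F D) {y} (germ K {y} U (germ F U V s))
      = germ K {y} U (germ_der F D U (germ F U V s))"
  proof (rule K.germ_der_germ[OF _ _ near_K[OF U]], unfold sections_K base_K)
    fix U c assume "c \<in> carrier (germ_ring F U)"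
    then obtain V s where s: "near U V s" and eq: "c = germ F U V s" by (rule germE)
    show "germ_der F D U c \<in> carrier (germ_ring F U)" unfolding eq gd[OF s] by (rule germ_closed[OF nD[OF s]])
  next
    fix U U' c assume sub: "U' \<subseteq> U" and "c \<in> carrier (germ_ring F U)"
    then obtain V s where s: "near U V s" and eq: "c = germ F U V s" by (metis germE)
    show "restr K U U' (germ_der F D U c) = germ_der F D U' (restr K U U' c)"
      unfolding eq gd[OF s] restr_K[OF s sub] restr_K[OF nD[OF s] sub] gd[OF near_mono[OF s sub]] ..
  qed
  then show ?thesis unfolding iterated_germ_def gd[OF U(3)] .
qed

end

end

context vector_field_scheme
begin

lemma keigher_presheaf_eq:
  "keigher_presheaf F D = inverse_image_presheaf (\<lambda>\<eta>. \<eta>) (subtopology (base F) (leaves F D)) F"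
  by (simp add: keigher_presheaf_def leaf_space_def)

abbreviation "leaf_top \<equiv> subtopology (base F) (leaves F D)"
abbreviation "keigher \<equiv> inverse_image_presheaf (\<lambda>\<eta>. \<eta>) (subtopology (base F) (leaves F D)) F"
abbreviation "leaf_germ \<equiv> iterated_germ (leaves F D)"

lemma leaf_germ_der: "openin leaf_top U \<Longrightarrow> y \<in> U \<Longrightarrow> near U V s \<Longrightarrow>
    germ_der keigher (germ_der F D) {y} (leaf_germ y U V s) = leaf_germ y U V (D V s)"
  by (rule iterated_germ_der[OF D_closed D_res])

lemma opn_leaves: "opn N \<Longrightarrow> openin leaf_top (N \<inter> leaves F D)"
  by (auto simp: openin_subtopology)

text \<open>
  Both stages of germs collapse: locally, a section of the Keigher sheaf consists of the germs, at the
  leaves in \<open>N\<close>, of a single section over an open set \<open>N\<close> of the whole space.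
\<close>

lemma keigher_section_iff:
  assumes U: "openin leaf_top U"
  shows "k \<in> carrier (sections (keigher_sheaf F D) U) \<longleftrightarrow>
    k \<in> extensional U \<and> (\<forall>\<eta>\<in>U. \<exists>N s. opn N \<and> \<eta> \<in> N \<and> N \<inter> leaves F D \<subseteq> U \<and> s \<in> carrier (\<O> N) \<and>
      (\<forall>y\<in>N \<inter> leaves F D. k y = leaf_germ y (N \<inter> leaves F D) N s))" (is "_ \<longleftrightarrow> _ \<and> ?loc")
proof -
  let ?L = "leaves F D"
  let ?loc' = "\<forall>\<eta>\<in>U. \<exists>V. openin leaf_top V \<and> \<eta> \<in> V \<and> V \<subseteq> U \<and>
             (\<exists>t\<in>carrier (germ_ring F V). \<forall>y\<in>V. k y = germ keigher {y} V t)"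
  have mem: "k \<in> carrier (sections (keigher_sheaf F D) U) \<longleftrightarrow>
    k \<in> (\<Pi>\<^sub>E x\<in>U. carrier (stalk keigher x)) \<and> ?loc'"
    by (simp add: keigher_sheaf_def keigher_presheaf_eq sheafification_def pointwise_ring_def
        base_K sections_K)
  have UL: "U \<subseteq> ?L" using openin_subset[OF U] by auto
  have "?loc' \<longleftrightarrow> ?loc"
  proof (intro ball_cong refl iffI)
    fix \<eta> assume \<eta>: "\<eta> \<in> U" and "\<exists>V. openin leaf_top V \<and> \<eta> \<in> V \<and> V \<subseteq> U \<and>
             (\<exists>t\<in>carrier (germ_ring F V). \<forall>y\<in>V. k y = germ keigher {y} V t)"
    then obtain V t where V: "openin leaf_top V" "\<eta> \<in> V" "V \<subseteq> U" "t \<in> carrier (germ_ring F V)"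
      and k: "\<And>y. y \<in> V \<Longrightarrow> k y = germ keigher {y} V t" by blast
    obtain V' s where s: "near V V' s" and t: "t = germ F V V' s" by (rule germE[OF V(4)])
    obtain V'' where V'': "opn V''" "V = V'' \<inter> ?L" using V(1) by (auto simp: openin_subtopology)
    let ?N = "V'' \<inter> V'"
    have V': "opn V'" "V \<subseteq> V'" "s \<in> carrier (\<O> V')" using s by (auto simp: near_def)
    have N: "opn ?N" "?N \<inter> ?L = V" "V \<subseteq> ?N" using V'' V' by auto
    have "k y = leaf_germ y (?N \<inter> ?L) ?N (res V' ?N s)" if "y \<in> V" for y
      using iterated_germ_restrict[OF V(1) V(1) that subset_refl s N(1) N(3)] k[OF that]
      unfolding N(2) t iterated_germ_def by simp
    then show "\<exists>N s. opn N \<and> \<eta> \<in> N \<and> N \<inter> ?L \<subseteq> U \<and> s \<in> carrier (\<O> N) \<and>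
      (\<forall>y\<in>N \<inter> ?L. k y = leaf_germ y (N \<inter> ?L) N s)"
      using N V V' by (intro exI[of _ ?N] exI[of _ "res V' ?N s"]) auto
  next
    fix \<eta> assume \<eta>: "\<eta> \<in> U" and "\<exists>N s. opn N \<and> \<eta> \<in> N \<and> N \<inter> ?L \<subseteq> U \<and> s \<in> carrier (\<O> N) \<and>
      (\<forall>y\<in>N \<inter> ?L. k y = leaf_germ y (N \<inter> ?L) N s)"
    then obtain N s where N: "opn N" "\<eta> \<in> N" "N \<inter> ?L \<subseteq> U" "s \<in> carrier (\<O> N)"
      "\<forall>y\<in>N \<inter> ?L. k y = leaf_germ y (N \<inter> ?L) N s" by blast
    have "near (N \<inter> ?L) N s" using N by (simp add: near_def)
    from germ_closed[OF this] show "\<exists>V. openin leaf_top V \<and> \<eta> \<in> V \<and> V \<subseteq> U \<and>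
             (\<exists>t\<in>carrier (germ_ring F V). \<forall>y\<in>V. k y = germ keigher {y} V t)"
      using N \<eta> UL opn_leaves[OF N(1)] unfolding iterated_germ_def
      by (intro exI[of _ "N \<inter> ?L"] conjI bexI[of _ "germ F (N \<inter> ?L) N s"]) auto
  qed
  moreover have "k \<in> (\<Pi>\<^sub>E x\<in>U. carrier (stalk keigher x))" if ext: "k \<in> extensional U" and loc: ?loc
  proof -
    have "k \<eta> \<in> carrier (stalk keigher \<eta>)" if \<eta>: "\<eta> \<in> U" for \<eta>
    proof -
      from bspec[OF loc \<eta>] obtain N s where N: "opn N" "\<eta> \<in> N" "N \<inter> ?L \<subseteq> U" "s \<in> carrier (\<O> N)"
        "\<forall>y\<in>N \<inter> ?L. k y = leaf_germ y (N \<inter> ?L) N s" by (elim exE conjE) (rule that)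
      have "near (N \<inter> ?L) N s" using N by (simp add: near_def)
      have \<eta>N: "\<eta> \<in> N \<inter> ?L" using N(2) \<eta> UL by blast
      show ?thesis unfolding bspec[OF N(5) \<eta>N]
        by (rule iterated_germ_closed[OF opn_leaves[OF N(1)] \<eta>N \<open>near (N \<inter> ?L) N s\<close>])
    qed
    with ext show ?thesis by (simp add: PiE_def)
  qed
  ultimately show ?thesis unfolding mem by (auto simp: PiE_def)
qed

context
  fixes U :: "'a set"
  assumes U: "openin leaf_top U"
begin

text \<open>
  The open set over which the Carra Ferro sections of \<open>U\<close> are taken.  Its leaves are exactly the
  points of \<open>U\<close>, as leaves are their own trajectories.
\<close>

abbreviation W :: "'a set" where
  "W \<equiv> preimage (base F) (traj F D) U"

lemma U_leaves: "U \<subseteq> leaves F D" and U_top: "U \<subseteq> topspace (base F)"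
  using openin_subset[OF U] by auto

lemma opn_W: "opn W"
proof -
  obtain U' where U': "opn U'" "U = U' \<inter> leaves F D" using U by (auto simp: openin_subtopology)
  have "W = {x \<in> topspace (base F). traj F D x \<in> U'}"
    unfolding preimage_def using traj_leaf by (subst U'(2)) blast
  then show ?thesis using opn_traj_preimage[OF U'(1)] by simp
qed

lemma U_W: "U \<subseteq> W"
  using U_leaves U_top traj_of_leaf unfolding preimage_def by fastforce

lemma leaf_W: "\<eta> \<in> W \<Longrightarrow> \<eta> \<in> leaves F D \<Longrightarrow> \<eta> \<in> U"
  using traj_of_leaf unfolding preimage_def by fastforce

text \<open>
  The comparison map: restriction to germs at the leaves.
\<close>

definition to_keigher :: "'b \<Rightarrow> 'a \<Rightarrow> ('a set \<times> ('a set \<times> 'b) set) set" where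
  "to_keigher s = (\<lambda>\<eta>\<in>U. leaf_germ \<eta> U W s)"

lemma near_W: "s \<in> carrier (\<O> W) \<Longrightarrow> near U W s"
  using opn_W U_W by (simp add: near_def)

lemma to_keigher_restrict:
  assumes "opn N" "N \<subseteq> W" "s \<in> carrier (\<O> W)" "\<eta> \<in> N" "\<eta> \<in> leaves F D"
  shows "leaf_germ \<eta> (N \<inter> leaves F D) N (res W N s) = to_keigher s \<eta>"
proof -
  have sub: "N \<inter> leaves F D \<subseteq> U" using assms(2) leaf_W by blast
  then have "leaf_germ \<eta> (N \<inter> leaves F D) N (res W N s) = leaf_germ \<eta> U W s"
    using assms by (intro iterated_germ_restrict[OF U opn_leaves _ sub near_W]) auto
  then show ?thesis using sub assms by (auto simp: to_keigher_def)
qed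

lemma to_keigher_closed:
  assumes s: "s \<in> carrier (\<O> W)"
  shows "to_keigher s \<in> carrier (sections (keigher_sheaf F D) U)"
  unfolding keigher_section_iff[OF U]
proof (intro conjI ballI)
  show "to_keigher s \<in> extensional U" by (simp add: to_keigher_def)
  fix \<eta> assume "\<eta> \<in> U"
  then show "\<exists>N t. opn N \<and> \<eta> \<in> N \<and> N \<inter> leaves F D \<subseteq> U \<and> t \<in> carrier (\<O> N) \<and>
      (\<forall>y\<in>N \<inter> leaves F D. to_keigher s y = leaf_germ y (N \<inter> leaves F D) N t)"
    using s opn_W U_W leaf_W to_keigher_restrict[OF opn_W subset_refl s]
    by (intro exI[of _ W] exI[of _ s]) auto
qed

lemma to_keigher_hom: "to_keigher \<in> ring_hom (\<O> W) (sections (keigher_sheaf F D) U)"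
proof (rule ring_hom_memI)
  fix s t assume st: "s \<in> carrier (\<O> W)" "t \<in> carrier (\<O> W)"
  show "to_keigher s \<in> carrier (sections (keigher_sheaf F D) U)" by (rule to_keigher_closed[OF st(1)])
  show "to_keigher (s \<otimes>\<^bsub>\<O> W\<^esub> t) = to_keigher s \<otimes>\<^bsub>sections (keigher_sheaf F D) U\<^esub> to_keigher t"
    using iterated_germ_mult[OF U _ near_W[OF st(1)] near_W[OF st(2)]]
    by (auto simp: to_keigher_def keigher_sheaf_def keigher_presheaf_eq sheafification_def
        pointwise_ring_def intro!: restrict_ext)
  show "to_keigher (s \<oplus>\<^bsub>\<O> W\<^esub> t) = to_keigher s \<oplus>\<^bsub>sections (keigher_sheaf F D) U\<^esub> to_keigher t"
    using iterated_germ_add[OF U _ near_W[OF st(1)] near_W[OF st(2)]]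
    by (auto simp: to_keigher_def keigher_sheaf_def keigher_presheaf_eq sheafification_def
        pointwise_ring_def intro!: restrict_ext)
next
  show "to_keigher \<one>\<^bsub>\<O> W\<^esub> = \<one>\<^bsub>sections (keigher_sheaf F D) U\<^esub>"
    using iterated_germ_one[OF U _ opn_W U_W]
    by (auto simp: to_keigher_def keigher_sheaf_def keigher_presheaf_eq sheafification_def
        pointwise_ring_def intro!: restrict_ext)
qed

lemma keigher_der_to_keigher:
  assumes s: "s \<in> carrier (\<O> W)"
  shows "keigher_der F D U (to_keigher s) = to_keigher (D W s)"
  using leaf_germ_der[OF U _ near_W[OF s]]
  by (auto simp: keigher_der_def sheafification_der_def keigher_presheaf_eq to_keigher_def
      intro!: restrict_ext)

lemma zero_keigher: "\<zero>\<^bsub>sections (keigher_sheaf F D) U\<^esub> = to_keigher \<zero>\<^bsub>\<O> W\<^esub>"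
  using iterated_germ_zero[OF U _ opn_W U_W]
  by (auto simp: to_keigher_def keigher_sheaf_def keigher_presheaf_eq sheafification_def
      pointwise_ring_def intro!: restrict_ext)

lemma to_keigher_inj: "inj_on to_keigher (carrier (\<O> W))"
proof (rule inj_onI)
  fix s t assume s: "s \<in> carrier (\<O> W)" and t: "t \<in> carrier (\<O> W)" and eq: "to_keigher s = to_keigher t"
  show "s = t"
  proof (rule eq_if_eq_at_leaves[OF opn_W s t])
    fix \<eta> assume "\<eta> \<in> W" "\<eta> \<in> leaves F D"
    then have \<eta>: "\<eta> \<in> U" by (rule leaf_W)
    then have "leaf_germ \<eta> U W s = leaf_germ \<eta> U W t" using fun_cong[OF eq, of \<eta>] by (simp add: to_keigher_def)
    then obtain Z where "opn Z" "\<eta> \<in> Z" "Z \<subseteq> W \<inter> W" "res W Z s = res W Z t"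
      by (rule iterated_germ_eqD[OF U \<eta> near_W[OF s] U \<eta> near_W[OF t]])
    then show "\<exists>Z. opn Z \<and> \<eta> \<in> Z \<and> Z \<subseteq> W \<and> res W Z s = res W Z t" by auto
  qed
qed

text \<open>
  If the derivative of a local representative has germ zero at \<open>\<eta>\<close>, it is zero on a neighbourhood of
  \<open>\<eta>\<close>, so after shrinking the representative itself is constant.
\<close>

lemma constant_locally:
  assumes k: "k \<in> carrier (sections (keigher_sheaf F D) U)"
    and const: "keigher_der F D U k = \<zero>\<^bsub>sections (keigher_sheaf F D) U\<^esub>" and \<eta>: "\<eta> \<in> U"
  shows "\<exists>N \<sigma>. opn N \<and> \<eta> \<in> N \<and> N \<subseteq> W \<and> \<sigma> \<in> carrier (\<O> N) \<and> D N \<sigma> = \<zero>\<^bsub>\<O> N\<^esub> \<and>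
    (\<forall>y\<in>N \<inter> leaves F D. k y = leaf_germ y (N \<inter> leaves F D) N \<sigma>)"
proof -
  let ?L = "leaves F D"
  from k[unfolded keigher_section_iff[OF U], THEN conjunct2, THEN bspec, OF \<eta>]
  obtain N s where N: "opn N" "\<eta> \<in> N" "N \<inter> ?L \<subseteq> U" "s \<in> carrier (\<O> N)"
    and all: "\<forall>y\<in>N \<inter> ?L. k y = leaf_germ y (N \<inter> ?L) N s" by (elim exE conjE) (rule that)
  note ks = bspec[OF all]
  have \<eta>N: "\<eta> \<in> N \<inter> ?L" using N \<eta> U_leaves by blast
  have n: "near (N \<inter> ?L) N s" "near (N \<inter> ?L) N (D N s)" "near (N \<inter> ?L) N \<zero>\<^bsub>\<O> N\<^esub>"
    using N D_closed near_zero[OF N(1), of "N \<inter> ?L"] by (auto simp: near_def)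
  have "leaf_germ \<eta> (N \<inter> ?L) N (D N s) = germ_der keigher (germ_der F D) {\<eta>} (k \<eta>)"
    unfolding ks[OF \<eta>N] by (rule leaf_germ_der[OF opn_leaves[OF N(1)] \<eta>N n(1), symmetric])
  also have "\<dots> = keigher_der F D U k \<eta>"
    using \<eta> by (simp add: keigher_der_def sheafification_der_def keigher_presheaf_eq)
  also have "\<dots> = \<zero>\<^bsub>stalk keigher \<eta>\<^esub>"
    unfolding const using \<eta>
    by (simp add: keigher_sheaf_def keigher_presheaf_eq sheafification_def pointwise_ring_def)
  also have "\<dots> = leaf_germ \<eta> (N \<inter> ?L) N \<zero>\<^bsub>\<O> N\<^esub>"
    by (rule iterated_germ_zero[OF opn_leaves[OF N(1)] \<eta>N N(1)]) simp
  finally obtain Z where Z: "opn Z" "\<eta> \<in> Z" "Z \<subseteq> N \<inter> N" "res N Z (D N s) = res N Z \<zero>\<^bsub>\<O> N\<^esub>"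
    by (rule iterated_germ_eqD[OF opn_leaves[OF N(1)] \<eta>N n(2) opn_leaves[OF N(1)] \<eta>N n(3)])
  let ?M = "Z \<inter> W"
  have M: "opn ?M" "\<eta> \<in> ?M" "?M \<subseteq> W" "?M \<subseteq> N" "?M \<subseteq> Z" using Z opn_W U_W \<eta> by auto
  have ZN: "Z \<subseteq> N" using Z by blast
  have DZ: "D Z (res N Z s) = \<zero>\<^bsub>\<O> Z\<^esub>" using Z(4) D_res[OF N(1) Z(1) ZN N(4)] N(1) Z(1) ZN by simp
  have "D ?M (res N ?M s) = res Z ?M (D Z (res N Z s))"
    using D_res[OF Z(1) M(1,5), of "res N Z s"] N Z(1) ZN M by simp
  also have "\<dots> = \<zero>\<^bsub>\<O> ?M\<^esub>" unfolding DZ using Z(1) M by simp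
  finally have DM: "D ?M (res N ?M s) = \<zero>\<^bsub>\<O> ?M\<^esub>" .
  have sub: "?M \<inter> ?L \<subseteq> N \<inter> ?L" using M by blast
  have "k y = leaf_germ y (?M \<inter> ?L) ?M (res N ?M s)" if y: "y \<in> ?M \<inter> ?L" for y
  proof -
    have yN: "y \<in> N \<inter> ?L" using y sub by blast
    show ?thesis unfolding ks[OF yN]
      by (rule iterated_germ_restrict[OF opn_leaves[OF N(1)] opn_leaves[OF M(1)] y sub n(1) M(1) Int_lower1 M(4),
            symmetric])
  qed
  then show ?thesis using M N DM by (intro exI[of _ ?M] exI[of _ "res N ?M s"]) simp
qed

text \<open>
  The constant local representatives have the same germs at the leaves where two of them are defined,
  so they agree on overlaps by \<open>eq_if_eq_at_leaves\<close> and glue to a constant section over a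
  neighbourhood of \<open>U\<close>.  This section extends to \<open>W\<close> by \<open>extend_constant\<close>.
\<close>

lemma constant_lift:
  assumes k: "k \<in> carrier (sections (keigher_sheaf F D) U)"
    and const: "keigher_der F D U k = \<zero>\<^bsub>sections (keigher_sheaf F D) U\<^esub>"
  shows "\<exists>t\<in>carrier (\<O> W). D W t = \<zero>\<^bsub>\<O> W\<^esub> \<and> to_keigher t = k"
proof -
  let ?L = "leaves F D"
  from constant_locally[OF k const] obtain N \<sigma>
    where N: "\<And>\<eta>. \<eta> \<in> U \<Longrightarrow> opn (N \<eta>) \<and> \<eta> \<in> N \<eta> \<and> N \<eta> \<subseteq> W"
      and \<sigma>: "\<And>\<eta>. \<eta> \<in> U \<Longrightarrow> \<sigma> \<eta> \<in> carrier (\<O> (N \<eta>)) \<and> D (N \<eta>) (\<sigma> \<eta>) = \<zero>\<^bsub>\<O> (N \<eta>)\<^esub>"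
      and k\<sigma>: "\<And>\<eta> y. \<eta> \<in> U \<Longrightarrow> y \<in> N \<eta> \<inter> ?L \<Longrightarrow> k y = leaf_germ y (N \<eta> \<inter> ?L) (N \<eta>) (\<sigma> \<eta>)" by metis
  have near: "near (N \<eta> \<inter> ?L) (N \<eta>) (\<sigma> \<eta>)" if "\<eta> \<in> U" for \<eta>
    using N[OF that] \<sigma>[OF that] by (simp add: near_def)
  have agree: "res (N \<eta>) (N \<eta> \<inter> N \<zeta>) (\<sigma> \<eta>) = res (N \<zeta>) (N \<eta> \<inter> N \<zeta>) (\<sigma> \<zeta>)"
    if U: "\<eta> \<in> U" "\<zeta> \<in> U" for \<eta> \<zeta>
  proof (rule eq_if_eq_at_leaves)
    let ?Y = "N \<eta> \<inter> N \<zeta>"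
    have o: "opn (N \<eta>)" "opn (N \<zeta>)" "?Y \<subseteq> N \<eta>" "?Y \<subseteq> N \<zeta>" using N U by auto
    show Y: "opn ?Y" by (rule openin_Int[OF o(1,2)])
    show "res (N \<eta>) ?Y (\<sigma> \<eta>) \<in> carrier (\<O> ?Y)" "res (N \<zeta>) ?Y (\<sigma> \<zeta>) \<in> carrier (\<O> ?Y)"
      using o Y \<sigma> U by simp_all
    fix y assume y: "y \<in> ?Y" "y \<in> ?L"
    then have yN: "y \<in> N \<eta> \<inter> ?L" "y \<in> N \<zeta> \<inter> ?L" by auto
    have "leaf_germ y (N \<eta> \<inter> ?L) (N \<eta>) (\<sigma> \<eta>) = leaf_germ y (N \<zeta> \<inter> ?L) (N \<zeta>) (\<sigma> \<zeta>)"
      unfolding k\<sigma>[OF U(1) yN(1), symmetric] k\<sigma>[OF U(2) yN(2), symmetric] ..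
    then obtain Z where "opn Z" "y \<in> Z" "Z \<subseteq> ?Y" "res (N \<eta>) Z (\<sigma> \<eta>) = res (N \<zeta>) Z (\<sigma> \<zeta>)"
      by (rule iterated_germ_eqD[OF opn_leaves[OF o(1)] yN(1) near[OF U(1)] opn_leaves[OF o(2)] yN(2) near[OF U(2)]])
    then show "\<exists>Z. opn Z \<and> y \<in> Z \<and> Z \<subseteq> ?Y \<and>
        res ?Y Z (res (N \<eta>) ?Y (\<sigma> \<eta>)) = res ?Y Z (res (N \<zeta>) ?Y (\<sigma> \<zeta>))"
      using o Y \<sigma> U by (intro exI[of _ Z]) simp
  qed
  \<comment> \<open>Gluing is indexed by all points of the union, so each point picks a leaf whose neighbourhood contains it.\<close>
  let ?U = "\<Union>\<eta>\<in>U. N \<eta>"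
  have oU: "opn ?U" using N by blast
  have UW: "?U \<subseteq> W" using N by blast
  have UU: "U \<subseteq> ?U" using N by blast
  have "\<forall>x\<in>?U. \<exists>\<eta>. \<eta> \<in> U \<and> x \<in> N \<eta>" by blast
  then obtain p where p: "\<And>x. x \<in> ?U \<Longrightarrow> p x \<in> U \<and> x \<in> N (p x)" by metis
  have Z: "opn (N (p x)) \<and> x \<in> N (p x) \<and> N (p x) \<subseteq> ?U" if "x \<in> ?U" for x
    using p[OF that] N by blast
  have \<sigma>p: "\<sigma> (p x) \<in> carrier (\<O> (N (p x)))" if "x \<in> ?U" for x
    using p[OF that] \<sigma> by blast
  have agree_p: "res (N (p x)) (N (p x) \<inter> N (p y)) (\<sigma> (p x)) = res (N (p y)) (N (p x) \<inter> N (p y)) (\<sigma> (p y))"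
    if "x \<in> ?U" "y \<in> ?U" for x y
    using p[OF that(1)] p[OF that(2)] by (intro agree) auto
  have "\<exists>s\<in>carrier (\<O> ?U). \<forall>x\<in>?U. res ?U (N (p x)) s = \<sigma> (p x)"
    by (rule glue[OF oU Z \<sigma>p agree_p]) auto
  then obtain s where s: "s \<in> carrier (\<O> ?U)" "\<And>x. x \<in> ?U \<Longrightarrow> res ?U (N (p x)) s = \<sigma> (p x)"
    by auto
  have Ds: "D ?U s = \<zero>\<^bsub>\<O> ?U\<^esub>"
  proof (rule zero_if_zero_at_leaves[OF oU D_closed[OF oU s(1)]])
    fix x assume x: "x \<in> ?U"
    have "res ?U (N (p x)) (D ?U s) = \<zero>\<^bsub>\<O> (N (p x))\<^esub>"
      using D_res[OF oU _ _ s(1), of "N (p x)"] Z[OF x] \<sigma> p[OF x] s(2)[OF x] by simp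
    then show "\<exists>Z. opn Z \<and> x \<in> Z \<and> Z \<subseteq> ?U \<and> res ?U Z (D ?U s) = \<zero>\<^bsub>\<O> Z\<^esub>" using Z[OF x] by blast
  qed
  have lv: "\<eta> \<in> ?U" if "\<eta> \<in> W" "\<eta> \<in> ?L" for \<eta> using UU leaf_W[OF that] by blast
  obtain t where t: "t \<in> carrier (\<O> W)" "D W t = \<zero>\<^bsub>\<O> W\<^esub>" "res W ?U t = s"
    by (rule extend_constant[OF oU opn_W UW lv s(1) Ds])
  have "to_keigher t \<eta> = k \<eta>" if \<eta>: "\<eta> \<in> U" for \<eta>
  proof -
    have x: "\<eta> \<in> ?U" using \<eta> UU by blast
    note px = p[OF x] Z[OF x]
    have "N (p \<eta>) \<subseteq> W" using px UW by blast
    then have "to_keigher t \<eta> = leaf_germ \<eta> (N (p \<eta>) \<inter> ?L) (N (p \<eta>)) (res W (N (p \<eta>)) t)"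
      using px t(1) \<eta> U_leaves by (intro to_keigher_restrict[symmetric]) auto
    also have "res W (N (p \<eta>)) t = \<sigma> (p \<eta>)"
      using s(2)[OF x] px t oU opn_W UW unfolding t(3)[symmetric] by simp
    also have "leaf_germ \<eta> (N (p \<eta>) \<inter> ?L) (N (p \<eta>)) (\<sigma> (p \<eta>)) = k \<eta>"
      using px \<eta> U_leaves by (intro k\<sigma>[symmetric]) auto
    finally show ?thesis .
  qed
  moreover have "to_keigher t \<in> extensional U" "k \<in> extensional U"
    using k unfolding keigher_section_iff[OF U] by (auto simp: to_keigher_def)
  ultimately have "to_keigher t = k" by (intro extensionalityI[of _ U])
  with t show ?thesis by blast
qed

theorem constants_iso:
  "constants (sections (keigher_sheaf F D) U) (keigher_der F D U) \<simeq> constants (\<O> W) (D W)"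
proof -
  let ?A = "{a \<in> carrier (\<O> W). D W a = \<zero>\<^bsub>\<O> W\<^esub>}"
  let ?B = "{k \<in> carrier (sections (keigher_sheaf F D) U).
      keigher_der F D U k = \<zero>\<^bsub>sections (keigher_sheaf F D) U\<^esub>}"
  have maps: "to_keigher s \<in> ?B" if "s \<in> ?A" for s
    using that to_keigher_closed keigher_der_to_keigher zero_keigher by simp
  have "bij_betw to_keigher ?A ?B"
  proof (rule bij_betw_imageI)
    show "inj_on to_keigher ?A" using to_keigher_inj by (rule inj_on_subset) blast
    show "to_keigher ` ?A = ?B" using maps constant_lift by blast
  qed
  then have "to_keigher \<in> ring_iso (constants (\<O> W) (D W))
      (constants (sections (keigher_sheaf F D) U) (keigher_der F D U))"
    using maps to_keigher_hom unfolding ring_iso_def ring_hom_def constants_def by auto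
  moreover have "ring (constants (\<O> W) (D W))"
    unfolding constants_def by (rule diff_ring.ring_constants[OF diff_ring_sections[OF opn_W]])
  ultimately show ?thesis using ring_iso_sym is_ring_iso_def by blast
qed

end

end

lemma rational_hom_inverse:
  assumes S: "cring S" and h: "h \<in> ring_hom (ring_of_type_algebra :: rat ring) S" and c: "0 < (c::nat)"
  shows "\<exists>u\<in>carrier S. add_pow S c \<one>\<^bsub>S\<^esub> \<otimes>\<^bsub>S\<^esub> u = \<one>\<^bsub>S\<^esub>"
proof -
  let ?Q = "ring_of_type_algebra :: rat ring"
  interpret h: ring_hom_cring ?Q S h
    using S h cring_from_type_algebra by (auto simp: ring_hom_cring_def ring_hom_cring_axioms_def)
  have Q: "carrier ?Q = UNIV" "\<one>\<^bsub>?Q\<^esub> = 1" "\<zero>\<^bsub>?Q\<^esub> = 0" "a \<otimes>\<^bsub>?Q\<^esub> b = a * b" "a \<oplus>\<^bsub>?Q\<^esub> b = a + b" for a b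
    by (simp_all add: ring_of_type_algebra_def)
  have nat: "h (of_nat k) = add_pow S k \<one>\<^bsub>S\<^esub>" for k :: nat
  proof (induction k)
    case 0
    then show ?case using h.hom_zero by (simp add: Q)
  next
    case (Suc k)
    have "h (of_nat (Suc k)) = h (of_nat k \<oplus>\<^bsub>?Q\<^esub> \<one>\<^bsub>?Q\<^esub>)" by (simp add: Q add.commute)
    also have "\<dots> = add_pow S (Suc k) \<one>\<^bsub>S\<^esub>"
      using Suc h.hom_add[of "of_nat k" "\<one>\<^bsub>?Q\<^esub>"] by (simp add: Q(1) h.S.add.nat_pow_Suc)
    finally show ?case .
  qed
  have "h (of_nat c) \<otimes>\<^bsub>S\<^esub> h (1 / of_nat c) = h (of_nat c \<otimes>\<^bsub>?Q\<^esub> (1 / of_nat c))"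
    by (rule h.hom_mult[symmetric]) (simp_all add: Q)
  also have "\<dots> = \<one>\<^bsub>S\<^esub>" using c h.hom_one by (simp add: Q)
  finally show ?thesis
    unfolding nat using h.hom_closed[of "1 / of_nat c"] by (intro bexI) (auto simp: Q)
qed

lemma Q_scheme_rational_sections:
  assumes "Q_scheme \<X>" and c: "0 < (c::nat)"
  shows "\<exists>u\<in>carrier (sections \<X> (topspace (base \<X>))).
    add_pow (sections \<X> (topspace (base \<X>))) c \<one>\<^bsub>sections \<X> (topspace (base \<X>))\<^esub>
      \<otimes>\<^bsub>sections \<X> (topspace (base \<X>))\<^esub> u = \<one>\<^bsub>sections \<X> (topspace (base \<X>))\<^esub>"
proof -
  let ?Q = "ring_of_type_algebra :: rat ring"
  let ?S = "sections \<X> (topspace (base \<X>))"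
  obtain f \<phi> where m: "lrs_morphism \<X> (spec ?Q) f \<phi>" using assms(1) unfolding Q_scheme_def by blast
  let ?Z = "topspace (zariski ?Q)"
  have base: "base (spec ?Q) = zariski ?Q" by (simp add: spec_def)
  have cont: "continuous_map (base \<X>) (zariski ?Q) f" using m unfolding lrs_morphism_def base by blast
  have "preimage (base \<X>) f ?Z = topspace (base \<X>)"
    using continuous_map_image_subset_topspace[OF cont] by (auto simp: preimage_def)
  then have sec: "sections (direct_image f (zariski ?Q) \<X>) ?Z = ?S" by (simp add: direct_image_def)
  have "\<phi> ?Z \<in> ring_hom (sections (spec ?Q) ?Z) (sections (direct_image f (zariski ?Q) \<X>) ?Z)"
    by (rule m[unfolded lrs_morphism_def base, THEN conjunct2, THEN conjunct1, THEN spec, THEN mp,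
          OF openin_topspace])
  then have "\<phi> ?Z \<circ> (\<lambda>a. cring.frac_section ?Q ?Z a \<one>\<^bsub>?Q\<^esub>) \<in> ring_hom ?Q ?S"
    unfolding sec by (rule ring_hom_trans[OF cring.frac_section_hom[OF cring_from_type_algebra openin_topspace]])
  moreover have "cring ?S"
    using assms(1) openin_topspace[of "base \<X>"]
    by (simp add: Q_scheme_def scheme_def locally_ringed_space_def sheaf_of_rings_def presheaf_of_rings_def)
  ultimately show ?thesis using rational_hom_inverse c by blast
qed

text \<open>
  For a point of a scheme, an affine open neighbourhood supplies the chart.
\<close>

lemma vector_field_schemeI:
  assumes Q: "Q_scheme \<X>" and red: "reduced \<X>" and vf: "vector_field \<X> D"
  shows "vector_field_scheme \<X> D"
proof -
  have sch: "scheme \<X>" using Q by (simp add: Q_scheme_def)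
  then have lrs: "locally_ringed_space \<X>" by (simp add: scheme_def)
  then have sh: "sheaf_of_rings \<X>" by (simp add: locally_ringed_space_def)
  interpret ringed_space \<X>
  proof unfold_locales
    show "presheaf_of_rings \<X>" using sh by (simp add: sheaf_of_rings_def)
  qed (rule sh)
  have charts: "\<exists>V (R :: 'b ring) \<rho> pr. x \<in> V \<and> affine_chart V R \<rho> pr"
    if x: "x \<in> topspace (base \<X>)" for x
  proof -
    obtain V where V: "opn V" "x \<in> V" "affine_scheme (open_restriction \<X> V)"
      using sch x unfolding scheme_def by blast
    then obtain R :: "'b ring" and f \<phi>
      where R: "cring R" "lrs_isomorphism (open_restriction \<X> V) (spec R) f \<phi>"
      unfolding affine_scheme_def by blast
    from affine_chart_of_iso[OF V(1) R] V(2) show ?thesis by blast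
  qed
  show ?thesis
  proof unfold_locales
    show "\<exists>V (R :: 'b ring) \<rho> pr. x \<in> V \<and> affine_chart V R \<rho> pr" if "x \<in> topspace (base \<X>)" for x
      by (rule charts[OF that])
    show "reduced \<X>" by (rule red)
    show "vector_field \<X> D" by (rule vf)
    show "local_ring (stalk \<X> x)" if "x \<in> topspace (base \<X>)" for x
      using lrs that by (simp add: locally_ringed_space_def)
  qed (rule Q_scheme_rational_sections[OF Q])
qed

theorem theorem5p1:
  fixes \<X> :: "('a, 'b) presheaf" and D :: "'a set \<Rightarrow> 'b \<Rightarrow> 'b"
  assumes "Q_scheme \<X>"
    and "reduced \<X>"
    and "vector_field \<X> D"
  shows "\<forall>U. openin (leaf_space \<X> D) U \<longrightarrow>
    constants (sections (keigher_sheaf \<X> D) U) (keigher_der \<X> D U) \<simeq>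
    constants (sections (carra_ferro_sheaf \<X> D) U) (carra_ferro_der \<X> D U)"
proof (intro allI impI)
  interpret vector_field_scheme \<X> D by (rule vector_field_schemeI[OF assms])
  fix U assume "openin (leaf_space \<X> D) U"
  then have "openin leaf_top U" by (simp add: leaf_space_def)
  from constants_iso[OF this]
  show "constants (sections (keigher_sheaf \<X> D) U) (keigher_der \<X> D U) \<simeq>
    constants (sections (carra_ferro_sheaf \<X> D) U) (carra_ferro_der \<X> D U)"
    by (simp add: carra_ferro_sheaf_def carra_ferro_der_def direct_image_def)
qed

end
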